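(* Let $X$ be a P-complex in $V$ with compact cells and let $S$ be a supercommutative ring. Let $r_p\in C^p(X,S)$ and $r_q\in C^q(X,S)$ be closed ($dr_p=0$, $dr_q=0$). Let $u,v\in V^*$ be convenient points, $u,v\in\mathcal{U}(X)$, both lying in one connected component $\mathcal{C}$ of $V^*\setminus D(X)$, where $D(X)$ is the discriminant of $X$. Then $r_p\smile_u r_q=r_p\smile_v r_q$.
   Context: $V$ is a real vector space of finite dimension $n$, $V^*$ its dual. P-complex: a finite set $X$ of closed convex polyhedra in $V$ (its cells) such that every face of a cell is a cell and every non-empty intersection of two cells is a common face of both. All cells are assumed compact. Cochains: $S$ is a supercommutative ring ($\mathbb{Z}/2$-graded, $ab=(-1)^{|a||b|}ba$ for homogeneous $a,b$). $C^p(X,S)$ is the module of functions from oriented $p$-dimensional cells to $S$ that change sign when the orientation of the cell is reversed; $d\colon C^p(X,S)\to C^{p+1}(X,S)$ is the usual coboundary: $(dr)(\mu)$ is the sum of $r$ over the facets of $\mu$ with induced boundary orientation (outward normal first). For a cell $\delta$, $V_\delta\subset V$ is the linear subspace generated by differences of points of $\delta$. For a cell $\gamma$, let $X_\gamma$ be the P-complex in $V_\gamma$ of faces of $\gamma$ ($\gamma$ translated into $V_\gamma$; the choice is immaterial). For a face $\delta$ of $\gamma$ the dual cone $\delta^*\subset (V_\gamma)^*$ consists of all $w\in(V_\gamma)^*$ for which the maximum of $w$ on $\gamma$ is attained at every point of $\delta$; $\dim\delta^*=\dim\gamma-\dim\delta$. These cones form the dual fan $X_\gamma^*$, with $j$-dimensional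 skeleton $(X_\gamma^* )^j$. Let $\pi_\gamma\colon V^*\to(V_\gamma)^*$ be the restriction map. Two P-complexes in a space are transversal if for any cells $\delta_1,\delta_2$ of them with $\delta_1\cap\delta_2\ne\emptyset$ one has $\operatorname{codim}(V_{\delta_1}\cap V_{\delta_2})=\operatorname{codim}V_{\delta_1}+\operatorname{codim}V_{\delta_2}$. A point $v\in V^*$ is $(p,q)$-convenient if $\pi_\gamma(v)+(X_\gamma^* )^q$ and $(X_\gamma^* )^p$ are transversal for every $\gamma\in X$ with $\dim\gamma=p+q$; $\mathcal{U}_{p,q}(X)$ is the set of such points, and $\mathcal{U}(X)=\bigcap_{p,q}\mathcal{U}_{p,q}(X)$ is the set of convenient points. Product: for $v\in\mathcal{U}_{p,q}(X)$ and an oriented cell $\gamma$ of dimension $p+q$, $(r_p\smile_v r_q)(\gamma)=\sum_{(\delta,\lambda)\in\mathcal{P}(p,q,\gamma,v)}r_p(\delta)r_q(\lambda)$, where $\mathcal{P}(p,q,\gamma,v)$ is the set of pairs $(\delta,\lambda)$ of faces of $\gamma$ of dimensions $p,q$ with $(\pi_\gamma(v)+\delta^* )\cap\lambda^*\neq\emptyset$, oriented so that $V_\gamma=V_\delta\oplus V_\lambda$ as oriented spaces. Discriminant: $\Lambda_{p,q}$ is the set of triples of cells $(\delta,\lambda,\mu)$ of dimensions $p,q,p+q$ with $\delta\cup\lambda\subset\mu$ and $\dim(V_\delta\cap V_\lambda)\ge1$. If $(\delta,\lambda,\mu)\in\Lambda_{p,q}$ for some $p,q$, $\dim(V_\delta\cap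 V_\lambda)=1$, and $\gamma$ is a $(p+q-1)$-dimensional face of $\mu$ with $\delta\cup\lambda\subset\gamma$, then $(\delta,\lambda,\gamma)$ is a special triple. Let $V^*_{\delta,\lambda}\subset V^*$ be the annihilator of $V_\delta\cap V_\lambda$. The discriminant $D(X)$ is the union of the hyperplanes $V^*_{\delta,\lambda}$ over all special triples. *)

theory Defs
  imports
    "HOL-Analysis.Analysis"
    "HOL-Library.Function_Algebras"
    "HOL-Library.Z2"
    "Jordan_Normal_Form.Determinant"
begin

text \<open>Together with the pointwise group structure of Function_Algebras this gives a home to the dual
  spaces of linear subspaces.\<close>

instantiation "fun" :: (type, real_vector) real_vector
begin

definition scaleR_fun_def: "scaleR c f = (\<lambda>x. c *\<^sub>R f x)"

instance
  by standard (simp_all add: scaleR_fun_def fun_eq_iff scaleR_add_right scaleR_add_left)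

end

text \<open>The empty set is a polyhedron and a face of every convex set in the library; it is not
  counted as a cell here.\<close>

definition faces :: "'a::real_vector set \<Rightarrow> 'a set set" where
  "faces c = {f. f face_of c \<and> f \<noteq> {}}"

definition P_complex :: "'a::euclidean_space set set \<Rightarrow> bool" where
  "P_complex X \<longleftrightarrow>
     finite X \<and>
     (\<forall>c\<in>X. polyhedron c \<and> c \<noteq> {}) \<and>
     (\<forall>c\<in>X. faces c \<subseteq> X) \<and>
     (\<forall>c\<in>X. \<forall>c'\<in>X. c \<inter> c' \<noteq> {} \<longrightarrow> c \<inter> c' \<in> faces c \<and> c \<inter> c' \<in> faces c')"

definition dir_space :: "'a::real_vector set \<Rightarrow> 'a set" where
  "dir_space c = span {x - y | x y. x \<in> c \<and> y \<in> c}"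

definition ordered_bases :: "'a::real_vector set \<Rightarrow> 'a list set" where
  "ordered_bases W = {bs. distinct bs \<and> independent (set bs) \<and> span (set bs) = W}"

text \<open>An orientation is given by the sign it assigns to each ordered basis. In dimension zero the
  only ordered basis is the empty list, which leaves the two orientations +1 and -1 of a point.
  The value 0 outside the ordered bases makes the representation unique.\<close>

type_synonym 'a orientation = "'a list \<Rightarrow> real"

definition is_orientation :: "'a::real_vector set \<Rightarrow> 'a orientation \<Rightarrow> bool" where
  "is_orientation W \<omega> \<longleftrightarrow>
     (\<forall>bs. bs \<in> ordered_bases W \<longrightarrow> \<omega> bs \<in> {-1, 1}) \<and>
     (\<forall>bs. bs \<notin> ordered_bases W \<longrightarrow> \<omega> bs = 0) \<and>
     (\<forall>bs\<in>ordered_bases W. \<forall>cs\<in>ordered_bases W. \<forall>A\<in>carrier_mat (length bs) (length bs).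
        (\<forall>j<length bs. cs ! j = (\<Sum>i<length bs. A $$ (i, j) *\<^sub>R (bs ! i)))
        \<longrightarrow> \<omega> cs = sgn (Determinant.det A) * \<omega> bs)"

definition oriented_cells ::
    "nat \<Rightarrow> 'a::euclidean_space set set \<Rightarrow> ('a set \<times> 'a orientation) set" where
  "oriented_cells p X =
     {(c, \<omega>). c \<in> X \<and> aff_dim c = int p \<and> is_orientation (dir_space c) \<omega>}"

text \<open>The vector n below is one that points from the interior of the cell out through the facet.
  Modulo the direction space of the facet it is a positive multiple of an outward normal, so the
  induced orientation does not depend on the choice and no inner product is needed.\<close>

definition boundary_orientation ::
    "'a::real_vector set \<Rightarrow> 'a orientation \<Rightarrow> 'a set \<Rightarrow> 'a orientation" where
  "boundary_orientation c \<omega> f = (\<lambda>bs.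
     if bs \<in> ordered_bases (dir_space f)
     then \<omega> ((SOME n. \<exists>x\<in>f. \<exists>y\<in>c - f. n = x - y) # bs) else 0)"

text \<open>The oriented space U is the direct sum of the oriented spaces W and W'. As orientations vanish
  exactly outside the ordered bases, the equation also forces the underlying spaces to form a direct
  sum.\<close>

definition oriented_direct_sum ::
    "'a::real_vector set \<Rightarrow> 'a orientation \<Rightarrow> 'a set \<Rightarrow> 'a orientation \<Rightarrow> 'a orientation \<Rightarrow> bool" where
  "oriented_direct_sum W \<omega> W' \<omega>' \<omega>U \<longleftrightarrow>
     (\<forall>bs\<in>ordered_bases W. \<forall>cs\<in>ordered_bases W'. \<omega>U (bs @ cs) = \<omega> bs * \<omega>' cs)"

definition supercommutative :: "(bit \<Rightarrow> 's::ring set) \<Rightarrow> bool" where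
  "supercommutative G \<longleftrightarrow>
     (\<forall>i. 0 \<in> G i \<and> (\<forall>a\<in>G i. \<forall>b\<in>G i. a - b \<in> G i)) \<and>
     (\<forall>s. \<exists>a\<in>G 0. \<exists>b\<in>G 1. s = a + b) \<and> G 0 \<inter> G 1 = {0} \<and>
     (\<forall>i j. \<forall>a\<in>G i. \<forall>b\<in>G j. a * b \<in> G (i + j)) \<and>
     (\<forall>i j. \<forall>a\<in>G i. \<forall>b\<in>G j. a * b = (if i = 1 \<and> j = 1 then - (b * a) else b * a))"

text \<open>A cochain is a function on oriented cells; its values elsewhere are irrelevant.\<close>

type_synonym ('a, 's) cochain = "'a set \<times> 'a orientation \<Rightarrow> 's"

definition cochains ::
    "nat \<Rightarrow> 'a::euclidean_space set set \<Rightarrow> ('a, 's::ring) cochain set" where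
  "cochains p X = {r. \<forall>(c, \<omega>)\<in>oriented_cells p X. r (c, \<lambda>bs. - \<omega> bs) = - r (c, \<omega>)}"

definition coboundary :: "('a::euclidean_space, 's::ring) cochain \<Rightarrow> ('a, 's) cochain" where
  "coboundary r = (\<lambda>(c, \<omega>). \<Sum>f | f facet_of c. r (f, boundary_orientation c \<omega> f))"

definition closed_cochain ::
    "nat \<Rightarrow> 'a::euclidean_space set set \<Rightarrow> ('a, 's::ring) cochain \<Rightarrow> bool" where
  "closed_cochain p X r \<longleftrightarrow> (\<forall>(c, \<omega>)\<in>oriented_cells (p + 1) X. coboundary r (c, \<omega>) = 0)"

text \<open>A linear functional on a subspace W is represented by its extension by zero to all of the
  ambient type; the restriction map is then multiplication by the indicator of W.\<close>

definition dual_space :: "'a::real_vector set \<Rightarrow> ('a \<Rightarrow> real) set" where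
  "dual_space W = {w.
     (\<forall>x\<in>W. \<forall>y\<in>W. w (x + y) = w x + w y) \<and>
     (\<forall>c. \<forall>x\<in>W. w (c *\<^sub>R x) = c * w x) \<and>
     (\<forall>x. x \<notin> W \<longrightarrow> w x = 0)}"

definition restr :: "'a::euclidean_space set \<Rightarrow> ('a \<Rightarrow>\<^sub>L real) \<Rightarrow> ('a \<Rightarrow> real)" where
  "restr \<gamma> v = (\<lambda>x. if x \<in> dir_space \<gamma> then blinfun_apply v x else 0)"

text \<open>The point a serves to translate the cell into its direction space.\<close>

definition dual_cone :: "'a::real_vector set \<Rightarrow> 'a set \<Rightarrow> ('a \<Rightarrow> real) set" where
  "dual_cone \<gamma> \<delta> =
     {w \<in> dual_space (dir_space \<gamma>). \<forall>a\<in>\<gamma>. \<forall>x\<in>\<delta>. \<forall>y\<in>\<gamma>. w (y - a) \<le> w (x - a)}"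

definition dual_fan :: "'a::real_vector set \<Rightarrow> ('a \<Rightarrow> real) set set" where
  "dual_fan \<gamma> = dual_cone \<gamma> ` faces \<gamma>"

definition skeleton :: "nat \<Rightarrow> 'b::real_vector set set \<Rightarrow> 'b set set" where
  "skeleton j Y = {c \<in> Y. dim (dir_space c) \<le> j}"

definition translate_complex :: "'b::real_vector \<Rightarrow> 'b set set \<Rightarrow> 'b set set" where
  "translate_complex t Y = (\<lambda>c. (+) t ` c) ` Y"

definition codim_in :: "'b::real_vector set \<Rightarrow> 'b set \<Rightarrow> int" where
  "codim_in W U = int (dim W) - int (dim U)"

definition transversal_in :: "'b::real_vector set \<Rightarrow> 'b set set \<Rightarrow> 'b set set \<Rightarrow> bool" where
  "transversal_in W Y Z \<longleftrightarrow>
     (\<forall>c\<in>Y. \<forall>c'\<in>Z. c \<inter> c' \<noteq> {} \<longrightarrow>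
        codim_in W (dir_space c \<inter> dir_space c')
          = codim_in W (dir_space c) + codim_in W (dir_space c'))"

definition convenient_pq ::
    "nat \<Rightarrow> nat \<Rightarrow> 'a::euclidean_space set set \<Rightarrow> ('a \<Rightarrow>\<^sub>L real) set" where
  "convenient_pq p q X = {v. \<forall>\<gamma>\<in>X. aff_dim \<gamma> = int (p + q) \<longrightarrow>
     transversal_in (dual_space (dir_space \<gamma>))
       (translate_complex (restr \<gamma> v) (skeleton q (dual_fan \<gamma>))) (skeleton p (dual_fan \<gamma>))}"

definition convenient :: "'a::euclidean_space set set \<Rightarrow> ('a \<Rightarrow>\<^sub>L real) set" where
  "convenient X = (\<Inter>p q. convenient_pq p q X)"

definition cup_pairs ::
    "nat \<Rightarrow> nat \<Rightarrow> 'a::euclidean_space set \<Rightarrow> ('a \<Rightarrow>\<^sub>L real) \<Rightarrow> ('a set \<times> 'a set) set" where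
  "cup_pairs p q \<gamma> v = {(\<delta>, l). \<delta> \<in> faces \<gamma> \<and> l \<in> faces \<gamma> \<and>
     aff_dim \<delta> = int p \<and> aff_dim l = int q \<and>
     ((+) (restr \<gamma> v) ` dual_cone \<gamma> \<delta>) \<inter> dual_cone \<gamma> l \<noteq> {}}"

text \<open>For convenient v the two direction spaces are complementary, so compatible orientations exist;
  there are two such pairs, differing by a simultaneous reversal, and on cochains they give the same
  product.\<close>

definition cup ::
    "nat \<Rightarrow> nat \<Rightarrow> ('a::euclidean_space \<Rightarrow>\<^sub>L real) \<Rightarrow> ('a, 's::ring) cochain \<Rightarrow> ('a, 's) cochain
      \<Rightarrow> ('a, 's) cochain" where
  "cup p q v rp rq = (\<lambda>(\<gamma>, \<omega>). \<Sum>(\<delta>, l)\<in>cup_pairs p q \<gamma> v.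
     let (\<omega>\<delta>, \<omega>l) = (SOME (\<alpha>, \<beta>).
           is_orientation (dir_space \<delta>) \<alpha> \<and> is_orientation (dir_space l) \<beta> \<and>
           oriented_direct_sum (dir_space \<delta>) \<alpha> (dir_space l) \<beta> \<omega>)
     in rp (\<delta>, \<omega>\<delta>) * rq (l, \<omega>l))"

definition Lambda ::
    "nat \<Rightarrow> nat \<Rightarrow> 'a::euclidean_space set set \<Rightarrow> ('a set \<times> 'a set \<times> 'a set) set" where
  "Lambda p q X = {(\<delta>, l, \<mu>). \<delta> \<in> X \<and> l \<in> X \<and> \<mu> \<in> X \<and>
     aff_dim \<delta> = int p \<and> aff_dim l = int q \<and> aff_dim \<mu> = int (p + q) \<and>
     \<delta> \<union> l \<subseteq> \<mu> \<and> 1 \<le> dim (dir_space \<delta> \<inter> dir_space l)}"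

definition special_triples ::
    "'a::euclidean_space set set \<Rightarrow> ('a set \<times> 'a set \<times> 'a set) set" where
  "special_triples X = {(\<delta>, l, \<gamma>). \<exists>p q \<mu>. (\<delta>, l, \<mu>) \<in> Lambda p q X \<and>
     dim (dir_space \<delta> \<inter> dir_space l) = 1 \<and>
     \<gamma> \<in> faces \<mu> \<and> aff_dim \<gamma> = int (p + q) - 1 \<and> \<delta> \<union> l \<subseteq> \<gamma>}"

definition ann :: "'a::euclidean_space set \<Rightarrow> ('a \<Rightarrow>\<^sub>L real) set" where
  "ann U = {w. \<forall>x\<in>U. blinfun_apply w x = 0}"

definition discriminant :: "'a::euclidean_space set set \<Rightarrow> ('a \<Rightarrow>\<^sub>L real) set" where
  "discriminant X = (\<Union>(\<delta>, l, \<gamma>)\<in>special_triples X. ann (dir_space \<delta> \<inter> dir_space l))"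

end

theory Submission
  imports Defs
begin

text \<open>Fix a cell \<open>\<gamma>\<close> of dimension \<open>p + q\<close> and identify functionals on \<open>dir_space \<gamma>\<close> with vectors. A pair
  of faces \<open>(\<delta>, l)\<close> occurs in the product for \<open>a\<close> iff \<open>\<delta> \<times> l\<close> lies in the maximal face on \<open>\<gamma> \<times> \<gamma>\<close> of
  \<open>(x, y) \<mapsto> w (x + y) - a x\<close> for some \<open>w\<close>. Let \<open>a\<close> move along a generic segment. For a face \<open>F\<close> of
  \<open>\<gamma> \<times> \<gamma>\<close> of dimension \<open>p + q + 1\<close> at most one point \<open>(t, w)\<close> makes \<open>F\<close> maximal, and for a face of
  dimension \<open>p + q\<close> these points form a segment, whose ends are either at \<open>t = 0, 1\<close> or come from faces of
  dimension \<open>p + q + 1\<close>. The segment could only be unbounded if \<open>\<delta>\<close> and \<open>l\<close> lay in a common facet of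
  \<open>\<gamma>\<close> with \<open>a\<close> on the wall of that special triple, which is excluded off the discriminant. Hence the
  difference of the two products is a sum of values of the coboundary of the product cochain
  \<open>rp \<times> rq\<close>, which is closed.\<close>

subsection \<open>Orientations\<close>

text \<open>The square of \<open>\<gamma>\<close> enters through the sum map (x, y) -> x + y. Faces
  \<delta> and l of complementary dimensions have complementary direction spaces exactly when this
  map is injective on \<open>dir_space (\<delta> \<times> l)\<close>, and the orientation rule of
  the product then says that it preserves orientation. The obstacle is that convenience is known
  only at u and v. A path between them may cross walls where the two direction spaces share a line,
  but where they share a plane the maximal faces of the square become too large. So the vectors
  representing u and v on \<open>dir_space \<gamma>\<close> are each joined by a straight segment to
  a third vector m off finitely many hyperplanes: a shared plane is then impossible for t > 0, and
  convenience rules it out at t = 0. To keep both segments away from the discriminant, m is taken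
  from an open set on which its sign on every special line is that of u, which is also that of v.
  Between the ends the sum map may have a kernel on a maximal face. What survives is injectivity of
  the map \<open>L\<close>, which also records the dependence on t; this is why dimension p + q + 1
  occurs and no larger one.\<close>

definition lincomb :: "real mat \<Rightarrow> 'a::real_vector list \<Rightarrow> 'a list \<Rightarrow> bool" where
  "lincomb A bs cs \<longleftrightarrow> A \<in> carrier_mat (length bs) (length bs) \<and> length cs = length bs \<and>
     (\<forall>j<length bs. cs ! j = (\<Sum>i<length bs. A $$ (i, j) *\<^sub>R (bs ! i)))"

lemma ordered_bases_length:
  fixes bs :: "'a::euclidean_space list"
  assumes "bs \<in> ordered_bases W"
  shows "length bs = dim W"
  using assms unfolding ordered_bases_def
  by (metis (mono_tags, lifting) dim_eq_card distinct_card mem_Collect_eq span_span)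

lemma ordered_bases_subset: "bs \<in> ordered_bases W \<Longrightarrow> set bs \<subseteq> W"
  unfolding ordered_bases_def using span_superset by blast

lemma ordered_basesI:
  fixes cs :: "'a::euclidean_space list"
  assumes "subspace W" "set cs \<subseteq> W" "W \<subseteq> span (set cs)" "length cs \<le> dim W"
  shows "cs \<in> ordered_bases W"
proof -
  have s: "span (set cs) = W"
    using assms by (simp add: span_minimal subset_antisym)
  have "dim W \<le> card (set cs)"
    using assms(3) by (simp add: dim_le_card)
  then have c: "card (set cs) = length cs" "card (set cs) = dim W"
    using assms(4) card_length[of cs] by auto
  then have "distinct cs" by (simp add: card_distinct)
  moreover have "independent (set cs)"
    using c s by (metis List.finite_set card_le_dim_spanning assms(3) assms(2) order_refl)
  ultimately show ?thesis using s by (simp add: ordered_bases_def)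
qed

lemma ordered_bases_exists:
  fixes W :: "'a::euclidean_space set"
  assumes "subspace W"
  obtains bs where "bs \<in> ordered_bases W"
proof -
  obtain B where B: "B \<subseteq> W" "independent B" "W \<subseteq> span B" "card B = dim W"
    using basis_exists by blast
  then have "finite B" using independent_imp_finite by blast
  then obtain bs where "set bs = B" "distinct bs" using finite_distinct_list by blast
  with B assms show ?thesis
    by (intro that[of bs]) (auto intro!: ordered_basesI simp: distinct_card[symmetric])
qed

lemma span_list_sum:
  fixes bs :: "'a::real_vector list"
  assumes "x \<in> span (set bs)"
  shows "\<exists>f. x = (\<Sum>i<length bs. f i *\<^sub>R (bs ! i))"
  using assms
proof (induction rule: span_induct_alt)
  case base
  show ?case by (rule exI[of _ "\<lambda>_. 0"]) simp
next
  case (step c y z)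
  then obtain f k where f: "z = (\<Sum>i<length bs. f i *\<^sub>R (bs ! i))" and k: "k < length bs" "y = bs ! k"
    by (metis in_set_conv_nth)
  have "c *\<^sub>R y + z = (\<Sum>i<length bs. (if i = k then c *\<^sub>R (bs ! i) else 0) + f i *\<^sub>R (bs ! i))"
    using k by (simp add: sum.distrib f)
  also have "\<dots> = (\<Sum>i<length bs. (f i + (if i = k then c else 0)) *\<^sub>R (bs ! i))"
    by (intro sum.cong) (auto simp: scaleR_add_left)
  finally show ?case by (intro exI)
qed

lemma lincomb_exists:
  fixes bs :: "'a::euclidean_space list"
  assumes "bs \<in> ordered_bases W" "set cs \<subseteq> W" "length cs = length bs"
  obtains A where "lincomb A bs cs"
proof -
  have "\<exists>f. cs ! j = (\<Sum>i<length bs. f i *\<^sub>R (bs ! i))" if "j < length bs" for j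
    using assms that by (intro span_list_sum) (auto simp: ordered_bases_def)
  then obtain f where f: "\<And>j. j < length bs \<Longrightarrow> cs ! j = (\<Sum>i<length bs. f j i *\<^sub>R (bs ! i))"
    by metis
  show ?thesis
    by (rule that[of "mat (length bs) (length bs) (\<lambda>(i,j). f j i)"])
       (auto simp: lincomb_def f assms)
qed

lemma orientation_lincomb:
  fixes W :: "'a::euclidean_space set"
  assumes "is_orientation W \<omega>" "bs \<in> ordered_bases W" "cs \<in> ordered_bases W" "lincomb A bs cs"
  shows "\<omega> cs = sgn (Determinant.det A) * \<omega> bs"
  using assms unfolding is_orientation_def lincomb_def by blast

lemma orientation_values:
  assumes "is_orientation W \<omega>" "bs \<in> ordered_bases W"
  shows "\<omega> bs = 1 \<or> \<omega> bs = -1"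
  using assms unfolding is_orientation_def by blast

lemma orientation_zero:
  assumes "is_orientation W \<omega>" "bs \<notin> ordered_bases W"
  shows "\<omega> bs = 0"
  using assms unfolding is_orientation_def by blast

lemma orientation_uminus:
  assumes "is_orientation W \<omega>"
  shows "is_orientation W (\<lambda>bs. - \<omega> bs)"
  using assms unfolding is_orientation_def by (auto; metis)

lemma orientationI:
  fixes W :: "'a::euclidean_space set"
  assumes "\<And>bs. bs \<in> ordered_bases W \<Longrightarrow> \<omega> bs = 1 \<or> \<omega> bs = -1"
    and "\<And>bs. bs \<notin> ordered_bases W \<Longrightarrow> \<omega> bs = 0"
    and "\<And>bs cs A. bs \<in> ordered_bases W \<Longrightarrow> cs \<in> ordered_bases W \<Longrightarrow> lincomb A bs cs \<Longrightarrow>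
           \<omega> cs = sgn (Determinant.det A) * \<omega> bs"
  shows "is_orientation W \<omega>"
  unfolding is_orientation_def
proof (intro conjI ballI allI impI)
  fix bs cs A
  assume *: "bs \<in> ordered_bases W" "cs \<in> ordered_bases W" "A \<in> carrier_mat (length bs) (length bs)"
    "\<forall>j<length bs. cs ! j = (\<Sum>i<length bs. A $$ (i, j) *\<^sub>R bs ! i)"
  then have "lincomb A bs cs"
    unfolding lincomb_def by (simp add: ordered_bases_length)
  with * assms(3) show "\<omega> cs = sgn (Determinant.det A) * \<omega> bs" by blast
qed (use assms in auto)

lemma orientation_eq:
  fixes W :: "'a::euclidean_space set"
  assumes "is_orientation W \<omega>" "is_orientation W \<omega>'" "bs \<in> ordered_bases W" "\<omega> bs = \<omega>' bs"
  shows "\<omega> = \<omega>'"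
proof
  fix cs
  show "\<omega> cs = \<omega>' cs"
  proof (cases "cs \<in> ordered_bases W")
    case True
    then obtain A where "lincomb A bs cs"
      using lincomb_exists assms(3) ordered_bases_subset ordered_bases_length by metis
    with True show ?thesis
      using orientation_lincomb assms by metis
  qed (use assms orientation_zero in metis)
qed

lemma orientation_eq_or_uminus:
  fixes W :: "'a::euclidean_space set"
  assumes "is_orientation W \<omega>" "is_orientation W \<omega>'" "subspace W"
  shows "\<omega>' = \<omega> \<or> \<omega>' = (\<lambda>bs. - \<omega> bs)"
proof -
  obtain bs where bs: "bs \<in> ordered_bases W" using ordered_bases_exists assms(3) by blast
  then consider "\<omega>' bs = \<omega> bs" | "\<omega>' bs = - \<omega> bs"
    using orientation_values assms(1,2) by (metis add.inverse_inverse)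
  then show ?thesis
    using orientation_eq[OF assms(2,1) bs] orientation_eq[OF assms(2) orientation_uminus[OF assms(1)] bs]
    by cases auto
qed

lemma lincomb_trans:
  assumes "lincomb A bs cs" "lincomb B cs ds"
  shows "lincomb (A * B) bs ds"
proof -
  let ?n = "length bs"
  have c: "A \<in> carrier_mat ?n ?n" "B \<in> carrier_mat ?n ?n" "length cs = ?n" "length ds = ?n"
    using assms by (auto simp: lincomb_def)
  have "ds ! j = (\<Sum>i<?n. (A * B) $$ (i, j) *\<^sub>R (bs ! i))" if j: "j < ?n" for j
  proof -
    have "ds ! j = (\<Sum>k<?n. B $$ (k, j) *\<^sub>R (\<Sum>i<?n. A $$ (i, k) *\<^sub>R (bs ! i)))"
      using assms j c by (simp add: lincomb_def)
    also have "\<dots> = (\<Sum>k<?n. \<Sum>i<?n. (A $$ (i, k) * B $$ (k, j)) *\<^sub>R (bs ! i))"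
      by (simp add: scaleR_sum_right mult.commute)
    also have "\<dots> = (\<Sum>i<?n. (\<Sum>k<?n. A $$ (i, k) * B $$ (k, j)) *\<^sub>R (bs ! i))"
      by (subst sum.swap) (simp add: scaleR_sum_left)
    also have "\<dots> = (\<Sum>i<?n. (A * B) $$ (i, j) *\<^sub>R (bs ! i))"
      using c j by (intro sum.cong) (auto simp: scalar_prod_def atLeast0LessThan)
    finally show ?thesis .
  qed
  then show ?thesis using c by (auto simp: lincomb_def)
qed

lemma lincomb_unique:
  fixes bs :: "'a::euclidean_space list"
  assumes "bs \<in> ordered_bases W" "lincomb A bs cs" "lincomb B bs cs"
  shows "A = B"
proof (rule eq_matI)
  let ?n = "length bs"
  have c: "A \<in> carrier_mat ?n ?n" "B \<in> carrier_mat ?n ?n"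
    using assms by (auto simp: lincomb_def)
  then show "dim_row A = dim_row B" "dim_col A = dim_col B" by auto
  fix i j assume "i < dim_row B" "j < dim_col B"
  then have ij: "i < ?n" "j < ?n" using c by auto
  have ind: "independent (set bs)" "distinct bs" using assms by (auto simp: ordered_bases_def)
  have "(\<Sum>i<?n. (A $$ (i, j) - B $$ (i, j)) *\<^sub>R (bs ! i)) = cs ! j - cs ! j"
    using assms ij by (simp add: lincomb_def scaleR_diff_left sum_subtractf)
  then have z: "(\<Sum>i<?n. (A $$ (i, j) - B $$ (i, j)) *\<^sub>R (bs ! i)) = 0" by simp
  define ix where "ix x = (THE i. i < ?n \<and> bs ! i = x)" for x
  have ix: "ix (bs ! i) = i" if "i < ?n" for i
    unfolding ix_def using that ind(2) by (auto simp: nth_eq_iff_index_eq)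
  have "bij_betw (\<lambda>i. bs ! i) {..<?n} (set bs)" using ind(2) by (intro bij_betw_nth) auto
  from sum.reindex_bij_betw[OF this, of "\<lambda>x. (A $$ (ix x, j) - B $$ (ix x, j)) *\<^sub>R x"]
  have "(\<Sum>x\<in>set bs. (A $$ (ix x, j) - B $$ (ix x, j)) *\<^sub>R x)
      = (\<Sum>i<?n. (A $$ (ix (bs ! i), j) - B $$ (ix (bs ! i), j)) *\<^sub>R (bs ! i))" by simp
  also have "\<dots> = (\<Sum>i<?n. (A $$ (i, j) - B $$ (i, j)) *\<^sub>R (bs ! i))"
    using ix by (intro sum.cong) auto
  finally have "(\<Sum>x\<in>set bs. (A $$ (ix x, j) - B $$ (ix x, j)) *\<^sub>R x)
      = (\<Sum>i<?n. (A $$ (i, j) - B $$ (i, j)) *\<^sub>R (bs ! i))" .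
  then have "\<forall>x\<in>set bs. A $$ (ix x, j) - B $$ (ix x, j) = 0"
    using ind(1) z independentD[OF ind(1), of "set bs" "\<lambda>x. A $$ (ix x, j) - B $$ (ix x, j)"] by auto
  then show "A $$ (i, j) = B $$ (i, j)"
    using ij ix by (metis eq_iff_diff_eq_0 nth_mem)
qed

lemma lincomb_one: "lincomb (1\<^sub>m (length bs)) bs bs"
proof -
  have "(\<Sum>i<length bs. (if i = j then 1 else 0) *\<^sub>R bs ! i) = bs ! j" if "j < length bs" for j
    using that by (simp add: if_distrib[of "\<lambda>c. c *\<^sub>R _"] cong: if_cong)
  then show ?thesis by (auto simp: lincomb_def)
qed

lemma lincomb_det_nonzero:
  fixes bs :: "'a::euclidean_space list"
  assumes "bs \<in> ordered_bases W" "cs \<in> ordered_bases W" "lincomb A bs cs"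
  shows "Determinant.det A \<noteq> 0"
proof -
  obtain B where B: "lincomb B cs bs"
    using lincomb_exists[OF assms(2)] assms ordered_bases_subset ordered_bases_length by metis
  have "A * B = 1\<^sub>m (length bs)"
    using lincomb_unique[OF assms(1) lincomb_trans[OF assms(3) B] lincomb_one] .
  moreover have "Determinant.det (A * B) = Determinant.det A * Determinant.det B"
    using assms(3) B by (intro det_mult[of _ "length bs"]) (auto simp: lincomb_def)
  ultimately have "Determinant.det A * Determinant.det B = 1" by simp
  then show ?thesis by auto
qed

text \<open>The sign of the transition determinant from \<open>bs\<close> works, because
  determinants are multiplicative along \<open>lincomb_trans\<close>.\<close>

lemma orientation_exists:
  fixes W :: "'a::euclidean_space set"
  assumes "bs \<in> ordered_bases W"
  obtains \<omega> where "is_orientation W \<omega>" "\<omega> bs = 1"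
proof -
  define M where "M cs = (SOME A. lincomb A bs cs)" for cs
  define \<omega> where "\<omega> cs = (if cs \<in> ordered_bases W then sgn (Determinant.det (M cs)) else 0)" for cs
  have M: "lincomb (M cs) bs cs" if "cs \<in> ordered_bases W" for cs
    unfolding M_def
    using lincomb_exists[OF assms, of cs] that assms ordered_bases_subset ordered_bases_length
    by (metis someI_ex)
  have "is_orientation W \<omega>"
  proof (rule orientationI)
    fix cs assume "cs \<in> ordered_bases W"
    then show "\<omega> cs = 1 \<or> \<omega> cs = -1"
      using lincomb_det_nonzero[OF assms _ M] by (auto simp: \<omega>_def sgn_if)
  next
    fix cs ds A assume *: "cs \<in> ordered_bases W" "ds \<in> ordered_bases W" "lincomb A cs ds"
    have "M ds = M cs * A"
      using lincomb_unique[OF assms M[OF *(2)] lincomb_trans[OF M[OF *(1)] *(3)]] .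
    moreover have "Determinant.det (M cs * A) = Determinant.det (M cs) * Determinant.det A"
      using * M[of cs] by (intro det_mult[of _ "length bs"]) (auto simp: lincomb_def)
    ultimately show "\<omega> ds = sgn (Determinant.det A) * \<omega> cs"
      using * by (simp add: \<omega>_def sgn_mult)
  qed (simp add: \<omega>_def)
  moreover have "M bs = 1\<^sub>m (length bs)"
    using lincomb_unique[OF assms M[OF assms] lincomb_one] .
  then have "\<omega> bs = 1" using assms by (simp add: \<omega>_def)
  ultimately show ?thesis by (rule that)
qed

lemma sum_lessThan_add:
  fixes f :: "nat \<Rightarrow> 'b::comm_monoid_add"
  shows "(\<Sum>i<n + m. f i) = (\<Sum>i<n. f i) + (\<Sum>i<m. f (n + i))"
  by (induction m) (auto simp: add.assoc)

lemma lincomb_append: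
  assumes "lincomb A bs cs" "lincomb B bs' cs'"
  obtains M where "lincomb M (bs @ bs') (cs @ cs')" "Determinant.det M = Determinant.det A * Determinant.det B"
proof -
  let ?n = "length bs" and ?m = "length bs'"
  define M where "M = four_block_mat A (0\<^sub>m ?n ?m) (0\<^sub>m ?m ?n) B"
  have c: "A \<in> carrier_mat ?n ?n" "B \<in> carrier_mat ?m ?m" "length cs = ?n" "length cs' = ?m"
    using assms by (auto simp: lincomb_def)
  have d: "Determinant.det M = Determinant.det A * Determinant.det B"
    unfolding M_def using c by (intro det_four_block_mat_upper_right_zero) auto
  have Mc: "M \<in> carrier_mat (?n + ?m) (?n + ?m)" unfolding M_def using c by auto
  have "(cs @ cs') ! j = (\<Sum>i<?n + ?m. M $$ (i, j) *\<^sub>R ((bs @ bs') ! i))" if j: "j < ?n + ?m" for j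
  proof -
    have "(\<Sum>i<?n + ?m. M $$ (i, j) *\<^sub>R ((bs @ bs') ! i))
       = (\<Sum>i<?n. M $$ (i, j) *\<^sub>R (bs ! i)) + (\<Sum>i<?m. M $$ (?n + i, j) *\<^sub>R (bs' ! i))"
      by (simp add: sum_lessThan_add nth_append)
    also have "\<dots> = (cs @ cs') ! j"
      using assms c j unfolding M_def
      by (cases "j < ?n") (auto simp: nth_append lincomb_def)
    finally show ?thesis by simp
  qed
  then have "lincomb M (bs @ bs') (cs @ cs')"
    using Mc c by (auto simp: lincomb_def)
  with d that show ?thesis by blast
qed


text \<open>Covers two changes of basis at once: altering the leading vector modulo the others
  (\<open>b = 0\<close>) and shearing the others along the leading vector (\<open>x = 0\<close>). In
  either case the block matrix is triangular, so its determinant is read off the diagonal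
  blocks.\<close>

lemma lincomb_Cons:
  assumes "lincomb A bs cs'" and "x \<in> span (set bs)" and "length cs = length bs"
    and "\<And>j. j < length bs \<Longrightarrow> cs ! j = cs' ! j + b j *\<^sub>R n"
  obtains M where "lincomb M (n # bs) ((c *\<^sub>R n + x) # cs)"
    "x = 0 \<or> b = (\<lambda>_. 0) \<Longrightarrow> Determinant.det M = c * Determinant.det A"
proof -
  let ?n = "length bs"
  \<comment> \<open>The coefficients of \<open>x\<close> are not unique here; for
    \<open>x = 0\<close> the zero ones are taken, so that the lower left block vanishes.\<close>
  obtain f where f: "x = (\<Sum>i<?n. f i *\<^sub>R (bs ! i))" "x = 0 \<Longrightarrow> f = (\<lambda>_. 0)"
  proof (cases "x = 0")
    case True
    then show ?thesis using that[of "\<lambda>_. 0"] by simp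
  next
    case False
    then show ?thesis using that span_list_sum[OF assms(2)] by blast
  qed
  define M where "M = four_block_mat (mat 1 1 (\<lambda>_. c)) (mat 1 ?n (\<lambda>(i,j). b j)) (mat ?n 1 (\<lambda>(i,j). f i)) A"
  have A: "A \<in> carrier_mat ?n ?n" "length cs' = ?n" using assms by (auto simp: lincomb_def)
  have Mc: "M \<in> carrier_mat (Suc ?n) (Suc ?n)"
    using four_block_carrier_mat[of "mat 1 1 (\<lambda>_. c)" 1 1 A ?n ?n] A unfolding M_def by simp
  have d: "Determinant.det M = c * Determinant.det A" if "x = 0 \<or> b = (\<lambda>_. 0)"
  proof -
    have 1: "Determinant.det (mat 1 1 (\<lambda>_. c)) = c"
      using det_single[of "mat 1 1 (\<lambda>_. c)"] by simp
    from that show ?thesis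
    proof
      assume "x = 0"
      then have z: "mat ?n 1 (\<lambda>(i,j). f i) = 0\<^sub>m ?n 1" using f(2) by (intro eq_matI) auto
      show ?thesis unfolding M_def z using A
        by (subst det_four_block_mat_lower_left_zero[of _ 1 _ ?n]) (auto simp: 1[simplified])
    next
      assume "b = (\<lambda>_. 0)"
      then have z: "mat 1 ?n (\<lambda>(i,j). b j) = 0\<^sub>m 1 ?n" by (intro eq_matI) auto
      show ?thesis unfolding M_def z using A
        by (subst det_four_block_mat_upper_right_zero[of _ 1 _ ?n]) (auto simp: 1[simplified])
    qed
  qed
  have "((c *\<^sub>R n + x) # cs) ! j = (\<Sum>i<Suc ?n. M $$ (i, j) *\<^sub>R ((n # bs) ! i))" if j: "j < Suc ?n" for j
  proof (cases j)
    case 0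
    then show ?thesis
      using A by (subst sum.lessThan_Suc_shift) (auto simp: M_def f(1))
  next
    case (Suc k)
    then show ?thesis
      using A assms(1,4) j by (subst sum.lessThan_Suc_shift) (auto simp: M_def lincomb_def)
  qed
  then have "lincomb M (n # bs) ((c *\<^sub>R n + x) # cs)"
    using Mc assms(3) by (auto simp: lincomb_def)
  with d that show ?thesis by blast
qed

lemma ordered_bases_Cons_scale:
  fixes Y :: "'a::euclidean_space set"
  assumes "n # bs \<in> ordered_bases Y" "c \<noteq> 0" "n' - c *\<^sub>R n \<in> span (set bs)"
  shows "n' # bs \<in> ordered_bases Y"
proof (rule ordered_basesI)
  have Y: "Y = span (insert n (set bs))" using assms by (auto simp: ordered_bases_def)
  then show "subspace Y" by simp
  have n': "n' = c *\<^sub>R n + (n' - c *\<^sub>R n)" by simp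
  have "n' \<in> Y" unfolding Y
    by (subst n', intro span_add span_scale)
       (use assms(3) span_mono[of "set bs" "insert n (set bs)"] in \<open>auto simp: span_base\<close>)
  then show "set (n' # bs) \<subseteq> Y" using Y by (auto intro: span_base)
  have n: "n = inverse c *\<^sub>R n' - inverse c *\<^sub>R (n' - c *\<^sub>R n)"
    using assms(2) by (simp add: scaleR_diff_right)
  have "n' - c *\<^sub>R n \<in> span (set (n' # bs))"
    using assms(3) span_mono[of "set bs" "insert n' (set bs)"] by auto
  then have "n \<in> span (set (n' # bs))"
    by (subst n) (simp add: span_diff span_scale span_base)
  then show "Y \<subseteq> span (set (n' # bs))" unfolding Y
    by (intro span_minimal) (auto simp: span_base)
  show "length (n' # bs) \<le> dim Y" using ordered_bases_length[OF assms(1)] by simp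
qed

text \<open>Only the coefficient of \<open>n\<close> modulo the span of the remaining vectors
  matters. This is behind the independence of the induced orientation from the outward vector and
  behind \<open>\<Omega>_normal\<close>.\<close>

lemma orientation_Cons_scale:
  fixes Y :: "'a::euclidean_space set"
  assumes "is_orientation Y \<omega>" "n # bs \<in> ordered_bases Y" "c \<noteq> 0" "n' - c *\<^sub>R n \<in> span (set bs)"
  shows "\<omega> (n' # bs) = sgn c * \<omega> (n # bs)"
proof -
  obtain M where M: "lincomb M (n # bs) ((c *\<^sub>R n + (n' - c *\<^sub>R n)) # bs)"
      "Determinant.det M = c * Determinant.det (1\<^sub>m (length bs) :: real mat)"
    using lincomb_Cons[OF lincomb_one assms(4), of bs "\<lambda>_. 0" n c] by auto
  then show ?thesis
    using orientation_lincomb[OF assms(1,2) ordered_bases_Cons_scale[OF assms(2-4)]] by simp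
qed

lemma ordered_bases_Cons_shear:
  fixes Y :: "'a::euclidean_space set"
  assumes "n # bs \<in> ordered_bases Y" "length cs = length bs"
    and "\<And>j. j < length bs \<Longrightarrow> cs ! j = bs ! j + b j *\<^sub>R n"
  shows "n # cs \<in> ordered_bases Y"
proof (rule ordered_basesI)
  have Y: "Y = span (insert n (set bs))" using assms by (auto simp: ordered_bases_def)
  then show "subspace Y" by simp
  have "cs ! j \<in> Y" if "j < length bs" for j
    unfolding Y using assms(3)[OF that] that by (simp add: span_add span_scale span_base)
  then show "set (n # cs) \<subseteq> Y"
    using assms(2) Y by (auto simp: in_set_conv_nth) (auto intro: span_base)
  have "bs ! j \<in> span (insert n (set cs))" if "j < length bs" for j
  proof -
    have "bs ! j = cs ! j - b j *\<^sub>R n" using assms that by simp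
    then show ?thesis using that assms(2) by (metis insertCI nth_mem span_base span_diff span_scale)
  qed
  then show "Y \<subseteq> span (set (n # cs))" unfolding Y
    by (intro span_minimal) (auto simp: span_base in_set_conv_nth)
  show "length (n # cs) \<le> dim Y" using ordered_bases_length[OF assms(1)] assms(2) by simp
qed

text \<open>Serves to replace \<open>L\<close> by \<open>(0, \<pi>)\<close> behind the leading
  vector \<open>(1, 0)\<close>, from which it differs by multiples of that vector.\<close>

lemma orientation_Cons_shear:
  fixes Y :: "'a::euclidean_space set"
  assumes "is_orientation Y \<omega>" "n # bs \<in> ordered_bases Y" "length cs = length bs"
    and "\<And>j. j < length bs \<Longrightarrow> cs ! j = bs ! j + b j *\<^sub>R n"
  shows "\<omega> (n # cs) = \<omega> (n # bs)"
proof -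
  obtain M where M: "lincomb M (n # bs) ((1 *\<^sub>R n + 0) # cs)"
      "Determinant.det M = 1 * Determinant.det (1\<^sub>m (length bs) :: real mat)"
    using lincomb_Cons[OF lincomb_one span_zero assms(3,4), where c = 1] by auto
  then show ?thesis
    using orientation_lincomb[OF assms(1,2) ordered_bases_Cons_shear[OF assms(2-4)]] by simp
qed

lemma orientation_swap:
  fixes Y :: "'a::euclidean_space set"
  assumes "is_orientation Y \<omega>"
  shows "\<omega> (as @ x # y # bs) = - \<omega> (as @ y # x # bs)"
proof (cases "as @ x # y # bs \<in> ordered_bases Y")
  case True
  then have 2: "as @ y # x # bs \<in> ordered_bases Y"
    by (auto simp: ordered_bases_def insert_commute)
  let ?as = "as @ x # y # bs" and ?k = "length as"
  define A :: "real mat" where "A = swaprows_mat (length ?as) ?k (Suc ?k)"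
  have "(as @ y # x # bs) ! j = (\<Sum>i<length ?as. A $$ (i, j) *\<^sub>R (?as ! i))" if j: "j < length ?as" for j
  proof -
    define j' where "j' = (if j = ?k then Suc ?k else if j = Suc ?k then ?k else j)"
    have "(\<Sum>i<length ?as. A $$ (i, j) *\<^sub>R (?as ! i)) = (\<Sum>i<length ?as. if i = j' then ?as ! i else 0)"
      using j by (intro sum.cong) (auto simp: A_def j'_def)
    also have "\<dots> = ?as ! j'" using j by (auto simp: j'_def)
    also have "\<dots> = (as @ y # x # bs) ! j" by (auto simp: j'_def nth_append nth_Cons split: nat.splits)
    finally show ?thesis by simp
  qed
  then have "lincomb A ?as (as @ y # x # bs)" by (auto simp: lincomb_def A_def)
  moreover have "Determinant.det A = -1" unfolding A_def by (rule det_swaprows_mat) auto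
  ultimately show ?thesis using orientation_lincomb[OF assms True 2] by simp
next
  case False
  then have "as @ y # x # bs \<notin> ordered_bases Y"
    by (auto simp: ordered_bases_def insert_commute)
  with False show ?thesis using orientation_zero[OF assms] by simp
qed

text \<open>One transposition for each vector passed; this is the origin of the sign in
  \<open>splits_boundary_right\<close>.\<close>

lemma orientation_move:
  fixes Y :: "'a::euclidean_space set"
  assumes "is_orientation Y \<omega>"
  shows "\<omega> (ps @ x # as @ bs) = (-1) ^ length as * \<omega> (ps @ as @ x # bs)"
proof (induction as arbitrary: ps)
  case (Cons a as)
  have "\<omega> (ps @ x # (a # as) @ bs) = - \<omega> ((ps @ [a]) @ x # as @ bs)"
    using orientation_swap[OF assms, of ps x a "as @ bs"] by simp
  also have "\<dots> = - ((-1) ^ length as * \<omega> ((ps @ [a]) @ as @ x # bs))"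
    by (subst Cons.IH) simp
  finally show ?case by simp
qed simp

section \<open>Pull-backs, contractions and products of orientations\<close>

definition pull_orientation ::
    "'b::real_vector orientation \<Rightarrow> ('a::real_vector \<Rightarrow> 'b) \<Rightarrow> 'a set \<Rightarrow> 'a orientation" where
  "pull_orientation \<omega> f V = (\<lambda>bs. if bs \<in> ordered_bases V then \<omega> (map f bs) else 0)"

lemma ordered_bases_map:
  fixes f :: "'a::euclidean_space \<Rightarrow> 'b::euclidean_space"
  assumes "linear f" "inj_on f V" "bs \<in> ordered_bases V"
  shows "map f bs \<in> ordered_bases (f ` V)"
proof -
  have V: "V = span (set bs)" "independent (set bs)" "distinct bs"
    using assms by (auto simp: ordered_bases_def)
  have "inj_on f (set bs)" using assms(2) V(1) span_superset by (metis inj_on_subset)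
  moreover have "independent (f ` set bs)"
    using linear_independent_injective_image[OF assms(1) V(2)] assms(2) V(1) by simp
  moreover have "span (f ` set bs) = f ` V"
    using linear_span_image[OF assms(1)] V(1) by metis
  ultimately show ?thesis using V(3) by (simp add: ordered_bases_def distinct_map)
qed

lemma lincomb_map:
  assumes "linear f" "lincomb A bs cs"
  shows "lincomb A (map f bs) (map f cs)"
  using assms by (auto simp: lincomb_def linear_sum linear_scale)

lemma is_orientation_pull:
  fixes f :: "'a::euclidean_space \<Rightarrow> 'b::euclidean_space"
  assumes "linear f" "inj_on f V" "is_orientation (f ` V) \<omega>"
  shows "is_orientation V (pull_orientation \<omega> f V)"
proof (rule orientationI)
  fix bs assume "bs \<in> ordered_bases V"
  then show "pull_orientation \<omega> f V bs = 1 \<or> pull_orientation \<omega> f V bs = -1"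
    using orientation_values[OF assms(3) ordered_bases_map[OF assms(1,2)]]
    by (simp add: pull_orientation_def)
next
  fix bs cs A assume "bs \<in> ordered_bases V" "cs \<in> ordered_bases V" "lincomb A bs cs"
  then show "pull_orientation \<omega> f V cs = sgn (Determinant.det A) * pull_orientation \<omega> f V bs"
    using orientation_lincomb[OF assms(3) ordered_bases_map[OF assms(1,2)]
        ordered_bases_map[OF assms(1,2)] lincomb_map[OF assms(1)]]
    by (simp add: pull_orientation_def)
qed (simp add: pull_orientation_def)

text \<open>Contraction with a fixed leading vector: an induced boundary orientation is the case of
  an outward vector and the identity map, \<open>\<Theta>\<close> the case of a normal vector and
  the map \<open>L\<close>.\<close>

lemma orientation_contract:
  fixes f :: "'a::euclidean_space \<Rightarrow> 'b::euclidean_space"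
  assumes "linear f" "is_orientation Y \<Omega>" "\<And>bs. bs \<in> ordered_bases V \<Longrightarrow> n # map f bs \<in> ordered_bases Y"
  shows "is_orientation V (\<lambda>bs. if bs \<in> ordered_bases V then \<Omega> (n # map f bs) else 0)"
proof (rule orientationI, goal_cases)
  case (1 bs)
  then show ?case using orientation_values[OF assms(2) assms(3)] by simp
next
  case (3 bs cs A)
  note * = lincomb_map[OF assms(1) 3(3)]
  obtain M where "lincomb M (n # map f bs) ((1 *\<^sub>R n + 0) # map f cs)"
    "Determinant.det M = 1 * Determinant.det A"
    using lincomb_Cons[OF * span_zero, of "map f cs" "\<lambda>_. 0" n 1] 3(3) by (auto simp: lincomb_def)
  then show ?case
    using orientation_lincomb[OF assms(2) assms(3)[OF 3(1)] assms(3)[OF 3(2)]] 3 by simp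
qed simp

definition product_basis :: "'a::zero list \<Rightarrow> 'b::zero list \<Rightarrow> ('a \<times> 'b) list" where
  "product_basis bs cs = map (\<lambda>x. (x, 0)) bs @ map (\<lambda>y. (0, y)) cs"

lemma span_product_basis:
  fixes bs :: "'a::real_vector list" and cs :: "'b::real_vector list"
  shows "span (set (product_basis bs cs)) = span (set bs) \<times> span (set cs)"
proof -
  have l: "linear (\<lambda>x::'a. (x, 0::'b))" "linear (\<lambda>y::'b. (0::'a, y))"
    by (auto intro!: linearI)
  have "span (set (product_basis bs cs)) =
      {x + y |x y. x \<in> (\<lambda>x. (x, 0)) ` span (set bs) \<and> y \<in> (\<lambda>y. (0, y)) ` span (set cs)}"
    by (simp add: product_basis_def span_Un linear_span_image[OF l(1)] linear_span_image[OF l(2)])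
  also have "\<dots> = span (set bs) \<times> span (set cs)" by force
  finally show ?thesis .
qed

lemma ordered_bases_product:
  fixes V :: "'a::euclidean_space set" and V' :: "'b::euclidean_space set"
  assumes "bs \<in> ordered_bases V" "cs \<in> ordered_bases V'"
  shows "product_basis bs cs \<in> ordered_bases (V \<times> V')"
proof (rule ordered_basesI)
  have V: "V = span (set bs)" "V' = span (set cs)" using assms by (auto simp: ordered_bases_def)
  then have s: "subspace V" "subspace V'" by auto
  then show "subspace (V \<times> V')" by (rule subspace_Times)
  show "V \<times> V' \<subseteq> span (set (product_basis bs cs))" by (simp add: span_product_basis V)
  then show "set (product_basis bs cs) \<subseteq> V \<times> V'"
    by (metis V span_product_basis span_superset)
  show "length (product_basis bs cs) \<le> dim (V \<times> V')"
    using ordered_bases_length[OF assms(1)] ordered_bases_length[OF assms(2)]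
    by (simp add: product_basis_def dim_Times[OF s])
qed

lemma orientation_product_lincomb:
  fixes V :: "'a::euclidean_space set" and V' :: "'b::euclidean_space set"
  assumes "is_orientation (V \<times> V') \<Omega>" "bs \<in> ordered_bases V" "cs \<in> ordered_bases V'"
    "bs' \<in> ordered_bases V" "cs' \<in> ordered_bases V'" "lincomb A bs bs'" "lincomb B cs cs'"
  shows "\<Omega> (product_basis bs' cs') =
    sgn (Determinant.det A) * sgn (Determinant.det B) * \<Omega> (product_basis bs cs)"
proof -
  have l: "linear (\<lambda>x::'a. (x, 0::'b))" "linear (\<lambda>y::'b. (0::'a, y))"
    by (auto intro!: linearI)
  obtain M where "lincomb M (product_basis bs cs) (product_basis bs' cs')"
      "Determinant.det M = Determinant.det A * Determinant.det B"
    unfolding product_basis_def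
    using lincomb_append[OF lincomb_map[OF l(1) assms(6)] lincomb_map[OF l(2) assms(7)]] by blast
  then show ?thesis
    using orientation_lincomb[OF assms(1) ordered_bases_product ordered_bases_product] assms
    by (simp add: sgn_mult)
qed

text \<open>External counterpart of \<open>oriented_direct_sum\<close>. Including the two
  orientation conditions makes a choice from this predicate comparable with the choice made in
  \<open>cup\<close>.\<close>

definition splits ::
    "'a::real_vector set \<Rightarrow> 'a orientation \<Rightarrow> 'b::real_vector set \<Rightarrow> 'b orientation
      \<Rightarrow> ('a \<times> 'b) orientation \<Rightarrow> bool" where
  "splits V \<alpha> V' \<beta> \<Omega> \<longleftrightarrow> is_orientation V \<alpha> \<and> is_orientation V' \<beta> \<and>
     (\<forall>bs\<in>ordered_bases V. \<forall>cs\<in>ordered_bases V'. \<Omega> (product_basis bs cs) = \<alpha> bs * \<beta> cs)"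

lemma splits_exists:
  fixes V :: "'a::euclidean_space set" and V' :: "'b::euclidean_space set"
  assumes "is_orientation (V \<times> V') \<Omega>" "subspace V" "subspace V'"
  obtains \<alpha> \<beta> where "splits V \<alpha> V' \<beta> \<Omega>"
proof -
  obtain bs0 cs0 where b: "bs0 \<in> ordered_bases V" "cs0 \<in> ordered_bases V'"
    using ordered_bases_exists assms(2,3) by metis
  define s where "s = \<Omega> (product_basis bs0 cs0)"
  have s: "s = 1 \<or> s = -1" unfolding s_def
    using orientation_values[OF assms(1) ordered_bases_product] b by blast
  define \<alpha> where "\<alpha> bs = (if bs \<in> ordered_bases V then \<Omega> (product_basis bs cs0) else 0)" for bs
  \<comment> \<open>As \<open>\<alpha> bs0 = s\<close>, the factor \<open>s\<close> makes
    \<open>\<beta> cs0 = s * s = 1\<close>, so the product is right on the reference bases.\<close>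
  define \<beta> where "\<beta> cs = (if cs \<in> ordered_bases V' then s * \<Omega> (product_basis bs0 cs) else 0)" for cs
  have "is_orientation V \<alpha>"
  proof (rule orientationI)
    fix bs cs A assume "bs \<in> ordered_bases V" "cs \<in> ordered_bases V" "lincomb A bs cs"
    then show "\<alpha> cs = sgn (Determinant.det A) * \<alpha> bs"
      using orientation_product_lincomb[OF assms(1) _ b(2) _ b(2) _ lincomb_one] by (simp add: \<alpha>_def)
  qed (use orientation_values[OF assms(1) ordered_bases_product] b in \<open>auto simp: \<alpha>_def\<close>)
  moreover have "is_orientation V' \<beta>"
  proof (rule orientationI)
    fix bs cs A assume "bs \<in> ordered_bases V'" "cs \<in> ordered_bases V'" "lincomb A bs cs"
    then show "\<beta> cs = sgn (Determinant.det A) * \<beta> bs"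
      using orientation_product_lincomb[OF assms(1) b(1) _ b(1) _ lincomb_one] by (simp add: \<beta>_def)
  next
    fix bs assume "bs \<in> ordered_bases V'"
    then show "\<beta> bs = 1 \<or> \<beta> bs = -1"
      using s orientation_values[OF assms(1) ordered_bases_product[OF b(1)]] by (force simp: \<beta>_def)
  qed (simp add: \<beta>_def)
  moreover have "\<Omega> (product_basis bs cs) = \<alpha> bs * \<beta> cs"
    if *: "bs \<in> ordered_bases V" "cs \<in> ordered_bases V'" for bs cs
  proof -
    obtain A B where AB: "lincomb A bs0 bs" "lincomb B cs0 cs"
      using lincomb_exists b * ordered_bases_subset ordered_bases_length by metis
    have "s * s = 1" using s by auto
    then show ?thesis
      using orientation_product_lincomb[OF assms(1) b * AB]
        orientation_product_lincomb[OF assms(1) b *(1) b(2) AB(1) lincomb_one]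
        orientation_product_lincomb[OF assms(1) b b(1) *(2) lincomb_one AB(2)] *
      by (simp add: \<alpha>_def \<beta>_def s_def[symmetric] algebra_simps)
  qed
  ultimately show ?thesis using that unfolding splits_def by blast
qed

text \<open>A product of signs determines its factors up to reversing both. Such a double reversal
  does not change a product of two cochain values, which makes choices by \<open>SOME\<close>
  harmless.\<close>

lemma splits_unique:
  fixes V :: "'a::euclidean_space set" and V' :: "'b::euclidean_space set"
  assumes "splits V \<alpha> V' \<beta> \<Omega>" "splits V \<alpha>' V' \<beta>' \<Omega>" "subspace V" "subspace V'"
  shows "\<alpha>' = \<alpha> \<and> \<beta>' = \<beta> \<or> \<alpha>' = (\<lambda>bs. - \<alpha> bs) \<and> \<beta>' = (\<lambda>cs. - \<beta> cs)"
proof -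
  obtain bs cs where b: "bs \<in> ordered_bases V" "cs \<in> ordered_bases V'"
    using ordered_bases_exists assms(3,4) by metis
  have o: "is_orientation V \<alpha>" "is_orientation V' \<beta>" "is_orientation V \<alpha>'" "is_orientation V' \<beta>'"
    using assms by (auto simp: splits_def)
  have v: "\<alpha> bs = 1 \<or> \<alpha> bs = -1" "\<beta> cs = 1 \<or> \<beta> cs = -1"
    using orientation_values o b by blast+
  have "\<alpha> bs * \<beta> cs = \<alpha>' bs * \<beta>' cs" using assms b by (metis splits_def)
  then show ?thesis
    using orientation_eq_or_uminus[OF o(1,3) assms(3)] orientation_eq_or_uminus[OF o(2,4) assms(4)] v
    by auto
qed

lemma splits_uminus:
  assumes "splits V \<alpha> V' \<beta> \<Omega>"
  shows "splits V (\<lambda>bs. - \<alpha> bs) V' \<beta> (\<lambda>bs. - \<Omega> bs)"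
  using assms orientation_uminus by (auto simp: splits_def)

subsection \<open>Polytopes and their facets\<close>

lemma dir_space_eq:
  assumes "x \<in> c"
  shows "dir_space c = span ((\<lambda>y. y - x) ` c)"
proof (rule subset_antisym)
  have "y - z \<in> span ((\<lambda>y. y - x) ` c)" if "y \<in> c" "z \<in> c" for y z
  proof -
    have "y - z = (y - x) - (z - x)" by simp
    then show ?thesis using that by (metis imageI span_base span_diff)
  qed
  then show "dir_space c \<subseteq> span ((\<lambda>y. y - x) ` c)"
    unfolding dir_space_def by (intro span_minimal) auto
  show "span ((\<lambda>y. y - x) ` c) \<subseteq> dir_space c"
    unfolding dir_space_def using assms by (intro span_mono) auto
qed

lemma subspace_dir_space [simp]: "subspace (dir_space c)"
  by (simp add: dir_space_def)

lemma span_dir_space [simp]: "span (dir_space c) = dir_space c"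
  by (simp add: dir_space_def)

lemma dir_space_mono: "c \<subseteq> d \<Longrightarrow> dir_space c \<subseteq> dir_space d"
  unfolding dir_space_def by (intro span_mono) auto

lemma diff_in_dir_space: "x \<in> c \<Longrightarrow> y \<in> c \<Longrightarrow> x - y \<in> dir_space c"
  unfolding dir_space_def by (intro span_base) auto

lemma aff_dim_dir_space:
  fixes c :: "'a::euclidean_space set"
  assumes "c \<noteq> {}"
  shows "aff_dim c = int (dim (dir_space c))"
proof -
  obtain x where x: "x \<in> c" using assms by blast
  have "(+) (- x) ` c = (\<lambda>y. y - x) ` c" by (auto simp: algebra_simps)
  then show ?thesis
    using aff_dim_eq_dim[of x c] x by (simp add: hull_inc dir_space_eq[OF x])
qed

lemma dir_space_Times:
  fixes c :: "'a::euclidean_space set" and d :: "'b::euclidean_space set"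
  assumes "c \<noteq> {}" "d \<noteq> {}"
  shows "dir_space (c \<times> d) = dir_space c \<times> dir_space d"
proof (rule subset_antisym)
  obtain x y where xy: "x \<in> c" "y \<in> d" using assms by blast
  show "dir_space (c \<times> d) \<subseteq> dir_space c \<times> dir_space d"
    unfolding dir_space_def[of "c \<times> d"]
    by (intro span_minimal) (auto intro: diff_in_dir_space subspace_Times)
  have l: "linear (\<lambda>x::'a. (x, 0::'b))" "linear (\<lambda>y::'b. (0::'a, y))"
    by (auto intro!: linearI)
  have "(\<lambda>x. (x, 0)) ` dir_space c \<subseteq> dir_space (c \<times> d)"
    unfolding dir_space_def[of c] linear_span_image[OF l(1), symmetric]
  proof (intro span_minimal, clarsimp)
    fix a b assume "a \<in> c" "b \<in> c"
    then show "(a - b, 0) \<in> dir_space (c \<times> d)"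
      using diff_in_dir_space[of "(a, y)" "c \<times> d" "(b, y)"] xy by simp
  qed simp
  moreover have "(\<lambda>y. (0, y)) ` dir_space d \<subseteq> dir_space (c \<times> d)"
    unfolding dir_space_def[of d] linear_span_image[OF l(2), symmetric]
  proof (intro span_minimal, clarsimp)
    fix a b assume "a \<in> d" "b \<in> d"
    then show "(0, a - b) \<in> dir_space (c \<times> d)"
      using diff_in_dir_space[of "(x, a)" "c \<times> d" "(x, b)"] xy by simp
  qed simp
  ultimately have "(a, 0) + (0, b) \<in> dir_space (c \<times> d)" if "a \<in> dir_space c" "b \<in> dir_space d" for a b
    using that by (intro subspace_add) auto
  then show "dir_space c \<times> dir_space d \<subseteq> dir_space (c \<times> d)" by auto
qed

section \<open>Maximal faces of linear functionals and outward vectors of facets\<close>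

definition argmax_on :: "('a \<Rightarrow> real) \<Rightarrow> 'a set \<Rightarrow> 'a set" where
  "argmax_on f Q = {x \<in> Q. \<forall>z\<in>Q. f z \<le> f x}"

lemma argmax_on_face_of:
  fixes f :: "'a::euclidean_space \<Rightarrow> real"
  assumes "linear f" "convex Q"
  shows "argmax_on f Q face_of Q"
proof (cases "argmax_on f Q = {}")
  case False
  then obtain x where x: "x \<in> Q" "\<forall>z\<in>Q. f z \<le> f x" by (auto simp: argmax_on_def)
  define a where "a = adjoint f 1"
  have a: "f z = inner a z" for z
    using adjoint_works[OF assms(1), of z 1] by (simp add: a_def inner_commute)
  have "argmax_on f Q = Q \<inter> {z. inner a z = inner a x}"
    using x unfolding argmax_on_def a by force
  then show ?thesis
    using face_of_Int_supporting_hyperplane_le[OF assms(2), of a "inner a x"] x a by auto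
qed simp

lemma argmax_on_nonempty:
  fixes f :: "'a::euclidean_space \<Rightarrow> real"
  assumes "linear f" "compact Q" "Q \<noteq> {}"
  shows "argmax_on f Q \<noteq> {}"
proof -
  have "continuous_on Q f"
    using assms(1) by (simp add: linear_continuous_on linear_conv_bounded_linear)
  then obtain x where "x \<in> Q" "\<forall>z\<in>Q. f z \<le> f x"
    using continuous_attains_sup[OF assms(2,3)] by blast
  then show ?thesis by (auto simp: argmax_on_def)
qed

lemma linear_zero_on_dir_space:
  fixes f :: "'a::real_vector \<Rightarrow> real"
  assumes "linear f" "\<And>x y. x \<in> c \<Longrightarrow> y \<in> c \<Longrightarrow> f x = f y" "v \<in> dir_space c"
  shows "f v = 0"
  using assms(3) unfolding dir_space_def
proof (induction rule: span_induct_alt)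
  case base
  show ?case by (rule linear_0[OF assms(1)])
next
  case (step k x y)
  then obtain a b where ab: "a \<in> c" "b \<in> c" "x = a - b" by blast
  have "f a = f b" using assms(2) ab(1,2) by blast
  then show ?case using step(2) ab(3)
    by (simp add: linear_add[OF assms(1)] linear_scale[OF assms(1)] linear_diff[OF assms(1)])
qed

lemma argmax_on_zero_dir_space:
  fixes f :: "'a::real_vector \<Rightarrow> real"
  assumes "linear f" "F \<subseteq> argmax_on f Q" "v \<in> dir_space F"
  shows "f v = 0"
proof (rule linear_zero_on_dir_space[OF assms(1) _ assms(3)])
  fix x y assume "x \<in> F" "y \<in> F"
  then show "f x = f y" using assms(2) by (intro antisym) (auto simp: argmax_on_def)
qed

text \<open>Faces of a polyhedron are exposed. One supporting functional serves all outward
  differences at once, so that any two of them can be compared.\<close>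

lemma facet_outward:
  fixes G :: "'a::euclidean_space set"
  assumes "polyhedron G" "F facet_of G"
  obtains a where "\<And>v. v \<in> dir_space F \<Longrightarrow> inner a v = 0"
    "\<And>x y. x \<in> F \<Longrightarrow> y \<in> G - F \<Longrightarrow> inner a (x - y) > 0"
proof -
  have "F face_of G" using assms by (simp add: facet_of_def)
  then have "F exposed_face_of G" using assms exposed_face_of_polyhedron by blast
  then obtain a b where ab: "G \<subseteq> {x. inner a x \<le> b}" "F = G \<inter> {x. inner a x = b}"
    unfolding exposed_face_of_def by blast
  show ?thesis
  proof (rule that[of a])
    show "inner a v = 0" if "v \<in> dir_space F" for v
      using that ab by (intro linear_zero_on_dir_space[of "inner a" F v])
        (auto intro!: linearI simp: inner_right_distrib)
    show "inner a (x - y) > 0" if "x \<in> F" "y \<in> G - F" for x y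
      using that ab by (force simp: inner_diff_right)
  qed
qed

lemma facet_dim:
  fixes G :: "'a::euclidean_space set"
  assumes "F facet_of G"
  shows "dim (dir_space G) = Suc (dim (dir_space F))" "F \<subseteq> G" "F \<noteq> {}"
    "\<exists>x\<in>F. \<exists>y\<in>G - F. True"
proof -
  have f: "F face_of G" "F \<noteq> {}" "aff_dim F = aff_dim G - 1"
    using assms by (auto simp: facet_of_def)
  then show s: "F \<subseteq> G" "F \<noteq> {}" by (auto simp: face_of_imp_subset)
  then show "dim (dir_space G) = Suc (dim (dir_space F))"
    using f(3) aff_dim_dir_space[of F] aff_dim_dir_space[of G] by (cases "G = {}") auto
  have "F \<noteq> G" using f(3) by auto
  then show "\<exists>x\<in>F. \<exists>y\<in>G - F. True" using s by blast
qed

lemma facet_dir_space_decomp: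
  fixes G :: "'a::euclidean_space set"
  assumes "polyhedron G" "F facet_of G" "x \<in> F" "y \<in> G - F" "g \<in> dir_space G"
  obtains c where "g - c *\<^sub>R (x - y) \<in> dir_space F"
proof -
  obtain a where a: "\<And>v. v \<in> dir_space F \<Longrightarrow> inner a v = 0" "inner a (x - y) > 0"
    using facet_outward[OF assms(1,2)] assms(3,4) by metis
  let ?S = "insert (x - y) (dir_space F)"
  have n: "x - y \<notin> dir_space F" using a by fastforce
  have "?S \<subseteq> dir_space G"
    using dir_space_mono[OF facet_dim(2)[OF assms(2)]] assms facet_dim(2)[OF assms(2)]
    by (auto intro: diff_in_dir_space)
  moreover have "dim ?S = dim (dir_space G)"
    using n by (simp add: dim_insert facet_dim(1)[OF assms(2)])
  ultimately have "span ?S = span (dir_space G)"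
    by (intro dim_eq_span) auto
  then have "g \<in> span ?S" using assms(5) by (simp add: span_base)
  then show ?thesis using that by (auto simp: span_breakdown_eq)
qed

text \<open>\<open>dir_space F\<close> is a hyperplane in \<open>dir_space G\<close>, so the two
  differences are proportional modulo it; the supporting functional is positive on both, so the
  factor is positive. Hence the \<open>SOME\<close> in \<open>boundary_orientation\<close> is
  immaterial.\<close>

lemma facet_outward_multiple:
  fixes G :: "'a::euclidean_space set"
  assumes "polyhedron G" "F facet_of G" "x \<in> F" "y \<in> G - F" "x' \<in> F" "y' \<in> G - F"
  obtains c where "c > 0" "(x' - y') - c *\<^sub>R (x - y) \<in> dir_space F"
proof -
  obtain a where a: "\<And>v. v \<in> dir_space F \<Longrightarrow> inner a v = 0"
    "inner a (x - y) > 0" "inner a (x' - y') > 0"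
    using facet_outward[OF assms(1,2)] assms(3-) by metis
  have "x' - y' \<in> dir_space G"
    using facet_dim(2)[OF assms(2)] assms by (auto intro: diff_in_dir_space)
  then obtain c where c: "(x' - y') - c *\<^sub>R (x - y) \<in> dir_space F"
    using facet_dir_space_decomp[OF assms(1-4)] by blast
  have "inner a (x' - y') = c * inner a (x - y)"
    using a(1)[OF c] by (simp add: inner_diff_right)
  then have "c > 0" using a by (metis zero_less_mult_pos2)
  with c that show ?thesis by blast
qed

lemma ordered_bases_outward:
  fixes G :: "'a::euclidean_space set"
  assumes "polyhedron G" "F facet_of G" "x \<in> F" "y \<in> G - F" "bs \<in> ordered_bases (dir_space F)"
  shows "(x - y) # bs \<in> ordered_bases (dir_space G)"
proof (rule ordered_basesI)
  have s: "span (set bs) = dir_space F" using assms by (simp add: ordered_bases_def)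
  have F: "F \<subseteq> G" using facet_dim[OF assms(2)] by simp
  then show "set ((x - y) # bs) \<subseteq> dir_space G"
    using assms(3,4) s span_superset[of "set bs"] dir_space_mono[OF F] by (auto intro: diff_in_dir_space)
  show "dir_space G \<subseteq> span (set ((x - y) # bs))"
  proof
    fix g assume "g \<in> dir_space G"
    then obtain c where "g - c *\<^sub>R (x - y) \<in> dir_space F"
      using facet_dir_space_decomp[OF assms(1-4)] by blast
    then show "g \<in> span (set ((x - y) # bs))" by (auto simp: span_breakdown_eq s)
  qed
  show "length ((x - y) # bs) \<le> dim (dir_space G)"
    using ordered_bases_length[OF assms(5)] facet_dim(1)[OF assms(2)] by simp
qed simp

lemma boundary_orientation_eq:
  fixes G :: "'a::euclidean_space set"
  assumes "polyhedron G" "F facet_of G" "x \<in> F" "y \<in> G - F" "bs \<in> ordered_bases (dir_space F)"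
    "is_orientation (dir_space G) \<Omega>"
  shows "boundary_orientation G \<Omega> F bs = \<Omega> ((x - y) # bs)"
proof -
  define n where "n = (SOME n. \<exists>x\<in>F. \<exists>y\<in>G - F. n = x - y)"
  have "\<exists>x\<in>F. \<exists>y\<in>G - F. n = x - y"
    unfolding n_def by (rule someI_ex) (use assms in blast)
  then obtain x' y' where n: "x' \<in> F" "y' \<in> G - F" "n = x' - y'" by blast
  obtain c where c: "c > 0" "n - c *\<^sub>R (x - y) \<in> dir_space F"
    using facet_outward_multiple[OF assms(1-4) n(1,2)] n(3) by blast
  have "\<Omega> (n # bs) = sgn c * \<Omega> ((x - y) # bs)"
    using c assms(5) by (intro orientation_Cons_scale[OF assms(6) ordered_bases_outward[OF assms(1-5)]])
      (auto simp: ordered_bases_def)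
  then show ?thesis
    using c assms(5) by (simp add: boundary_orientation_def n_def)
qed

lemma is_orientation_boundary:
  fixes G :: "'a::euclidean_space set"
  assumes "polyhedron G" "F facet_of G" "is_orientation (dir_space G) \<Omega>"
  shows "is_orientation (dir_space F) (boundary_orientation G \<Omega> F)"
proof -
  obtain x y where xy: "x \<in> F" "y \<in> G - F" using facet_dim(4)[OF assms(2)] by blast
  have "boundary_orientation G \<Omega> F =
      (\<lambda>bs. if bs \<in> ordered_bases (dir_space F) then \<Omega> ((x - y) # map id bs) else 0)"
  proof
    fix bs
    show "boundary_orientation G \<Omega> F bs =
        (if bs \<in> ordered_bases (dir_space F) then \<Omega> ((x - y) # map id bs) else 0)"
    proof (cases "bs \<in> ordered_bases (dir_space F)")
      case True
      then show ?thesis using boundary_orientation_eq[OF assms(1,2) xy True assms(3)] by simp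
    qed (simp add: boundary_orientation_def)
  qed
  then show ?thesis
    using orientation_contract[OF linear_id assms(3)] ordered_bases_outward[OF assms(1,2) xy] by simp
qed

text \<open>By dimension, \<open>U\<close> is the whole orthogonal complement of
  \<open>\<tau>\<close> in \<open>Y\<close>.\<close>

lemma subspace_hyperplane_orthogonal:
  fixes Y :: "'a::euclidean_space set"
  assumes "subspace U" "subspace Y" "U \<subseteq> Y" "dim Y = Suc (dim U)" "\<tau> \<in> Y" "\<tau> \<noteq> 0"
    "\<And>u. u \<in> U \<Longrightarrow> inner \<tau> u = 0" "y \<in> Y" "inner \<tau> y = 0"
  shows "y \<in> U"
proof -
  have n: "\<tau> \<notin> U" 
  proof
    assume "\<tau> \<in> U"
    then have "inner \<tau> \<tau> = 0" by (rule assms(7))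
    with assms(6) show False by simp
  qed
  have "insert \<tau> U \<subseteq> Y" using assms by auto
  moreover have U: "span U = U" using assms(1) by (simp add: span_eq_iff)
  have "dim (insert \<tau> U) = dim Y"
    using n assms(4) unfolding dim_insert U by simp
  ultimately have "span (insert \<tau> U) = span Y" by (intro dim_eq_span) auto
  then have "y \<in> span (insert \<tau> U)" using span_base[OF assms(8)] by blast
  then obtain k where k: "y - k *\<^sub>R \<tau> \<in> U"
    unfolding span_breakdown_eq U by blast
  then have "inner \<tau> (y - k *\<^sub>R \<tau>) = 0" using assms(7) by blast
  then have "k = 0" using assms(6,9) by (simp add: inner_diff_right)
  with k show ?thesis by simp
qed

lemma face_of_dim_less:
  fixes G :: "'a::euclidean_space set"
  assumes "convex G" "F face_of G" "F \<noteq> {}" "dim (dir_space G) \<le> dim (dir_space F)"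
  shows "F = G"
proof (rule ccontr)
  assume "F \<noteq> G"
  then have "aff_dim F < aff_dim G" using face_of_aff_dim_lt assms by blast
  moreover have "G \<noteq> {}" using assms face_of_imp_subset by blast
  ultimately show False
    using assms(4) aff_dim_dir_space[of F] aff_dim_dir_space[of G] assms(3) by simp
qed

subsection \<open>Sweeping through the faces of a polytope\<close>

lemma inj_on_zero:
  assumes "linear f" "subspace V" "\<And>z. z \<in> V \<Longrightarrow> f z = 0 \<Longrightarrow> z = 0"
  shows "inj_on f V"
proof (rule inj_onI)
  fix a b assume *: "a \<in> V" "b \<in> V" "f a = f b"
  then have "a - b \<in> V" "f (a - b) = 0"
    using assms(1,2) by (auto simp: linear_diff subspace_diff)
  then show "a = b" using assms(3)[of "a - b"] by simp
qed

text \<open>A point \<open>(t, w)\<close> stands for the functional \<open>w \<circ> \<pi> - \<phi> - t \<eta>\<close>, whose maximal face on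
  \<open>Q\<close> is to be studied as \<open>t\<close> moves from 0 to 1. The assumption \<open>no_ray\<close> is where
  the discriminant enters.\<close>

locale sweep =
  fixes Q :: "'e::euclidean_space set" and \<pi> :: "'e \<Rightarrow> 'w::euclidean_space"
    and \<phi> \<eta> :: "'e \<Rightarrow> real" and W :: "'w set" and \<omega> :: "'w orientation"
    and R :: "('e, 's::ring) cochain"
  assumes polytope: "polytope Q"
    and linear: "linear \<pi>" "linear \<phi>" "linear \<eta>"
    and W: "subspace W" and \<pi>_W: "\<pi> ` dir_space Q \<subseteq> W" and \<omega>: "is_orientation W \<omega>"
    and R_uminus: "\<And>F \<Theta>. F face_of Q \<Longrightarrow> aff_dim F = int (dim W) \<Longrightarrow>
        is_orientation (dir_space F) \<Theta> \<Longrightarrow> R (F, \<lambda>bs. - \<Theta> bs) = - R (F, \<Theta>)"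
    and R_closed: "\<And>G \<Theta>. G face_of Q \<Longrightarrow> aff_dim G = int (dim W) + 1 \<Longrightarrow>
        is_orientation (dir_space G) \<Theta> \<Longrightarrow> coboundary R (G, \<Theta>) = 0"
    and transversal: "\<And>t w z. 0 \<le> t \<Longrightarrow> t \<le> 1 \<Longrightarrow> w \<in> W \<Longrightarrow>
        dim W \<le> dim (dir_space (argmax_on (\<lambda>z. inner w (\<pi> z) - \<phi> z - t * \<eta> z) Q)) \<Longrightarrow>
        z \<in> dir_space (argmax_on (\<lambda>z. inner w (\<pi> z) - \<phi> z - t * \<eta> z) Q) \<Longrightarrow>
        \<eta> z = 0 \<Longrightarrow> \<pi> z = 0 \<Longrightarrow> z = 0"
    and transversal_ends: "\<And>t w z. t = 0 \<or> t = 1 \<Longrightarrow> w \<in> W \<Longrightarrow>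
        dim W \<le> dim (dir_space (argmax_on (\<lambda>z. inner w (\<pi> z) - \<phi> z - t * \<eta> z) Q)) \<Longrightarrow>
        z \<in> dir_space (argmax_on (\<lambda>z. inner w (\<pi> z) - \<phi> z - t * \<eta> z) Q) \<Longrightarrow>
        \<pi> z = 0 \<Longrightarrow> z = 0"
    and no_ray: "\<And>F t w w'. F face_of Q \<Longrightarrow> aff_dim F = int (dim W) \<Longrightarrow> 0 \<le> t \<Longrightarrow> t \<le> 1 \<Longrightarrow>
        w \<in> W \<Longrightarrow> F \<subseteq> argmax_on (\<lambda>z. inner w (\<pi> z) - \<phi> z - t * \<eta> z) Q \<Longrightarrow>
        w' \<in> W \<Longrightarrow> F \<subseteq> argmax_on (\<lambda>z. inner w' (\<pi> z)) Q \<Longrightarrow> w' = 0"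
begin

section \<open>Heights, maximal faces and the parameter sets \<open>K F\<close>\<close>

definition height :: "real \<times> 'w \<Rightarrow> 'e \<Rightarrow> real" where
  "height y z = inner (snd y) (\<pi> z) - \<phi> z - fst y * \<eta> z"

text \<open>The derivative of \<open>height y z\<close> in the parameter \<open>y\<close>
  (\<open>height_shift\<close>); the sign of \<open>\<eta>\<close> is that of the term
  \<open>- t * \<eta>\<close> in the height.\<close>

definition L :: "'e \<Rightarrow> real \<times> 'w" where "L z = (- \<eta> z, \<pi> z)"

definition M :: "real \<times> 'w \<Rightarrow> 'e set" where "M y = argmax_on (height y) Q"

definition Y :: "(real \<times> 'w) set" where "Y = UNIV \<times> W"

definition strip :: "(real \<times> 'w) set" where "strip = {0..1} \<times> W"

definition nfaces :: "'e set set" where "nfaces = {F. F face_of Q \<and> aff_dim F = int (dim W)}"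

text \<open>Inclusion rather than equality with \<open>M y\<close>, so that the points where a
  larger face becomes maximal belong to \<open>K F\<close> as its ends.\<close>

definition K :: "'e set \<Rightarrow> (real \<times> 'w) set" where "K F = {y \<in> strip. F \<subseteq> M y}"

lemma subspace_Y: "subspace Y"
  unfolding Y_def using W by (intro subspace_Times) auto

lemma dim_Y: "dim Y = Suc (dim W)"
  unfolding Y_def using dim_Times[OF subspace_UNIV W, where 'a = real] by simp

lemma linear_L: "linear L"
  using linear by (auto intro!: linearI simp: L_def linear_add linear_scale)

lemma linear_height: "linear (height y)"
  using linear by (auto intro!: linearI simp: height_def linear_add linear_scale algebra_simps)

lemma height_shift: "height (y + s *\<^sub>R d) z = height y z + s * inner d (L z)"
  by (cases y, cases d) (simp add: height_def L_def inner_add_left algebra_simps)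

lemma M_face_of: "M y face_of Q"
  unfolding M_def using linear_height polytope by (intro argmax_on_face_of) (auto simp: polytope_imp_convex)

lemma polyhedron_face: "G face_of Q \<Longrightarrow> polyhedron G"
  using polytope by (meson face_of_polytope_polytope polytope_imp_polyhedron)

lemma convex_face: "G face_of Q \<Longrightarrow> convex G"
  by (rule face_of_imp_convex)

lemma L_in_Y:
  assumes "F face_of Q"
  shows "L ` dir_space F \<subseteq> Y"
  using dir_space_mono[OF face_of_imp_subset[OF assms]] \<pi>_W by (auto simp: L_def Y_def)

lemma nfaces_dim: 
  assumes "F \<in> nfaces"
  shows "dim (dir_space F) = dim W" "F \<noteq> {}" "F face_of Q"
proof -
  show 1: "F \<noteq> {}" "F face_of Q" using assms by (auto simp: nfaces_def)
  then show "dim (dir_space F) = dim W" using assms aff_dim_dir_space[of F] by (simp add: nfaces_def)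
qed

lemma finite_nfaces: "finite nfaces"
  using finite_polytope_faces[OF polytope] by (auto simp: nfaces_def intro: finite_subset[rotated])

lemma height_eq: "(\<lambda>z. inner w (\<pi> z) - \<phi> z - t * \<eta> z) = height (t, w)"
  by (auto simp: height_def)

text \<open>Between the ends \<open>\<pi>\<close> may have a kernel on the maximal face. The
  assumption \<open>transversal\<close> says that \<open>\<eta>\<close> vanishes on no non-zero
  vector of that kernel, that is, the pair of both maps is injective.\<close>

lemma inj_L:
  assumes "y \<in> strip" "dim W \<le> dim (dir_space (M y))"
  shows "inj_on L (dir_space (M y))"
proof (rule inj_on_zero[OF linear_L subspace_dir_space])
  fix z assume "z \<in> dir_space (M y)" "L z = 0"
  then show "z = 0"
    using transversal[of "fst y" "snd y" z] assms
    by (auto simp: strip_def height_eq M_def L_def zero_prod_def)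
qed

lemma inj_\<pi>:
  assumes "y \<in> strip" "fst y = 0 \<or> fst y = 1" "dim W \<le> dim (dir_space (M y))"
  shows "inj_on \<pi> (dir_space (M y))"
proof (rule inj_on_zero[OF linear(1) subspace_dir_space])
  fix z assume "z \<in> dir_space (M y)" "\<pi> z = 0"
  then show "z = 0"
    using transversal_ends[of "fst y" "snd y" z] assms
    by (auto simp: strip_def height_eq M_def)
qed

lemma dim_M_le:
  assumes "y \<in> strip" "dim W \<le> dim (dir_space (M y))"
  shows "dim (dir_space (M y)) \<le> Suc (dim W)"
proof -
  have "dim (dir_space (M y)) = dim (L ` dir_space (M y))"
    by (rule dim_image_eq[OF linear_L, symmetric]) (use inj_L[OF assms] in simp)
  also have "\<dots> \<le> dim Y" by (rule dim_subset[OF L_in_Y[OF M_face_of]])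
  finally show ?thesis by (simp add: dim_Y)
qed

lemma K_dim:
  assumes "F \<in> nfaces" "y \<in> K F"
  shows "F face_of M y" "dim W \<le> dim (dir_space (M y))" "y \<in> strip"
proof -
  show "y \<in> strip" using assms by (simp add: K_def)
  have "F \<subseteq> M y" using assms by (simp add: K_def)
  then show "F face_of M y"
    using nfaces_dim[OF assms(1)] M_face_of face_of_subset face_of_imp_subset by blast
  show "dim W \<le> dim (dir_space (M y))"
    using dim_subset[OF dir_space_mono[OF \<open>F \<subseteq> M y\<close>]] nfaces_dim[OF assms(1)] by simp
qed

text \<open>The dimension of \<open>M y\<close> is at least that of \<open>F\<close>, which is
  \<open>dim W\<close>, and at most \<open>dim Y = dim W + 1\<close>, because \<open>L\<close>
  embeds its direction space into \<open>Y\<close>.\<close>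

lemma K_cases:
  assumes "F \<in> nfaces" "y \<in> K F"
  obtains "F = M y" | "F facet_of M y" "aff_dim (M y) = int (dim W) + 1"
proof (cases "dim (dir_space (M y)) \<le> dim (dir_space F)")
  case True
  then show ?thesis
    using that(1) face_of_dim_less[OF convex_face[OF M_face_of] K_dim(1)[OF assms] nfaces_dim(2)[OF assms(1)]]
    by blast
next
  case False
  then have "dim (dir_space (M y)) = Suc (dim W)"
    using dim_M_le[OF K_dim(3,2)[OF assms]] nfaces_dim[OF assms(1)] by simp
  moreover have "M y \<noteq> {}" using assms nfaces_dim[OF assms(1)] by (auto simp: K_def)
  ultimately have "aff_dim (M y) = int (dim W) + 1" using aff_dim_dir_space[of "M y"] by simp
  then show ?thesis
    using that(2) K_dim(1)[OF assms] nfaces_dim[OF assms(1)] assms(1)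
    by (auto simp: facet_of_def nfaces_def)
qed

text \<open>At the times 0 and 1 already \<open>\<pi>\<close> embeds \<open>dir_space (M y)\<close>,
  now into \<open>W\<close>, which leaves no room for a face larger than \<open>F\<close>. The
  resulting isomorphism onto \<open>W\<close> is what \<open>end_term\<close> pulls
  \<open>\<omega>\<close> back along.\<close>

lemma K_end:
  assumes "F \<in> nfaces" "y \<in> K F" "fst y = 0 \<or> fst y = 1"
  shows "F = M y" "\<pi> ` dir_space F = W" "inj_on \<pi> (dir_space F)"
proof -
  note i = inj_\<pi>[OF K_dim(3)[OF assms(1,2)] assms(3) K_dim(2)[OF assms(1,2)]]
  have s: "\<pi> ` dir_space (M y) \<subseteq> W"
    using dir_space_mono[OF face_of_imp_subset[OF M_face_of]] \<pi>_W by blast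
  have d: "dim (dir_space (M y)) = dim (\<pi> ` dir_space (M y))"
    by (rule dim_image_eq[OF linear(1), symmetric]) (use i in simp)
  also have "\<dots> \<le> dim W" by (rule dim_subset[OF s])
  finally show F: "F = M y"
    using face_of_dim_less[OF convex_face[OF M_face_of] K_dim(1)[OF assms(1,2)] nfaces_dim(2)[OF assms(1)]]
      nfaces_dim[OF assms(1)] by simp
  show "inj_on \<pi> (dir_space F)" using i F by simp
  show "\<pi> ` dir_space F = W"
    using s d F nfaces_dim(1)[OF assms(1)] W
    by (intro subspace_dim_equal) (auto intro: linear_subspace_image[OF linear(1)])
qed

text \<open>Only the finitely many points spanning \<open>Q\<close> need testing. Those in
  \<open>M y\<close> are controlled by the hypothesis on \<open>d\<close>; the others start strictly
  lower and remain so for small \<open>s\<close>.\<close>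

lemma perturb:
  assumes "F \<noteq> {}" "F \<subseteq> M y" "\<And>x z. x \<in> F \<Longrightarrow> z \<in> M y \<Longrightarrow> inner d (L (x - z)) \<ge> 0"
  shows "\<forall>\<^sub>F s in at_right 0. F \<subseteq> M (y + s *\<^sub>R d)"
proof -
  obtain P where P: "finite P" "Q = convex hull P" using polytope by (auto simp: polytope_def)
  obtain x0 where x0: "x0 \<in> F" using assms(1) by blast
  then have x0Q: "x0 \<in> Q" "\<And>z. z \<in> Q \<Longrightarrow> height y z \<le> height y x0"
    using assms(2) by (auto simp: M_def argmax_on_def)
  have L: "L (x - z) = L x - L z" for x z by (rule linear_diff[OF linear_L])
  have "\<forall>\<^sub>F s in at_right 0. height (y + s *\<^sub>R d) p \<le> height (y + s *\<^sub>R d) x0" if "p \<in> P" for p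
  proof (cases "p \<in> M y")
    case True
    then have "inner d (L p) \<le> inner d (L x0)" "height y p = height y x0"
      using assms(3)[OF x0 True] x0Q by (auto simp: L inner_diff_right M_def argmax_on_def intro: antisym)
    then show ?thesis
      by (intro eventually_at_right_less[THEN eventually_mono]) (auto simp: height_shift intro: mult_left_mono)
  next
    case False
    have pQ: "p \<in> Q" using that P(2) by (simp add: hull_inc)
    then have "height y p < height y x0"
      using False x0Q by (force simp: M_def argmax_on_def)
    moreover have "((\<lambda>s. height (y + s *\<^sub>R d) x0 - height (y + s *\<^sub>R d) p)
        \<longlongrightarrow> height y x0 - height y p) (at_right 0)"
      unfolding height_shift by (auto intro!: tendsto_eq_intros)
    ultimately have "\<forall>\<^sub>F s in at_right 0. height (y + s *\<^sub>R d) x0 - height (y + s *\<^sub>R d) p > 0"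
      by (intro order_tendstoD(1)[where y = "height y x0 - height y p"]) auto
    then show ?thesis by (rule eventually_mono) simp
  qed
  then have "\<forall>\<^sub>F s in at_right 0. \<forall>p\<in>P. height (y + s *\<^sub>R d) p \<le> height (y + s *\<^sub>R d) x0"
    using P(1) by (simp add: eventually_ball_finite)
  then show ?thesis
  proof (rule eventually_mono)
    fix s assume *: "\<forall>p\<in>P. height (y + s *\<^sub>R d) p \<le> height (y + s *\<^sub>R d) x0"
    have "convex {z. height (y + s *\<^sub>R d) z \<le> height (y + s *\<^sub>R d) x0}"
      using convex_linear_vimage[OF linear_height, of "{..height (y + s *\<^sub>R d) x0}" "y + s *\<^sub>R d"]
      by (simp add: vimage_def)
    then have "Q \<subseteq> {z. height (y + s *\<^sub>R d) z \<le> height (y + s *\<^sub>R d) x0}"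
      unfolding P(2) using * by (intro hull_minimal) auto
    moreover have "height (y + s *\<^sub>R d) x = height (y + s *\<^sub>R d) x0" if "x \<in> F" for x
    proof -
      \<comment> \<open>The hypothesis applied to the pair in both orders gives both
        inequalities.\<close>
      have "inner d (L x) = inner d (L x0)" 
        using assms(3)[OF that, of x0] assms(3)[OF x0, of x] subsetD[OF assms(2) x0] subsetD[OF assms(2) that]
        by (simp add: L inner_diff_right)
      moreover have "height y x = height y x0"
        using that assms(2) x0Q by (intro antisym) (auto simp: M_def argmax_on_def)
      ultimately show ?thesis by (simp add: height_shift)
    qed
    moreover have "F \<subseteq> Q" using assms(2) by (auto simp: M_def argmax_on_def)
    ultimately show "F \<subseteq> M (y + s *\<^sub>R d)"
      unfolding M_def argmax_on_def by (intro subsetI CollectI conjI ballI) (auto simp: subset_iff)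
  qed
qed

section \<open>Orientations of the parameter space and of the faces\<close>

definition \<Omega> :: "(real \<times> 'w) orientation" where
  "\<Omega> = (SOME \<Omega>. is_orientation Y \<Omega> \<and>
     (\<forall>bs\<in>ordered_bases W. \<Omega> ((1, 0) # map (Pair 0) bs) = \<omega> bs))"

text \<open>The product orientation with the t-axis in front, obtained by fixing the sign on one
  reference basis. Having \<open>(1, 0)\<close> in front is what lets the sign of
  \<open>fst \<tau>\<close> appear at the times 0 and 1.\<close>

lemma \<Omega>:
  "is_orientation Y \<Omega>"
  "bs \<in> ordered_bases W \<Longrightarrow> \<Omega> ((1, 0) # map (Pair 0) bs) = \<omega> bs"
proof -
  have one: "[1::real] \<in> ordered_bases UNIV"
  proof (rule ordered_basesI)
    show "(UNIV :: real set) \<subseteq> span (set [1])"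
      by (auto simp: span_singleton image_iff)
  qed auto
  have p: "(1, 0) # map (Pair 0) bs = product_basis [1::real] bs" for bs :: "'w list"
    by (simp add: product_basis_def)
  obtain bs0 where bs0: "bs0 \<in> ordered_bases W" using ordered_bases_exists W by blast
  obtain \<Omega>0 where \<Omega>0: "is_orientation Y \<Omega>0" "\<Omega>0 (product_basis [1] bs0) = 1"
    using orientation_exists[OF ordered_bases_product[OF one bs0]] by (auto simp: Y_def)
  have "\<exists>\<Omega>'. is_orientation Y \<Omega>' \<and> \<Omega>' (product_basis [1] bs0) = \<omega> bs0"
    using orientation_values[OF \<omega> bs0] \<Omega>0 orientation_uminus[OF \<Omega>0(1)]
    by (metis (no_types, lifting))
  then obtain \<Omega>' where \<Omega>': "is_orientation Y \<Omega>'" "\<Omega>' (product_basis [1] bs0) = \<omega> bs0" by blast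
  have "\<Omega>' (product_basis [1] bs) = \<omega> bs" if bs: "bs \<in> ordered_bases W" for bs
  proof -
    obtain A where A: "lincomb A bs0 bs"
      using lincomb_exists bs0 bs ordered_bases_subset ordered_bases_length by metis
    show ?thesis
      using orientation_product_lincomb[OF _ one bs0 one bs lincomb_one A, of \<Omega>']
        orientation_lincomb[OF \<omega> bs0 bs A] \<Omega>' by (simp add: Y_def)
  qed
  with \<Omega>'(1) have "\<exists>\<Omega>. is_orientation Y \<Omega> \<and>
     (\<forall>bs\<in>ordered_bases W. \<Omega> ((1, 0) # map (Pair 0) bs) = \<omega> bs)"
    unfolding p by blast
  then have "is_orientation Y \<Omega> \<and>
     (\<forall>bs\<in>ordered_bases W. \<Omega> ((1, 0) # map (Pair 0) bs) = \<omega> bs)"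
    unfolding \<Omega>_def by (rule someI_ex)
  then show "is_orientation Y \<Omega>"
    "bs \<in> ordered_bases W \<Longrightarrow> \<Omega> ((1, 0) # map (Pair 0) bs) = \<omega> bs" by auto
qed

text \<open>Moving the parameter along such a \<open>\<tau>\<close> changes all heights on
  \<open>F\<close> by the same amount; the line containing \<open>K F\<close> has this direction
  (\<open>K_line\<close>).\<close>

definition normal :: "'e set \<Rightarrow> real \<times> 'w \<Rightarrow> bool" where
  "normal F \<tau> \<longleftrightarrow> \<tau> \<in> Y \<and> \<tau> \<noteq> 0 \<and> (\<forall>z\<in>dir_space F. inner \<tau> (L z) = 0)"

text \<open>Orients \<open>F\<close> so that \<open>\<tau>\<close> followed by the
  \<open>L\<close>-image of a positive basis is positive in \<open>Y\<close>; this makes sense when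
  \<open>L\<close> is injective on \<open>dir_space F\<close>.\<close>

definition \<Theta> :: "'e set \<Rightarrow> real \<times> 'w \<Rightarrow> 'e orientation" where
  "\<Theta> F \<tau> = (\<lambda>bs. if bs \<in> ordered_bases (dir_space F) then \<Omega> (\<tau> # map L bs) else 0)"

lemma normal_uminus: "normal F \<tau> \<Longrightarrow> normal F (- \<tau>)"
  using subspace_neg[OF subspace_Y] by (auto simp: normal_def)

lemma normal_decomp:
  assumes "F \<in> nfaces" "inj_on L (dir_space F)" "normal F \<tau>" "y \<in> Y"
  shows "y - (inner \<tau> y / inner \<tau> \<tau>) *\<^sub>R \<tau> \<in> L ` dir_space F"
proof (rule subspace_hyperplane_orthogonal[OF _ subspace_Y])
  show "subspace (L ` dir_space F)" by (intro linear_subspace_image[OF linear_L]) simp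
  show "L ` dir_space F \<subseteq> Y" by (rule L_in_Y[OF nfaces_dim(3)[OF assms(1)]])
  have "dim (L ` dir_space F) = dim (dir_space F)"
    by (rule dim_image_eq[OF linear_L]) (use assms(2) in simp)
  then show "dim Y = Suc (dim (L ` dir_space F))"
    using nfaces_dim[OF assms(1)] by (simp add: dim_Y)
  show "\<tau> \<in> Y" "\<tau> \<noteq> 0" "\<And>u. u \<in> L ` dir_space F \<Longrightarrow> inner \<tau> u = 0"
    using assms(3) by (auto simp: normal_def)
  then show "y - (inner \<tau> y / inner \<tau> \<tau>) *\<^sub>R \<tau> \<in> Y"
    using assms(4) subspace_Y by (intro subspace_diff subspace_scale)
  show "inner \<tau> (y - (inner \<tau> y / inner \<tau> \<tau>) *\<^sub>R \<tau>) = 0"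
    using \<open>\<tau> \<noteq> 0\<close> by (simp add: inner_diff_right)
qed

lemma span_map_L:
  assumes "bs \<in> ordered_bases (dir_space F)"
  shows "span (set (map L bs)) = L ` dir_space F"
  using assms by (simp add: ordered_bases_def linear_span_image[OF linear_L])

lemma normal_ordered_basis:
  assumes "F \<in> nfaces" "inj_on L (dir_space F)" "normal F \<tau>" "bs \<in> ordered_bases (dir_space F)"
  shows "\<tau> # map L bs \<in> ordered_bases Y"
proof (rule ordered_basesI[OF subspace_Y])
  show "set (\<tau> # map L bs) \<subseteq> Y"
    using assms(3) L_in_Y[OF nfaces_dim(3)[OF assms(1)]] ordered_bases_subset[OF assms(4)]
    by (auto simp: normal_def)
  show "Y \<subseteq> span (set (\<tau> # map L bs))"
  proof
    fix y assume "y \<in> Y"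
    from normal_decomp[OF assms(1-3) this] show "y \<in> span (set (\<tau> # map L bs))"
      using span_map_L[OF assms(4)] by (auto simp: span_breakdown_eq)
  qed
  show "length (\<tau> # map L bs) \<le> dim Y"
    using ordered_bases_length[OF assms(4)] nfaces_dim[OF assms(1)] by (simp add: dim_Y)
qed

lemma is_orientation_\<Theta>:
  assumes "F \<in> nfaces" "inj_on L (dir_space F)" "normal F \<tau>"
  shows "is_orientation (dir_space F) (\<Theta> F \<tau>)"
  unfolding \<Theta>_def
  by (rule orientation_contract[OF linear_L \<Omega>(1) normal_ordered_basis[OF assms]])

text \<open>Modulo the image of \<open>dir_space F\<close> under \<open>L\<close>, which is the
  orthogonal complement of \<open>\<tau>\<close> in \<open>Y\<close>, the vector \<open>y\<close> is
  \<open>inner \<tau> y / inner \<tau> \<tau>\<close> times \<open>\<tau>\<close>.\<close>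

lemma \<Omega>_normal:
  assumes "F \<in> nfaces" "inj_on L (dir_space F)" "normal F \<tau>" "bs \<in> ordered_bases (dir_space F)"
    "y \<in> Y" "inner \<tau> y \<noteq> 0"
  shows "\<Omega> (y # map L bs) = sgn (inner \<tau> y) * \<Theta> F \<tau> bs" "y # map L bs \<in> ordered_bases Y"
proof -
  have "inner \<tau> \<tau> > 0" using assms(3) by (simp add: normal_def)
  then have s: "sgn (inner \<tau> y / inner \<tau> \<tau>) = sgn (inner \<tau> y)" "inner \<tau> y / inner \<tau> \<tau> \<noteq> 0"
    using assms(6) by (auto simp: sgn_divide)
  have d: "y - (inner \<tau> y / inner \<tau> \<tau>) *\<^sub>R \<tau> \<in> span (set (map L bs))"
    unfolding span_map_L[OF assms(4)] by (rule normal_decomp[OF assms(1-3,5)])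
  show "\<Omega> (y # map L bs) = sgn (inner \<tau> y) * \<Theta> F \<tau> bs"
    using orientation_Cons_scale[OF \<Omega>(1) normal_ordered_basis[OF assms(1-4)] s(2) d] s assms(4)
    by (simp add: \<Theta>_def)
  show "y # map L bs \<in> ordered_bases Y"
    by (rule ordered_bases_Cons_scale[OF normal_ordered_basis[OF assms(1-4)] s(2) d])
qed

lemma \<Theta>_uminus:
  assumes "F \<in> nfaces" "inj_on L (dir_space F)" "normal F \<tau>"
  shows "\<Theta> F (- \<tau>) = (\<lambda>bs. - \<Theta> F \<tau> bs)"
proof
  fix bs
  show "\<Theta> F (- \<tau>) bs = - \<Theta> F \<tau> bs"
  proof (cases "bs \<in> ordered_bases (dir_space F)")
    case True
    then show ?thesis
      using \<Omega>_normal(1)[OF assms True, of "- \<tau>"] normal_uminus[OF assms(3)] assms(3)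
      by (simp add: \<Theta>_def normal_def)
  qed (simp add: \<Theta>_def)
qed

text \<open>Meant for faces of dimension \<open>dim W + 1\<close>, which \<open>L\<close> maps
  isomorphically onto \<open>Y\<close>. It depends on \<open>G\<close> alone, so all facets of
  \<open>G\<close> are compared with one orientation.\<close>

definition G_orientation :: "'e set \<Rightarrow> 'e orientation" where
  "G_orientation G = pull_orientation \<Omega> L (dir_space G)"

definition end_term :: "'e set \<Rightarrow> 's" where
  "end_term F = R (F, pull_orientation \<omega> \<pi> (dir_space F))"

definition face_term :: "'e set \<Rightarrow> 'e set \<Rightarrow> 's" where
  "face_term F G = R (F, boundary_orientation G (G_orientation G) F)"

text \<open>For a face \<open>F\<close> of dimension \<open>dim W\<close>, \<open>K F\<close> is a compact segment. With \<open>\<tau>\<close> pointing into the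
  segment, each of its two ends contributes \<open>R (F, \<Theta> F \<tau>)\<close>; as \<open>\<tau>\<close> has opposite directions at the
  two ends, the contributions cancel.\<close>

definition contribution :: "'e set \<Rightarrow> real \<times> 'w \<Rightarrow> 's" where
  "contribution F y =
     (if fst y = 0 then end_term F else if fst y = 1 then - end_term F else face_term F (M y))"

lemma inj_L_face:
  assumes "F \<in> nfaces" "y \<in> K F"
  shows "inj_on L (dir_space F)"
  using inj_L[OF K_dim(3,2)[OF assms]] dir_space_mono[OF face_of_imp_subset[OF K_dim(1)[OF assms]]]
  by (rule inj_on_subset)

lemma L_onto:
  assumes "G face_of Q" "inj_on L (dir_space G)" "dim (dir_space G) = Suc (dim W)"
  shows "L ` dir_space G = Y"
proof (rule subspace_dim_equal[OF _ subspace_Y L_in_Y[OF assms(1)]])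
  show "subspace (L ` dir_space G)" by (intro linear_subspace_image[OF linear_L]) simp
  have "dim (L ` dir_space G) = dim (dir_space G)"
    by (rule dim_image_eq[OF linear_L]) (use assms(2) in simp)
  then show "dim Y \<le> dim (L ` dir_space G)" using assms(3) by (simp add: dim_Y)
qed

text \<open>The functional \<open>inner \<tau> (L z)\<close> vanishes along \<open>F\<close>, hence
  on all outward vectors it has the sign of one value \<open>c\<close>. That sign decides both which
  of the directions \<open>\<tau>\<close> and \<open>- \<tau>\<close> keeps \<open>F\<close> maximal
  and how the boundary orientation compares with \<open>\<Theta> F \<tau>\<close>.\<close>

lemma facet_end:
  assumes "F \<in> nfaces" "y \<in> K F" "normal F \<tau>" "F facet_of M y" "aff_dim (M y) = int (dim W) + 1"
  obtains c where "c \<noteq> 0"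
    "\<And>x z. x \<in> F \<Longrightarrow> z \<in> M y \<Longrightarrow> c * inner \<tau> (L (x - z)) \<ge> 0"
    "\<And>x z. x \<in> F \<Longrightarrow> z \<in> M y - F \<Longrightarrow> c * inner \<tau> (L (x - z)) > 0"
    "boundary_orientation (M y) (G_orientation (M y)) F = (\<lambda>bs. sgn c * \<Theta> F \<tau> bs)"
proof -
  note poly = polyhedron_face[OF M_face_of[of y]]
  have ne: "M y \<noteq> {}" using facet_dim[OF assms(4)] by auto
  have dG: "dim (dir_space (M y)) = Suc (dim W)"
    using assms(5) aff_dim_dir_space[OF ne] by simp
  note inj = inj_L[OF K_dim(3,2)[OF assms(1,2)]]
  note injF = inj_L_face[OF assms(1,2)]
  have onto: "L ` dir_space (M y) = Y" by (rule L_onto[OF M_face_of inj dG])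
  obtain x0 z0 where xz: "x0 \<in> F" "z0 \<in> M y - F" using facet_dim(4)[OF assms(4)] by blast
  define c where "c = inner \<tau> (L (x0 - z0))"
  have dec: "\<exists>k. inner \<tau> (L g) = k * c" if g: "g \<in> dir_space (M y)" for g
  proof -
    obtain k where k: "g - k *\<^sub>R (x0 - z0) \<in> dir_space F"
      using facet_dir_space_decomp[OF poly assms(4) xz g] by blast
    then have "inner \<tau> (L (g - k *\<^sub>R (x0 - z0))) = 0" using assms(3) by (simp add: normal_def)
    then have "inner \<tau> (L g) = k * c"
      by (simp add: c_def linear_diff[OF linear_L] linear_scale[OF linear_L] inner_diff_right)
    then show ?thesis by blast
  qed
  have c0: "c \<noteq> 0"
  proof
    \<comment> \<open>Then \<open>\<tau>\<close> would be orthogonal to the image of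
      \<open>dir_space (M y)\<close> under \<open>L\<close>, which is all of \<open>Y\<close> and
      contains \<open>\<tau>\<close>.\<close>
    assume "c = 0"
    then have z: "inner \<tau> u = 0" if "u \<in> Y" for u
      using dec that unfolding onto[symmetric] by auto
    have "\<tau> \<in> Y" using assms(3) by (simp add: normal_def)
    from z[OF this] have "\<tau> = 0" by simp
    then show False using assms(3) by (simp add: normal_def)
  qed
  have pos: "c * inner \<tau> (L (x - z)) > 0" if x: "x \<in> F" and z: "z \<in> M y - F" for x z
  proof -
    obtain k where k: "k > 0" "(x - z) - k *\<^sub>R (x0 - z0) \<in> dir_space F"
      using facet_outward_multiple[OF poly assms(4) xz x z] by blast
    then have "inner \<tau> (L ((x - z) - k *\<^sub>R (x0 - z0))) = 0" using assms(3) unfolding normal_def by blast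
    then have "inner \<tau> (L (x - z)) = k * c"
      by (simp add: c_def linear_diff[OF linear_L] linear_scale[OF linear_L] inner_diff_right)
    then show ?thesis using k c0 by (auto simp: zero_less_mult_iff mult_less_0_iff)
  qed
  have nonneg: "c * inner \<tau> (L (x - z)) \<ge> 0" if "x \<in> F" "z \<in> M y" for x z
  proof (cases "z \<in> F")
    case True
    then have "x - z \<in> dir_space F" using that by (intro diff_in_dir_space)
    then show ?thesis using assms(3) by (simp add: normal_def)
  qed (use pos[of x z] that in force)
  have or: "is_orientation (dir_space (M y)) (G_orientation (M y))"
    unfolding G_orientation_def using onto \<Omega>(1) by (intro is_orientation_pull[OF linear_L inj]) simp
  have "boundary_orientation (M y) (G_orientation (M y)) F bs = sgn c * \<Theta> F \<tau> bs" for bs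
  proof (cases "bs \<in> ordered_bases (dir_space F)")
    case True
    have "L (x0 - z0) \<in> Y"
      using onto xz facet_dim(2)[OF assms(4)] by (metis DiffD1 diff_in_dir_space imageI subsetD)
    then have "\<Omega> (L (x0 - z0) # map L bs) = sgn c * \<Theta> F \<tau> bs"
      using \<Omega>_normal(1)[OF assms(1) injF assms(3) True] c0 by (simp add: c_def)
    then show ?thesis
      using boundary_orientation_eq[OF poly assms(4) xz True or]
        ordered_bases_outward[OF poly assms(4) xz True]
      by (simp add: G_orientation_def pull_orientation_def)
  next
    case False
    then show ?thesis by (simp add: boundary_orientation_def \<Theta>_def)
  qed
  with c0 nonneg pos that show ?thesis by blast
qed

section \<open>The ends of the segment \<open>K F\<close>\<close>

lemma strip_perturb:
  assumes "y \<in> strip" "d \<in> Y" "fst y = 0 \<Longrightarrow> fst d > 0" "fst y = 1 \<Longrightarrow> fst d < 0"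
  shows "\<forall>\<^sub>F s in at_right 0. y + s *\<^sub>R d \<in> strip"
proof -
  have W: "snd (y + s *\<^sub>R d) \<in> W" for s
    using assms W by (auto simp: strip_def Y_def subspace_add subspace_scale)
  have t: "((\<lambda>s. fst y + s * fst d) \<longlongrightarrow> fst y) (at_right 0)"
    by (auto intro!: tendsto_eq_intros)
  have pos: "\<forall>\<^sub>F s::real in at_right 0. s > 0" by (simp add: eventually_at_right_less)
  have "\<forall>\<^sub>F s in at_right 0. 0 \<le> fst y + s * fst d"
  proof (cases "fst y = 0")
    case True
    then show ?thesis using pos assms(3) by (auto elim: eventually_mono)
  next
    case False
    then have "fst y > 0" using assms(1) by (auto simp: strip_def less_le)
    from order_tendstoD(1)[OF t this] show ?thesis by (auto elim: eventually_mono)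
  qed
  moreover have "\<forall>\<^sub>F s in at_right 0. fst y + s * fst d \<le> 1"
  proof (cases "fst y = 1")
    case True
    then show ?thesis using pos assms(4)
      by (auto elim!: eventually_mono simp: mult_le_0_iff)
  next
    case False
    then have "fst y < 1" using assms(1) by (auto simp: strip_def less_le)
    from order_tendstoD(2)[OF t this] show ?thesis by (auto elim: eventually_mono)
  qed
  ultimately show ?thesis
  proof eventually_elim
    case (elim s)
    then show ?case using W[of s] by (simp add: strip_def mem_Times_iff)
  qed
qed

text \<open>For a short move only the active constraints count: the bounds on t when
  \<open>y\<close> lies on them, and the height inequalities at points of
  \<open>M y\<close>.\<close>

lemma K_perturb:
  assumes "F \<in> nfaces" "y \<in> K F" "d \<in> Y" "fst y = 0 \<Longrightarrow> fst d > 0" "fst y = 1 \<Longrightarrow> fst d < 0"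
    "\<And>x z. x \<in> F \<Longrightarrow> z \<in> M y \<Longrightarrow> inner d (L (x - z)) \<ge> 0"
  shows "\<exists>s>0. y + s *\<^sub>R d \<in> K F"
proof -
  have "\<forall>\<^sub>F s in at_right 0. y + s *\<^sub>R d \<in> strip \<and> F \<subseteq> M (y + s *\<^sub>R d) \<and> s > 0"
  proof (intro eventually_conj)
    show "\<forall>\<^sub>F s in at_right 0. y + s *\<^sub>R d \<in> strip"
      by (rule strip_perturb[OF K_dim(3)[OF assms(1,2)] assms(3-5)])
    show "\<forall>\<^sub>F s in at_right 0. F \<subseteq> M (y + s *\<^sub>R d)"
      using assms(2) by (intro perturb[OF nfaces_dim(2)[OF assms(1)] _ assms(6)]) (simp_all add: K_def)
  qed (simp add: eventually_at_right_less)
  then show ?thesis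
    unfolding K_def using eventually_happens'[OF trivial_limit_at_right_real] by blast
qed


text \<open>If \<open>fst \<tau> = 0\<close>, then \<open>snd \<tau>\<close> is
  \<open>\<pi> z\<close> for some \<open>z\<close> along \<open>F\<close>, and orthogonality of
  \<open>\<tau>\<close> to \<open>L z\<close> kills it. For the sign, shearing by multiples of
  \<open>(1, 0)\<close> turns \<open>L\<close> into \<open>(0, \<pi>)\<close>, where
  \<open>\<Omega>\<close> restricts to \<open>\<omega>\<close>.\<close>

lemma end_orientation:
  assumes "F \<in> nfaces" "y \<in> K F" "fst y = 0 \<or> fst y = 1" "normal F \<tau>"
  shows "fst \<tau> \<noteq> 0" "end_term F = R (F, \<lambda>bs. sgn (fst \<tau>) * \<Theta> F \<tau> bs)"
proof -
  note fe = K_end[OF assms(1-3)]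
  show f0: "fst \<tau> \<noteq> 0"
  proof
    assume f: "fst \<tau> = 0"
    have "snd \<tau> \<in> W" using assms(4) by (auto simp: normal_def Y_def)
    then obtain z where z: "z \<in> dir_space F" "snd \<tau> = \<pi> z" using fe(2) by blast
    then have "inner \<tau> (L z) = 0" using assms(4) by (simp add: normal_def)
    then have "snd \<tau> = 0" using f z by (cases \<tau>) (simp add: L_def)
    then show False using assms(4) f by (auto simp: normal_def prod_eq_iff)
  qed
  have "pull_orientation \<omega> \<pi> (dir_space F) bs = sgn (fst \<tau>) * \<Theta> F \<tau> bs" for bs
  proof (cases "bs \<in> ordered_bases (dir_space F)")
    case True
    have Y: "(1, 0) \<in> Y" using W by (simp add: Y_def subspace_0)
    have \<tau>: "inner \<tau> (1, 0) = fst \<tau>" by (cases \<tau>) simp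
    note \<Omega>' = \<Omega>_normal[OF assms(1) inj_L_face[OF assms(1,2)] assms(4) True Y]
    have "\<Omega> ((1, 0) # map (Pair 0) (map \<pi> bs)) = \<Omega> ((1, 0) # map L bs)"
      using f0 \<Omega>'(2) \<tau>
      by (intro orientation_Cons_shear[OF \<Omega>(1), where b = "\<lambda>j. \<eta> (bs ! j)"]) (auto simp: L_def)
    moreover have "map \<pi> bs \<in> ordered_bases W"
      using ordered_bases_map[OF linear(1) fe(3) True] fe(2) by simp
    ultimately show ?thesis
      using \<Omega>(2)[of "map \<pi> bs"] \<Omega>'(1) f0 \<tau> True
      by (simp add: pull_orientation_def del: map_map)
  next
    case False
    then show ?thesis by (simp add: pull_orientation_def \<Theta>_def)
  qed
  then show "end_term F = R (F, \<lambda>bs. sgn (fst \<tau>) * \<Theta> F \<tau> bs)"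
    unfolding end_term_def by presburger
qed

text \<open>If no constraint blocking \<open>- \<tau>\<close> were active, \<open>K_perturb\<close>
  would continue the segment. So either \<open>t = 0\<close> with \<open>fst \<tau> > 0\<close>, or
  \<open>t = 1\<close> with \<open>fst \<tau> < 0\<close>, which is compensated by the minus sign in
  \<open>contribution\<close>, or \<open>F\<close> is a facet of \<open>M y\<close> with
  \<open>c > 0\<close>. Applied to \<open>- \<tau>\<close>, the lemma treats the opposite
  end.\<close>

lemma lower_end:
  assumes "F \<in> nfaces" "y \<in> K F" "normal F \<tau>" "\<And>s. s > 0 \<Longrightarrow> y - s *\<^sub>R \<tau> \<notin> K F"
  shows "contribution F y = R (F, \<Theta> F \<tau>)" "\<exists>s>0. y + s *\<^sub>R \<tau> \<in> K F"
    "fst y \<noteq> 0 \<and> fst y \<noteq> 1 \<Longrightarrow> F facet_of M y \<and> aff_dim (M y) = int (dim W) + 1"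
proof -
  note inj = inj_L_face[OF assms(1,2)]
  have \<tau>Y: "\<tau> \<in> Y" "- \<tau> \<in> Y"
    using assms(3) subspace_neg[OF subspace_Y] by (simp_all add: normal_def)
  have neg: "\<not> (\<exists>s>0. y + s *\<^sub>R (- \<tau>) \<in> K F)" using assms(4) by auto
  have flat: "inner \<tau> (L (x - z)) = 0" if "x \<in> F" "z \<in> M y" "F = M y" for x z
    using that assms(3) diff_in_dir_space[of x F z] by (simp add: normal_def)
  have Rneg: "R (F, \<lambda>bs. - \<Theta> F \<tau> bs) = - R (F, \<Theta> F \<tau>)"
    using R_uminus is_orientation_\<Theta>[OF assms(1) inj assms(3)] assms(1) by (simp add: nfaces_def)
  have strip: "0 \<le> fst y" "fst y \<le> 1" using K_dim(3)[OF assms(1,2)] by (auto simp: strip_def)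
  have "contribution F y = R (F, \<Theta> F \<tau>) \<and> (\<exists>s>0. y + s *\<^sub>R \<tau> \<in> K F) \<and>
    (fst y \<noteq> 0 \<and> fst y \<noteq> 1 \<longrightarrow> F facet_of M y \<and> aff_dim (M y) = int (dim W) + 1)"
  proof (cases "fst y = 0 \<or> fst y = 1")
    case True
    note fe = K_end(1)[OF assms(1,2) True]
    note eo = end_orientation[OF assms(1,2) True assms(3)]
    \<comment> \<open>Since \<open>F = M y\<close>, the height constraints along
      \<open>\<tau>\<close> hold with equality, and only the bounds on t can stop the
      motion.\<close>
    have "fst y = 0 \<and> fst \<tau> > 0 \<or> fst y = 1 \<and> fst \<tau> < 0"
    proof (rule ccontr)
      assume "\<not> ?thesis"
      then have "\<exists>s>0. y + s *\<^sub>R (- \<tau>) \<in> K F"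
        using True eo(1) flat fe by (intro K_perturb[OF assms(1,2) \<tau>Y(2)]) auto
      with neg show False ..
    qed
    moreover from this have "\<exists>s>0. y + s *\<^sub>R \<tau> \<in> K F"
      using flat fe by (intro K_perturb[OF assms(1,2) \<tau>Y(1)]) auto
    ultimately show ?thesis
      using eo(2) Rneg True by (auto simp: contribution_def)
  next
    case False
    have nF: "F \<noteq> M y"
    proof
      assume "F = M y"
      then have "\<exists>s>0. y + s *\<^sub>R (- \<tau>) \<in> K F"
        using False flat by (intro K_perturb[OF assms(1,2) \<tau>Y(2)]) auto
      with neg show False ..
    qed
    then have facet: "F facet_of M y" "aff_dim (M y) = int (dim W) + 1"
      using K_cases[OF assms(1,2)] by blast+
    obtain c where c: "c \<noteq> 0"
      "\<And>x z. x \<in> F \<Longrightarrow> z \<in> M y \<Longrightarrow> c * inner \<tau> (L (x - z)) \<ge> 0"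
      "boundary_orientation (M y) (G_orientation (M y)) F = (\<lambda>bs. sgn c * \<Theta> F \<tau> bs)"
      using facet_end[OF assms(1-3) facet] by metis
    have "c > 0"
    proof (rule ccontr)
      assume "\<not> c > 0"
      with c(1) have "c < 0" by simp
      then have "inner (- \<tau>) (L (x - z)) \<ge> 0" if "x \<in> F" "z \<in> M y" for x z
        using c(2)[OF that] by (simp add: zero_le_mult_iff)
      then have "\<exists>s>0. y + s *\<^sub>R (- \<tau>) \<in> K F"
        using False by (intro K_perturb[OF assms(1,2) \<tau>Y(2)]) auto
      with neg show False ..
    qed
    then have "inner \<tau> (L (x - z)) \<ge> 0" if "x \<in> F" "z \<in> M y" for x z
      using c(2)[OF that] by (simp add: zero_le_mult_iff)
    then have "\<exists>s>0. y + s *\<^sub>R \<tau> \<in> K F"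
      using False by (intro K_perturb[OF assms(1,2) \<tau>Y(1)]) auto
    then show ?thesis
      using facet False \<open>c > 0\<close> c(3) by (simp add: contribution_def face_term_def)
  qed
  then show "contribution F y = R (F, \<Theta> F \<tau>)" "\<exists>s>0. y + s *\<^sub>R \<tau> \<in> K F"
    "fst y \<noteq> 0 \<and> fst y \<noteq> 1 \<Longrightarrow> F facet_of M y \<and> aff_dim (M y) = int (dim W) + 1"
    by auto
qed

text \<open>Such a point cannot be interior to the segment: at the times 0 and 1 one of the two
  moves leaves the strip because \<open>fst \<tau> \<noteq> 0\<close>, and otherwise a point of
  \<open>M y - F\<close> rises above \<open>F\<close> in one of the two directions.\<close>

lemma special_is_end:
  assumes "F \<in> nfaces" "y \<in> K F" "normal F \<tau>" "fst y = 0 \<or> fst y = 1 \<or> F \<noteq> M y"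
    "y + s *\<^sub>R \<tau> \<in> K F" "y - s' *\<^sub>R \<tau> \<in> K F" "s > 0" "s' > 0"
  shows False
proof (cases "fst y = 0 \<or> fst y = 1")
  case True
  have f: "0 \<le> fst (y + s *\<^sub>R \<tau>)" "fst (y + s *\<^sub>R \<tau>) \<le> 1" "0 \<le> fst (y - s' *\<^sub>R \<tau>)" "fst (y - s' *\<^sub>R \<tau>) \<le> 1"
    using assms(5,6) by (auto simp: K_def strip_def mem_Times_iff)
  have "fst \<tau> = 0"
    using True f assms(7,8) by (auto simp: zero_le_mult_iff mult_le_0_iff)
  then show False using end_orientation(1)[OF assms(1,2) True assms(3)] by simp
next
  case False
  then have facet: "F facet_of M y" "aff_dim (M y) = int (dim W) + 1"
    using K_cases[OF assms(1,2)] assms(4) by blast+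
  obtain c where c: "c \<noteq> 0"
      "\<And>x z. x \<in> F \<Longrightarrow> z \<in> M y - F \<Longrightarrow> c * inner \<tau> (L (x - z)) > 0"
    using facet_end[OF assms(1-3) facet] by metis
  obtain x z where xz: "x \<in> F" "z \<in> M y - F" using facet_dim(4)[OF facet(1)] by blast
  define k where "k = inner \<tau> (L x) - inner \<tau> (L z)"
  have k: "k \<noteq> 0"
    using c(2)[OF xz] by (auto simp: k_def linear_diff[OF linear_L] inner_diff_right)
  have "z \<in> Q" "x \<in> M y" using xz facet_dim(2)[OF facet(1)] by (auto simp: M_def argmax_on_def)
  then have h: "height y x = height y z"
    using xz by (auto simp: M_def argmax_on_def intro: antisym)
  have "x \<in> M (y + s *\<^sub>R \<tau>)" "x \<in> M (y + (- s') *\<^sub>R \<tau>)" using assms(5,6) xz by (auto simp: K_def)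
  then have "height (y + s *\<^sub>R \<tau>) z \<le> height (y + s *\<^sub>R \<tau>) x"
    "height (y + (- s') *\<^sub>R \<tau>) z \<le> height (y + (- s') *\<^sub>R \<tau>) x"
    using \<open>z \<in> Q\<close> by (auto simp: M_def argmax_on_def)
  then have "s * k \<ge> 0" "s' * k \<le> 0"
    unfolding height_shift h by (simp_all add: k_def algebra_simps)
  then show False using k assms(7,8) by (simp add: zero_le_mult_iff mult_le_0_iff)
qed

text \<open>At both parameters the height vanishes along \<open>F\<close>, so their difference is
  orthogonal to the image of \<open>dir_space F\<close> under \<open>L\<close>, as are multiples of
  \<open>\<tau>\<close>.\<close>

lemma K_line:
  assumes "F \<in> nfaces" "y0 \<in> K F" "normal F \<tau>" "y \<in> K F"
  obtains s where "y = y0 + s *\<^sub>R \<tau>"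
proof -
  define d where "d = y - y0"
  have dY: "d \<in> Y"
    using K_dim(3)[OF assms(1,2)] K_dim(3)[OF assms(1,4)] W
    by (auto simp: d_def strip_def Y_def subspace_diff)
  have dL: "inner d (L z) = 0" if "z \<in> dir_space F" for z
  proof -
    have "height (y0 + 1 *\<^sub>R d) z = 0" "height y0 z = 0"
      using assms(2,4) that argmax_on_zero_dir_space[OF linear_height, of F _ Q z]
      by (auto simp: K_def M_def d_def)
    then show ?thesis unfolding height_shift by simp
  qed
  define k where "k = inner \<tau> d / inner \<tau> \<tau>"
  have "d - k *\<^sub>R \<tau> \<in> L ` dir_space F"
    unfolding k_def by (rule normal_decomp[OF assms(1) inj_L_face[OF assms(1,2)] assms(3) dY])
  \<comment> \<open>This vector lies in that image and is orthogonal to it.\<close>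
  then have "inner (d - k *\<^sub>R \<tau>) (d - k *\<^sub>R \<tau>) = 0"
    using dL assms(3) by (auto simp: normal_def inner_diff_left)
  then have "d = k *\<^sub>R \<tau>" by simp
  then have "y = y0 + k *\<^sub>R \<tau>" by (simp add: d_def diff_eq_eq add.commute)
  then show ?thesis by (rule that)
qed

lemma normal_exists:
  assumes "F \<in> nfaces"
  obtains \<tau> where "normal F \<tau>"
proof -
  have s: "span (L ` dir_space F) = L ` dir_space F" "span Y = Y"
    using linear_span_image[OF linear_L, of "dir_space F"] subspace_Y
    by (simp_all add: span_eq_iff)
  have "dim (L ` dir_space F) \<le> dim (dir_space F)" by (rule dim_image_le[OF linear_L])
  then have "L ` dir_space F \<noteq> Y"
    using nfaces_dim[OF assms] dim_Y by auto
  then have "span (L ` dir_space F) \<subset> span Y"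
    using L_in_Y[OF nfaces_dim(3)[OF assms]] s by blast
  then obtain x where "x \<noteq> 0" "x \<in> span Y" "\<And>y. y \<in> span (L ` dir_space F) \<Longrightarrow> real_inner_class.orthogonal x y"
    using orthogonal_to_subspace_exists_gen by blast
  then have "normal F x" using s by (auto simp: normal_def real_inner_class.orthogonal_def)
  then show ?thesis by (rule that)
qed

lemma K_iff:
  assumes "F face_of Q"
  shows "y \<in> K F \<longleftrightarrow> y \<in> strip \<and> (\<forall>x\<in>F. \<forall>z\<in>Q. height y z \<le> height y x)"
  using face_of_imp_subset[OF assms] by (auto simp: K_def M_def argmax_on_def)

text \<open>A half-line in the strip has constant t, and letting \<open>s\<close> grow in the height
  inequalities leaves the inequalities for \<open>inner \<tau> (L z)\<close>. Then
  \<open>snd \<tau>\<close> alone makes \<open>F\<close> maximal, which \<open>no_ray\<close> allows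
  only for zero.\<close>

lemma K_bounded:
  assumes "F \<in> nfaces" "y0 \<in> K F" "normal F \<tau>"
  shows "\<exists>B. \<forall>s. y0 + s *\<^sub>R \<tau> \<in> K F \<longrightarrow> s \<le> B"
proof (rule ccontr)
  assume "\<not> ?thesis"
  then have large: "\<exists>s>B. y0 + s *\<^sub>R \<tau> \<in> K F" for B by (metis not_le)
  note face = nfaces_dim(3)[OF assms(1)]
  have str: "0 \<le> fst y \<and> fst y \<le> 1" if "y \<in> K F" for y
    using that by (auto simp: K_def strip_def mem_Times_iff)
  have f0: "fst \<tau> = 0"
  proof (rule ccontr)
    assume f: "fst \<tau> \<noteq> 0"
    \<comment> \<open>Past this value t has moved by more than 2, but the strip has width 1.\<close>
    obtain s where s: "s > 2 / \<bar>fst \<tau>\<bar>" "y0 + s *\<^sub>R \<tau> \<in> K F" using large by blast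
    have "s > 0" using s(1) by (smt (verit) divide_nonneg_nonneg abs_ge_zero)
    then have "\<bar>s * fst \<tau>\<bar> > 2" using s(1) f by (simp add: abs_mult field_simps)
    then show False using str[OF s(2)] str[OF assms(2)] by (simp add: abs_if split: if_splits)
  qed
  have k: "inner \<tau> (L z) \<le> inner \<tau> (L x)" if "x \<in> F" "z \<in> Q" for x z
  proof (rule ccontr)
    assume neg: "\<not> ?thesis"
    define a where "a = height y0 x - height y0 z"
    define b where "b = inner \<tau> (L z) - inner \<tau> (L x)"
    have b: "b > 0" using neg by (simp add: b_def)
    \<comment> \<open>At \<open>s = a / b\<close> the heights of \<open>z\<close> and
      \<open>x\<close> agree; beyond it \<open>z\<close> is higher.\<close>
    obtain s where s: "s > a / b" "y0 + s *\<^sub>R \<tau> \<in> K F" using large by blast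
    have "height (y0 + s *\<^sub>R \<tau>) z \<le> height (y0 + s *\<^sub>R \<tau>) x"
      using s(2) that by (simp add: K_iff[OF face])
    then have "s * b \<le> a" unfolding height_shift by (simp add: a_def b_def algebra_simps)
    then show False using s(1) b by (simp add: field_simps)
  qed
  have \<tau>L: "inner \<tau> (L z) = inner (snd \<tau>) (\<pi> z)" for z
    using f0 by (cases \<tau>) (simp add: L_def)
  have sW: "snd \<tau> \<in> W" using assms(3) by (auto simp: normal_def Y_def)
  have sub: "F \<subseteq> argmax_on (\<lambda>z. inner (snd \<tau>) (\<pi> z)) Q"
    using k face_of_imp_subset[OF face] by (auto simp: argmax_on_def \<tau>L)
  have sub0: "F \<subseteq> argmax_on (\<lambda>z. inner (snd y0) (\<pi> z) - \<phi> z - fst y0 * \<eta> z) Q"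
    using assms(2) by (simp add: K_def M_def height_eq)
  have y0W: "snd y0 \<in> W" using assms(2) by (auto simp: K_def strip_def)
  have "snd \<tau> = 0"
    using no_ray[OF face _ _ _ y0W sub0 sW sub] assms(1) str[OF assms(2)] by (simp add: nfaces_def)
  then show False using f0 assms(3) by (auto simp: normal_def prod_eq_iff)
qed


section \<open>Cancellation over all faces\<close>

definition crossings :: "'e set set" where
  "crossings = {G. G face_of Q \<and> aff_dim G = int (dim W) + 1 \<and>
     (\<exists>y\<in>strip. fst y \<noteq> 0 \<and> fst y \<noteq> 1 \<and> G \<subseteq> M y)}"

definition selected :: "real \<Rightarrow> 'e set set" where
  "selected t = {F \<in> nfaces. \<exists>w\<in>W. F \<subseteq> argmax_on (\<lambda>z. inner w (\<pi> z) - \<phi> z - t * \<eta> z) Q}"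

lemma selected_iff:
  assumes "0 \<le> t" "t \<le> 1"
  shows "F \<in> selected t \<longleftrightarrow> F \<in> nfaces \<and> (\<exists>y\<in>K F. fst y = t)"
  using assms by (auto simp: selected_def K_def strip_def M_def height_eq)

text \<open>The inclusion required of a crossing is an equality, because \<open>M y\<close> has
  dimension at most \<open>dim W + 1\<close> (\<open>dim_M_le\<close>).\<close>

lemma crossing_eq_M:
  assumes "F \<in> nfaces" "G \<in> crossings" "F facet_of G"
  obtains y where "y \<in> K F" "fst y \<noteq> 0" "fst y \<noteq> 1" "G = M y" "F \<noteq> M y"
proof -
  obtain y where y: "y \<in> strip" "fst y \<noteq> 0" "fst y \<noteq> 1" "G \<subseteq> M y" and
    G: "G face_of Q" "aff_dim G = int (dim W) + 1"
    using assms(2) by (auto simp: crossings_def)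
  have "F \<subseteq> G" using facet_dim[OF assms(3)] by simp
  then have yK: "y \<in> K F" using y by (auto simp: K_def)
  have ne: "G \<noteq> {}" using facet_dim[OF assms(3)] by auto
  then have d: "dim (dir_space G) = Suc (dim W)" using G(2) aff_dim_dir_space[of G] by simp
  have "G face_of M y"
    using face_of_subset[OF G(1) y(4)] face_of_imp_subset[OF M_face_of] by blast
  then have GM: "G = M y"
    using face_of_dim_less[OF convex_face[OF M_face_of] _ ne] d dim_M_le[OF K_dim(3,2)[OF assms(1) yK]]
    by simp
  moreover have "F \<noteq> G" using assms(3) by (auto simp: facet_of_def)
  ultimately show ?thesis using that yK y by blast
qed

text \<open>The contributions of the two ends of \<open>K F\<close> cancel. Every end is at time 0,
  at time 1 or at a crossing, and the equation is this cancellation with the time-1 term moved to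
  the right; if \<open>K F\<close> is empty, all terms vanish.\<close>

lemma face_sum:
  assumes "F \<in> nfaces"
  shows "(if F \<in> selected 0 then end_term F else 0) +
    (\<Sum>G | G \<in> crossings \<and> F facet_of G. face_term F G) = (if F \<in> selected 1 then end_term F else 0)"
proof (cases "K F = {}")
  case True
  then have "{G. G \<in> crossings \<and> F facet_of G} = {}"
    using crossing_eq_M[OF assms] by blast
  then have "(\<Sum>G | G \<in> crossings \<and> F facet_of G. face_term F G) = 0"
    by (simp only: sum.empty)
  moreover have "F \<notin> selected 0" "F \<notin> selected 1" using True by (auto simp: selected_iff)
  ultimately show ?thesis by simp
next
  case False
  then obtain y0 where y0: "y0 \<in> K F" by blast
  obtain \<tau> where \<tau>: "normal F \<tau>" using normal_exists[OF assms] by blast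
  note face = nfaces_dim(3)[OF assms]
  note inj = inj_L_face[OF assms y0]
  define S where "S = {s. y0 + s *\<^sub>R \<tau> \<in> K F}"
  have "0 \<in> S" using y0 by (simp add: S_def)
  obtain B where B: "\<And>s. s \<in> S \<Longrightarrow> s \<le> B"
    using K_bounded[OF assms y0 \<tau>] by (auto simp: S_def)
  obtain B' where B': "\<And>s. y0 + s *\<^sub>R (- \<tau>) \<in> K F \<Longrightarrow> s \<le> B'"
    using K_bounded[OF assms y0 normal_uminus[OF \<tau>]] by blast
  have B'': "- B' \<le> s" if "s \<in> S" for s
    using B'[of "- s"] that by (simp add: S_def)
  \<comment> \<open>All constraints are affine in \<open>s\<close>, so \<open>S\<close> is closed
    and its bounds are attained.\<close>
  have "S = {s. 0 \<le> fst y0 + s * fst \<tau>} \<inter> {s. fst y0 + s * fst \<tau> \<le> 1} \<inter>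
      (\<Inter>x\<in>F. \<Inter>z\<in>Q. {s. height y0 z + s * inner \<tau> (L z) \<le> height y0 x + s * inner \<tau> (L x)})"
    using K_dim(3)[OF assms y0] \<tau> W
    by (auto simp: S_def K_iff[OF face] height_shift strip_def mem_Times_iff normal_def Y_def
        subspace_add subspace_scale)
  also have "closed \<dots>"
    by (intro closed_Int closed_INT ballI closed_Collect_le continuous_intros)
  finally have "closed S" .
  have bdd: "bdd_above S" "bdd_below S" using B B'' by (auto simp: bdd_above_def bdd_below_def)
  define l where "l = Inf S"
  define r where "r = Sup S"
  have lS: "l \<in> S" and rS: "r \<in> S"
    unfolding l_def r_def using \<open>closed S\<close> bdd \<open>0 \<in> S\<close>
    by (auto intro: closed_contains_Inf closed_contains_Sup)
  have l: "l \<le> s" and r: "s \<le> r" if "s \<in> S" for s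
    unfolding l_def r_def using that bdd by (auto intro: cInf_lower cSup_upper)
  define yl where "yl = y0 + l *\<^sub>R \<tau>"
  define yr where "yr = y0 + r *\<^sub>R \<tau>"
  have ylK: "yl \<in> K F" and yrK: "yr \<in> K F" using lS rS by (auto simp: S_def yl_def yr_def)
  have outl: "yl - s *\<^sub>R \<tau> \<notin> K F" if "s > 0" for s
    using l[of "l - s"] that by (auto simp: S_def yl_def scaleR_diff_left algebra_simps)
  have outr: "yr - s *\<^sub>R (- \<tau>) \<notin> K F" if "s > 0" for s
    using r[of "r + s"] that by (auto simp: S_def yr_def scaleR_add_left algebra_simps)
  note El = lower_end[OF assms ylK \<tau> outl]
  note Er = lower_end[OF assms yrK normal_uminus[OF \<tau>] outr]
  obtain s0 where "s0 > 0" "yl + s0 *\<^sub>R \<tau> \<in> K F" using El(2) by blast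
  then have lr: "l < r" using r[of "l + s0"] by (simp add: S_def yl_def scaleR_add_left algebra_simps)
  have "contribution F yr = R (F, \<lambda>bs. - \<Theta> F \<tau> bs)"
    using lower_end(1)[OF assms yrK normal_uminus[OF \<tau>] outr]
    by (simp add: \<Theta>_uminus[OF assms inj \<tau>])
  also have "\<dots> = - R (F, \<Theta> F \<tau>)"
    using R_uminus[OF face _ is_orientation_\<Theta>[OF assms inj \<tau>]] assms by (simp add: nfaces_def)
  also have "\<dots> = - contribution F yl" by (simp add: lower_end(1)[OF assms ylK \<tau> outl])
  finally have "contribution F yr = - contribution F yl" .
  then have contr: "contribution F yl + contribution F yr = 0" by simp
  \<comment> \<open>The converse accounting: nothing strictly between the two ends is at time 0 or 1
    or at a crossing.\<close>
  have ends: "y = yl \<or> y = yr" if y: "y \<in> K F" "fst y = 0 \<or> fst y = 1 \<or> F \<noteq> M y" for y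
  proof (rule ccontr)
    assume n: "\<not> ?thesis"
    obtain s where s: "y = y0 + s *\<^sub>R \<tau>" using K_line[OF assms y0 \<tau> y(1)] by blast
    then have "s \<in> S" using y by (simp add: S_def)
    then have "l < s" "s < r" using l[of s] r[of s] n s by (auto simp: yl_def yr_def less_le)
    then show False
      using special_is_end[OF assms y(1) \<tau> y(2), of "r - s" "s - l"] ylK yrK
      by (simp add: s yl_def yr_def scaleR_diff_left algebra_simps)
  qed
  \<comment> \<open>If both ends lay at the same time 0 or 1, one membership in
    \<open>selected\<close> would have to stand for two contributions.\<close>
  have fst_ne: "fst yl \<noteq> fst yr" if "fst yl = 0 \<or> fst yl = 1 \<or> fst yr = 0 \<or> fst yr = 1"
  proof -
    have "fst \<tau> \<noteq> 0"
      using that end_orientation(1)[OF assms ylK _ \<tau>] end_orientation(1)[OF assms yrK _ \<tau>] by blast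
    then show ?thesis using lr by (simp add: yl_def yr_def)
  qed
  have sel: "F \<in> selected t \<longleftrightarrow> fst yl = t \<or> fst yr = t" if "t = 0 \<or> t = 1" for t
    using that assms ends ylK yrK by (subst selected_iff) auto
  define Z where "Z = {y \<in> {yl, yr}. fst y \<noteq> 0 \<and> fst y \<noteq> 1}"
  have ZK: "y \<in> K F" "fst y \<noteq> 0" "fst y \<noteq> 1" "F facet_of M y" "aff_dim (M y) = int (dim W) + 1"
    if "y \<in> Z" for y
    using that ylK yrK El(3) Er(3) by (auto simp: Z_def)
  have cr: "{G. G \<in> crossings \<and> F facet_of G} = M ` Z"
  proof (intro subset_antisym subsetI)
    fix G assume "G \<in> {G. G \<in> crossings \<and> F facet_of G}"
    then obtain y where "y \<in> K F" "fst y \<noteq> 0" "fst y \<noteq> 1" "G = M y" "F \<noteq> M y"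
      using crossing_eq_M[OF assms] by blast
    then show "G \<in> M ` Z" using ends[of y] by (auto simp: Z_def)
  next
    fix G assume "G \<in> M ` Z"
    then obtain y where y: "y \<in> Z" "G = M y" by blast
    show "G \<in> {G. G \<in> crossings \<and> F facet_of G}"
      using ZK[OF y(1)] y(2) M_face_of K_dim(3)[OF assms ZK(1)[OF y(1)]]
      by (auto simp: crossings_def)
  qed
  \<comment> \<open>A face of dimension \<open>dim W + 1\<close> is maximal at one parameter only:
    otherwise the heights at both ends vanish on its direction space, which \<open>L\<close> maps
    onto \<open>Y\<close>, and \<open>\<tau>\<close> would be orthogonal to itself. So two crossings
    give two summands.\<close>
  have "M yl \<noteq> M yr" if z: "yl \<in> Z"
  proof
    assume eq: "M yl = M yr"
    have "M yl \<noteq> {}" using facet_dim(2,3)[OF ZK(4)[OF z]] by blast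
    then have d: "dim (dir_space (M yl)) = Suc (dim W)"
      using ZK(5)[OF z] aff_dim_dir_space[of "M yl"] by simp
    have "L ` dir_space (M yl) = Y"
      by (rule L_onto[OF M_face_of inj_L[OF K_dim(3,2)[OF assms ylK]] d])
    moreover have "\<tau> \<in> Y" using \<tau> by (simp add: normal_def)
    ultimately obtain g where g: "g \<in> dir_space (M yl)" "L g = \<tau>" by (metis imageE)
    have "yl + (r - l) *\<^sub>R \<tau> = yr" by (simp add: yl_def yr_def scaleR_diff_left)
    then have "height yl g = 0" "height (yl + (r - l) *\<^sub>R \<tau>) g = 0"
      using argmax_on_zero_dir_space[OF linear_height, of "M yl" yl Q g]
        argmax_on_zero_dir_space[OF linear_height, of "M yr" yr Q g] g eq
      by (auto simp: M_def)
    then have "inner \<tau> \<tau> = 0" using lr g by (simp add: height_shift)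
    then show False using \<tau> by (simp add: normal_def)
  qed
  then have "inj_on M Z" by (auto simp: inj_on_def Z_def)
  have "yl \<noteq> yr" using lr \<tau> by (simp add: yl_def yr_def normal_def)
  have "(\<Sum>G | G \<in> crossings \<and> F facet_of G. face_term F G) = (\<Sum>y\<in>Z. face_term F (M y))"
    unfolding cr by (simp add: sum.reindex[OF \<open>inj_on M Z\<close>])
  also have "\<dots> = (\<Sum>y\<in>{yl, yr}. if fst y \<noteq> 0 \<and> fst y \<noteq> 1 then face_term F (M y) else 0)"
    unfolding Z_def by (rule sum.inter_filter) simp
  also have "\<dots> = (if fst yl \<noteq> 0 \<and> fst yl \<noteq> 1 then face_term F (M yl) else 0) +
      (if fst yr \<noteq> 0 \<and> fst yr \<noteq> 1 then face_term F (M yr) else 0)"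
    using \<open>yl \<noteq> yr\<close> by simp
  finally show ?thesis
    using contr fst_ne sel[of 0] sel[of 1]
    by (auto simp: contribution_def algebra_simps split: if_splits)
qed

lemma finite_crossings: "finite crossings"
  using finite_polytope_faces[OF polytope] by (auto simp: crossings_def intro: finite_subset[rotated])

text \<open>Summing \<open>face_sum\<close> over \<open>F\<close> and exchanging the sums collects
  the terms of all facets of one crossing. They carry the boundary orientations of
  \<open>G_orientation\<close>, so together they form a value of the coboundary, which is
  zero.\<close>

lemma sum_selected_eq: "(\<Sum>F\<in>selected 0. end_term F) = (\<Sum>F\<in>selected 1. end_term F)"
proof -
  have boundary_sum: "(\<Sum>F | F \<in> nfaces \<and> F facet_of G. face_term F G) = 0" if G: "G \<in> crossings" for G
  proof -
    have Gf: "G face_of Q" "aff_dim G = int (dim W) + 1" using G by (auto simp: crossings_def)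
    obtain y where y: "y \<in> strip" "G \<subseteq> M y" using G by (auto simp: crossings_def)
    have ne: "G \<noteq> {}" using Gf by auto
    then have d: "dim (dir_space G) = Suc (dim W)" using Gf aff_dim_dir_space[of G] by simp
    have "inj_on L (dir_space (M y))"
      using inj_L[OF y(1)] dim_subset[OF dir_space_mono[OF y(2)]] d by simp
    then have inj: "inj_on L (dir_space G)" using dir_space_mono[OF y(2)] by (rule inj_on_subset)
    have "is_orientation (dir_space G) (G_orientation G)"
      unfolding G_orientation_def using \<Omega>(1) L_onto[OF Gf(1) inj d]
      by (intro is_orientation_pull[OF linear_L inj]) simp
    then have "coboundary R (G, G_orientation G) = 0" by (rule R_closed[OF Gf])
    \<comment> \<open>The restriction to \<open>nfaces\<close> loses no facet, so the sum really is
      the full coboundary.\<close>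
    moreover have "{F. F \<in> nfaces \<and> F facet_of G} = {F. F facet_of G}"
      using Gf by (auto simp: nfaces_def facet_of_def intro: face_of_trans)
    ultimately show ?thesis by (simp add: coboundary_def face_term_def)
  qed
  have "(\<Sum>F\<in>nfaces. (if F \<in> selected 0 then end_term F else 0) +
      (\<Sum>G | G \<in> crossings \<and> F facet_of G. face_term F G)) =
      (\<Sum>F\<in>nfaces. if F \<in> selected 1 then end_term F else 0)"
    by (rule sum.cong[OF refl face_sum])
  moreover have "(\<Sum>F\<in>nfaces. if F \<in> selected t then end_term F else 0) = (\<Sum>F\<in>selected t. end_term F)" for t
  proof -
    have "{F \<in> nfaces. F \<in> selected t} = selected t" by (auto simp: selected_def)
    then show ?thesis using sum.inter_filter[OF finite_nfaces, of end_term "\<lambda>F. F \<in> selected t"] by simp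
  qed
  moreover have "(\<Sum>F\<in>nfaces. \<Sum>G | G \<in> crossings \<and> F facet_of G. face_term F G) =
      (\<Sum>G\<in>crossings. \<Sum>F | F \<in> nfaces \<and> F facet_of G. face_term F G)"
    by (rule sum.swap_restrict[OF finite_nfaces finite_crossings])
  ultimately show ?thesis using boundary_sum by (simp add: sum.distrib)
qed

end

subsection \<open>Product cochains\<close>

lemma face_of_Times_cases:
  fixes c :: "'a::euclidean_space set" and d :: "'b::euclidean_space set"
  assumes "F face_of c \<times> d" "F \<noteq> {}"
  obtains \<delta> l where "F = \<delta> \<times> l" "\<delta> face_of c" "l face_of d" "\<delta> \<noteq> {}" "l \<noteq> {}"
  using assms unfolding face_of_Times_decomp by blast

lemma aff_dim_Times:
  fixes c :: "'a::euclidean_space set" and d :: "'b::euclidean_space set"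
  assumes "c \<noteq> {}" "d \<noteq> {}"
  shows "aff_dim (c \<times> d) = aff_dim c + aff_dim d"
  using assms
  by (simp add: aff_dim_dir_space dir_space_Times dim_Times)

lemma facet_of_Times_left:
  fixes c :: "'a::euclidean_space set" and d :: "'b::euclidean_space set"
  assumes "\<delta> facet_of c" "d \<noteq> {}" "convex d"
  shows "\<delta> \<times> d facet_of c \<times> d"
proof -
  have "c \<noteq> {}" using facet_dim(2,3)[OF assms(1)] by auto
  then show ?thesis using assms
    by (auto simp: facet_of_def aff_dim_Times intro: face_of_Times face_of_refl)
qed

lemma facet_of_Times_right:
  fixes c :: "'a::euclidean_space set" and d :: "'b::euclidean_space set"
  assumes "l facet_of d" "c \<noteq> {}" "convex c"
  shows "c \<times> l facet_of c \<times> d"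
proof -
  have "d \<noteq> {}" using facet_dim(2,3)[OF assms(1)] by auto
  then show ?thesis using assms
    by (auto simp: facet_of_def aff_dim_Times intro: face_of_Times face_of_refl)
qed

text \<open>The outward vector (x - y, 0) belongs to the first factor and already stands in front,
  so no sign appears.\<close>

lemma splits_boundary_left:
  fixes c :: "'a::euclidean_space set" and d :: "'b::euclidean_space set"
  assumes "polytope c" "polytope d" "d \<noteq> {}" "\<delta> facet_of c"
    "is_orientation (dir_space c \<times> dir_space d) \<Theta>" "splits (dir_space c) \<alpha> (dir_space d) \<beta> \<Theta>"
  shows "splits (dir_space \<delta>) (boundary_orientation c \<alpha> \<delta>) (dir_space d) \<beta>
    (boundary_orientation (c \<times> d) \<Theta> (\<delta> \<times> d))"
  unfolding splits_def
proof (intro conjI ballI)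
  have o: "is_orientation (dir_space c) \<alpha>" "is_orientation (dir_space d) \<beta>"
    using assms(6) by (auto simp: splits_def)
  show "is_orientation (dir_space d) \<beta>" by (rule o)
  show "is_orientation (dir_space \<delta>) (boundary_orientation c \<alpha> \<delta>)"
    by (rule is_orientation_boundary[OF polytope_imp_polyhedron[OF assms(1)] assms(4) o(1)])
  fix bs cs assume b: "bs \<in> ordered_bases (dir_space \<delta>)" "cs \<in> ordered_bases (dir_space d)"
  obtain x y where xy: "x \<in> \<delta>" "y \<in> c - \<delta>" using facet_dim(4)[OF assms(4)] by blast
  obtain z where z: "z \<in> d" using assms(3) by blast
  have ne: "c \<noteq> {}" "\<delta> \<noteq> {}" using xy by auto
  have "product_basis bs cs \<in> ordered_bases (dir_space (\<delta> \<times> d))"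
    using ordered_bases_product[OF b] by (simp add: dir_space_Times[OF ne(2) assms(3)])
  then have "boundary_orientation (c \<times> d) \<Theta> (\<delta> \<times> d) (product_basis bs cs) =
      \<Theta> (((x, z) - (y, z)) # product_basis bs cs)"
    using assms(5) xy z
    by (intro boundary_orientation_eq[OF polytope_imp_polyhedron[OF polytope_Times[OF assms(1,2)]]
          facet_of_Times_left[OF assms(4,3) polytope_imp_convex[OF assms(2)]]])
      (auto simp: dir_space_Times[OF ne(1) assms(3)])
  also have "\<dots> = \<Theta> (product_basis ((x - y) # bs) cs)" by (simp add: product_basis_def)
  also have "\<dots> = \<alpha> ((x - y) # bs) * \<beta> cs"
    using assms(6) ordered_bases_outward[OF polytope_imp_polyhedron[OF assms(1)] assms(4) xy b(1)] b(2) by (simp add: splits_def)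
  also have "\<dots> = boundary_orientation c \<alpha> \<delta> bs * \<beta> cs"
    using boundary_orientation_eq[OF polytope_imp_polyhedron[OF assms(1)] assms(4) xy b(1) o(1)] by simp
  finally show "boundary_orientation (c \<times> d) \<Theta> (\<delta> \<times> d) (product_basis bs cs) =
      boundary_orientation c \<alpha> \<delta> bs * \<beta> cs" .
qed

text \<open>The outward vector (0, x - y) must pass a whole basis of \<open>dir_space c\<close>. The
  resulting sign is put on the orientation of \<open>c\<close>, since a cochain takes orientations
  as arguments.\<close>

lemma splits_boundary_right:
  fixes c :: "'a::euclidean_space set" and d :: "'b::euclidean_space set"
  assumes "polytope c" "polytope d" "c \<noteq> {}" "l facet_of d"
    "is_orientation (dir_space c \<times> dir_space d) \<Theta>" "splits (dir_space c) \<alpha> (dir_space d) \<beta> \<Theta>"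
  shows "splits (dir_space c) (\<lambda>bs. (-1) ^ dim (dir_space c) * \<alpha> bs) (dir_space l)
    (boundary_orientation d \<beta> l) (boundary_orientation (c \<times> d) \<Theta> (c \<times> l))"
  unfolding splits_def
proof (intro conjI ballI)
  have o: "is_orientation (dir_space c) \<alpha>" "is_orientation (dir_space d) \<beta>"
    using assms(6) by (auto simp: splits_def)
  show "is_orientation (dir_space c) (\<lambda>bs. (-1) ^ dim (dir_space c) * \<alpha> bs)"
    using o(1) orientation_uminus[OF o(1)] by (cases "even (dim (dir_space c))") auto
  show "is_orientation (dir_space l) (boundary_orientation d \<beta> l)"
    by (rule is_orientation_boundary[OF polytope_imp_polyhedron[OF assms(2)] assms(4) o(2)])
  fix bs cs assume b: "bs \<in> ordered_bases (dir_space c)" "cs \<in> ordered_bases (dir_space l)"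
  obtain x y where xy: "x \<in> l" "y \<in> d - l" using facet_dim(4)[OF assms(4)] by blast
  obtain z where z: "z \<in> c" using assms(3) by blast
  have ne: "d \<noteq> {}" "l \<noteq> {}" using xy by auto
  have "product_basis bs cs \<in> ordered_bases (dir_space (c \<times> l))"
    using ordered_bases_product[OF b] by (simp add: dir_space_Times[OF assms(3) ne(2)])
  then have "boundary_orientation (c \<times> d) \<Theta> (c \<times> l) (product_basis bs cs) =
      \<Theta> (((z, x) - (z, y)) # product_basis bs cs)"
    using assms(5) xy z
    by (intro boundary_orientation_eq[OF polytope_imp_polyhedron[OF polytope_Times[OF assms(1,2)]]
          facet_of_Times_right[OF assms(4,3) polytope_imp_convex[OF assms(1)]]])
      (auto simp: dir_space_Times[OF assms(3) ne(1)])
  also have "\<dots> = (-1) ^ length bs * \<Theta> (product_basis bs ((x - y) # cs))"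
    using orientation_move[OF assms(5), of "[]" "(0, x - y)" "map (\<lambda>x. (x, 0)) bs"]
    by (simp add: product_basis_def)
  also have "\<dots> = (-1) ^ length bs * (\<alpha> bs * \<beta> ((x - y) # cs))"
    using assms(6) ordered_bases_outward[OF polytope_imp_polyhedron[OF assms(2)] assms(4) xy b(2)] b(1) by (simp add: splits_def)
  also have "\<dots> = (-1) ^ dim (dir_space c) * \<alpha> bs * boundary_orientation d \<beta> l cs"
    using boundary_orientation_eq[OF polytope_imp_polyhedron[OF assms(2)] assms(4) xy b(2) o(2)] ordered_bases_length[OF b(1)] by simp
  finally show "boundary_orientation (c \<times> d) \<Theta> (c \<times> l) (product_basis bs cs) =
      (-1) ^ dim (dir_space c) * \<alpha> bs * boundary_orientation d \<beta> l cs" .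
qed

locale cochain_pair =
  fixes X :: "'a::euclidean_space set set" and p q :: nat
    and rp rq :: "('a, 's::ring) cochain"
  assumes X: "P_complex X" and polytope_cell: "\<And>c. c \<in> X \<Longrightarrow> polytope c"
    and rp: "rp \<in> cochains p X" "closed_cochain p X rp"
    and rq: "rq \<in> cochains q X" "closed_cochain q X rq"
begin

text \<open>The cross product of \<open>rp\<close> and \<open>rq\<close>, extended by zero to the
  other bidegrees; the projections recover the factors of a face.\<close>

definition product_cochain :: "('a \<times> 'a, 's) cochain" where
  "product_cochain = (\<lambda>(F, \<Omega>).
     if aff_dim (fst ` F) = int p \<and> aff_dim (snd ` F) = int q then
       (let (\<alpha>, \<beta>) = (SOME (\<alpha>, \<beta>). splits (dir_space (fst ` F)) \<alpha> (dir_space (snd ` F)) \<beta> \<Omega>)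
        in rp (fst ` F, \<alpha>) * rq (snd ` F, \<beta>))
     else 0)"

lemma face_in_X: "c \<in> X \<Longrightarrow> f face_of c \<Longrightarrow> f \<noteq> {} \<Longrightarrow> f \<in> X"
  using X unfolding P_complex_def faces_def by blast

lemma rp_uminus:
  "c \<in> X \<Longrightarrow> aff_dim c = int p \<Longrightarrow> is_orientation (dir_space c) \<alpha> \<Longrightarrow>
    rp (c, \<lambda>bs. - \<alpha> bs) = - rp (c, \<alpha>)"
  using rp(1) by (force simp: cochains_def oriented_cells_def)

lemma rq_uminus:
  "c \<in> X \<Longrightarrow> aff_dim c = int q \<Longrightarrow> is_orientation (dir_space c) \<alpha> \<Longrightarrow>
    rq (c, \<lambda>bs. - \<alpha> bs) = - rq (c, \<alpha>)"
  using rq(1) by (force simp: cochains_def oriented_cells_def)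

text \<open>By \<open>splits_unique\<close> another choice of orientations reverses both, and the
  two signs cancel in the product.\<close>

lemma product_cochain_eq:
  assumes "\<delta> \<in> X" "l \<in> X" "aff_dim \<delta> = int p" "aff_dim l = int q"
    "splits (dir_space \<delta>) \<alpha> (dir_space l) \<beta> \<Omega>"
  shows "product_cochain (\<delta> \<times> l, \<Omega>) = rp (\<delta>, \<alpha>) * rq (l, \<beta>)"
proof -
  have ne: "\<delta> \<noteq> {}" "l \<noteq> {}" using assms(3,4) by auto
  define ab where "ab = (SOME (\<alpha>, \<beta>). splits (dir_space \<delta>) \<alpha> (dir_space l) \<beta> \<Omega>)"
  obtain a b where ab': "ab = (a, b)" by (cases ab)
  have "case ab of (\<alpha>, \<beta>) \<Rightarrow> splits (dir_space \<delta>) \<alpha> (dir_space l) \<beta> \<Omega>"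
    unfolding ab_def by (rule someI[of _ "(\<alpha>, \<beta>)"]) (simp add: assms(5))
  then have s: "splits (dir_space \<delta>) a (dir_space l) b \<Omega>" by (simp add: ab')
  have "product_cochain (\<delta> \<times> l, \<Omega>) = rp (\<delta>, a) * rq (l, b)"
    using ne assms(3,4) by (simp add: product_cochain_def ab_def[symmetric] ab')
  also have "\<dots> = rp (\<delta>, \<alpha>) * rq (l, \<beta>)"
    using splits_unique[OF assms(5) s subspace_dir_space subspace_dir_space]
      rp_uminus[OF assms(1,3)] rq_uminus[OF assms(2,4)] assms(5)
    by (auto simp: splits_def)
  finally show ?thesis .
qed

lemma product_cochain_other:
  assumes "\<delta> \<noteq> {}" "l \<noteq> {}" "\<not> (aff_dim \<delta> = int p \<and> aff_dim l = int q)"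
  shows "product_cochain (\<delta> \<times> l, \<Omega>) = 0"
  using assms by (auto simp: product_cochain_def)

lemma product_cochain_uminus:
  assumes "\<gamma> \<in> X" "F face_of \<gamma> \<times> \<gamma>" "F \<noteq> {}" "is_orientation (dir_space F) \<Theta>"
  shows "product_cochain (F, \<lambda>bs. - \<Theta> bs) = - product_cochain (F, \<Theta>)"
proof -
  obtain \<delta> l where F: "F = \<delta> \<times> l" "\<delta> face_of \<gamma>" "l face_of \<gamma>" "\<delta> \<noteq> {}" "l \<noteq> {}"
    using face_of_Times_cases[OF assms(2,3)] .
  then have X: "\<delta> \<in> X" "l \<in> X" using face_in_X[OF assms(1)] by auto
  show ?thesis
  proof (cases "aff_dim \<delta> = int p \<and> aff_dim l = int q")
    case True
    obtain \<alpha> \<beta> where s: "splits (dir_space \<delta>) \<alpha> (dir_space l) \<beta> \<Theta>"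
      using splits_exists[OF _ subspace_dir_space subspace_dir_space] assms(4) F
      by (metis dir_space_Times)
    then show ?thesis
      using product_cochain_eq[OF X _ _ s] product_cochain_eq[OF X _ _ splits_uminus[OF s]] True
        rp_uminus[OF X(1)] by (simp add: F(1) splits_def)
  next
    case False
    then show ?thesis using F(1) product_cochain_other[OF F(4,5) False] by simp
  qed
qed

lemma face_same_aff_dim:
  assumes "c \<in> X" "f face_of c" "f \<noteq> {}" "aff_dim c \<le> aff_dim f"
  shows "f = c"
proof (rule face_of_dim_less[OF polytope_imp_convex[OF polytope_cell[OF assms(1)]] assms(2,3)])
  have "c \<noteq> {}" using assms face_of_imp_subset by blast
  then show "dim (dir_space c) \<le> dim (dir_space f)"
    using assms(3,4) by (simp add: aff_dim_dir_space)
qed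

text \<open>The Leibniz rule, where at most one of its two terms survives for a given bidegree: for
  (p + 1, q) the sum factors as \<open>coboundary rp\<close> times a constant, for (p, q + 1) as a
  constant times \<open>coboundary rq\<close>, and in other bidegrees every facet has value
  zero.\<close>

lemma product_cochain_closed:
  assumes "c \<in> X" "d \<in> X" "aff_dim (c \<times> d) = int (p + q) + 1"
    "is_orientation (dir_space (c \<times> d)) \<Theta>"
  shows "coboundary product_cochain (c \<times> d, \<Theta>) = 0"
proof -
  have ne: "c \<noteq> {}" "d \<noteq> {}" using X assms(1,2) by (auto simp: P_complex_def)
  note poly = polytope_cell[OF assms(1)] polytope_cell[OF assms(2)]
  note conv = poly[THEN polytope_imp_convex]
  have dims: "aff_dim c + aff_dim d = int (p + q) + 1" using assms(3) aff_dim_Times[OF ne] by simp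
  have or: "is_orientation (dir_space c \<times> dir_space d) \<Theta>"
    using assms(4) by (simp add: dir_space_Times[OF ne])
  obtain \<alpha> \<beta> where s: "splits (dir_space c) \<alpha> (dir_space d) \<beta> \<Theta>"
    using splits_exists[OF or subspace_dir_space subspace_dir_space] .
  then have o: "is_orientation (dir_space c) \<alpha>" "is_orientation (dir_space d) \<beta>"
    by (auto simp: splits_def)
  let ?B = "boundary_orientation (c \<times> d) \<Theta>"
  have fin: "finite {F. F facet_of c \<times> d}"
    using finite_polytope_facets[OF polytope_Times[OF poly]] .
  \<comment> \<open>Contrapositive form: a facet with non-zero value determines the bidegree of
    \<open>c \<times> d\<close> and changes only one factor.\<close>
  have zero: "(\<exists>\<delta>. F = \<delta> \<times> d \<and> \<delta> facet_of c \<and> aff_dim c = int p + 1 \<and> aff_dim d = int q) \<or>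
      (\<exists>l. F = c \<times> l \<and> l facet_of d \<and> aff_dim c = int p \<and> aff_dim d = int q + 1)"
    if F: "F facet_of c \<times> d" and nz: "product_cochain (F, ?B F) \<noteq> 0" for F
  proof -
    have "F face_of c \<times> d" "F \<noteq> {}" using F by (auto simp: facet_of_def)
    then obtain \<delta> l where \<delta>: "F = \<delta> \<times> l" "\<delta> face_of c" "l face_of d" "\<delta> \<noteq> {}" "l \<noteq> {}"
      using face_of_Times_cases by metis
    have pq: "aff_dim \<delta> = int p" "aff_dim l = int q"
      using product_cochain_other[OF \<delta>(4,5)] nz \<delta>(1) by auto
    have "aff_dim \<delta> \<le> aff_dim c" "aff_dim l \<le> aff_dim d"
      using \<delta>(2,3) face_of_imp_subset aff_dim_subset by blast+
    then have "aff_dim c = int p + 1 \<and> aff_dim d = int q \<or> aff_dim c = int p \<and> aff_dim d = int q + 1"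
      using dims pq by auto
    then show ?thesis
    proof
      assume *: "aff_dim c = int p + 1 \<and> aff_dim d = int q"
      then have "l = d" using face_same_aff_dim[OF assms(2) \<delta>(3,5)] pq by simp
      then show ?thesis using * \<delta> pq by (auto simp: facet_of_def)
    next
      assume *: "aff_dim c = int p \<and> aff_dim d = int q + 1"
      then have "\<delta> = c" using face_same_aff_dim[OF assms(1) \<delta>(2,4)] pq by simp
      then show ?thesis using * \<delta> pq by (auto simp: facet_of_def)
    qed
  qed
  consider "aff_dim c = int p + 1 \<and> aff_dim d = int q" | "aff_dim c = int p \<and> aff_dim d = int q + 1"
    | "\<not> (aff_dim c = int p + 1 \<and> aff_dim d = int q)" "\<not> (aff_dim c = int p \<and> aff_dim d = int q + 1)"
    by blast
  then show ?thesis
  proof cases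
    case 1
    have inj: "inj_on (\<lambda>\<delta>. \<delta> \<times> d) {\<delta>. \<delta> facet_of c}"
      using ne by (auto simp: inj_on_def times_eq_iff)
    have "coboundary product_cochain (c \<times> d, \<Theta>) =
        (\<Sum>F\<in>(\<lambda>\<delta>. \<delta> \<times> d) ` {\<delta>. \<delta> facet_of c}. product_cochain (F, ?B F))"
      unfolding coboundary_def prod.case
      using zero 1 fin facet_of_Times_left[OF _ ne(2) conv(2)]
      by (intro sum.mono_neutral_right) auto
    also have "\<dots> = (\<Sum>\<delta> | \<delta> facet_of c. product_cochain (\<delta> \<times> d, ?B (\<delta> \<times> d)))"
      by (simp add: sum.reindex[OF inj])
    also have "\<dots> = (\<Sum>\<delta> | \<delta> facet_of c. rp (\<delta>, boundary_orientation c \<alpha> \<delta>) * rq (d, \<beta>))"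
    proof (intro sum.cong refl)
      fix \<delta> assume "\<delta> \<in> {\<delta>. \<delta> facet_of c}"
      then have \<delta>: "\<delta> facet_of c" by simp
      show "product_cochain (\<delta> \<times> d, ?B (\<delta> \<times> d)) = rp (\<delta>, boundary_orientation c \<alpha> \<delta>) * rq (d, \<beta>)"
        by (rule product_cochain_eq[OF face_in_X[OF assms(1)] assms(2) _ _
              splits_boundary_left[OF poly ne(2) \<delta> or s]])
          (use \<delta> 1 in \<open>auto simp: facet_of_def\<close>)
    qed
    also have "\<dots> = coboundary rp (c, \<alpha>) * rq (d, \<beta>)"
      by (simp add: coboundary_def sum_distrib_right)
    also have "\<dots> = 0"
      using rp(2) 1 assms(1) o by (auto simp: closed_cochain_def oriented_cells_def)
    finally show ?thesis .
  next
    case 2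
    have inj: "inj_on (\<lambda>l. c \<times> l) {l. l facet_of d}"
      using ne by (auto simp: inj_on_def times_eq_iff)
    let ?a = "\<lambda>bs. (-1) ^ dim (dir_space c) * \<alpha> bs"
    have "coboundary product_cochain (c \<times> d, \<Theta>) =
        (\<Sum>F\<in>(\<lambda>l. c \<times> l) ` {l. l facet_of d}. product_cochain (F, ?B F))"
      unfolding coboundary_def prod.case
      using zero 2 fin facet_of_Times_right[OF _ ne(1) conv(1)]
      by (intro sum.mono_neutral_right) auto
    also have "\<dots> = (\<Sum>l | l facet_of d. product_cochain (c \<times> l, ?B (c \<times> l)))"
      by (simp add: sum.reindex[OF inj])
    also have "\<dots> = (\<Sum>l | l facet_of d. rp (c, ?a) * rq (l, boundary_orientation d \<beta> l))"
    proof (intro sum.cong refl)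
      fix l assume "l \<in> {l. l facet_of d}"
      then have l: "l facet_of d" by simp
      show "product_cochain (c \<times> l, ?B (c \<times> l)) = rp (c, ?a) * rq (l, boundary_orientation d \<beta> l)"
        by (rule product_cochain_eq[OF assms(1) face_in_X[OF assms(2)] _ _
              splits_boundary_right[OF poly ne(1) l or s]])
          (use l 2 in \<open>auto simp: facet_of_def\<close>)
    qed
    also have "\<dots> = rp (c, ?a) * coboundary rq (d, \<beta>)"
      by (simp add: coboundary_def sum_distrib_left)
    also have "\<dots> = 0"
      using rq(2) 2 assms(2) o by (auto simp: closed_cochain_def oriented_cells_def)
    finally show ?thesis .
  next
    case 3
    then have "\<forall>F\<in>{F. F facet_of c \<times> d}. product_cochain (F, ?B F) = 0" using zero by blast
    then show ?thesis by (simp add: coboundary_def)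
  qed
qed

end

subsection \<open>Dual cones and convenient points\<close>

text \<open>The Riesz identification of \<open>W\<close> with \<open>dual_space W\<close>, following
  its convention of extension by zero.\<close>

definition functional_on :: "'a::euclidean_space set \<Rightarrow> 'a \<Rightarrow> 'a \<Rightarrow> real" where
  "functional_on W w = (\<lambda>x. if x \<in> W then inner w x else 0)"

lemma linear_functional_on: "linear (functional_on W)"
  by (auto intro!: linearI simp: functional_on_def fun_eq_iff scaleR_fun_def inner_add_left)

lemma inj_on_functional_on:
  assumes "subspace W"
  shows "inj_on (functional_on W) W"
proof (rule inj_onI)
  fix w w' assume *: "w \<in> W" "w' \<in> W" "functional_on W w = functional_on W w'"
  have "w - w' \<in> W" using * assms by (simp add: subspace_diff)
  with fun_cong[OF *(3), of "w - w'"] have "inner (w - w') (w - w') = 0"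
    by (simp add: functional_on_def inner_diff_left)
  then show "w = w'" by simp
qed

lemma linear_inner_representation:
  fixes g :: "'a::euclidean_space \<Rightarrow> real"
  assumes "linear g" "subspace W"
  obtains w where "w \<in> W" "\<And>x. x \<in> W \<Longrightarrow> g x = inner w x"
proof -
  define a where "a = adjoint g 1"
  have a: "g x = inner a x" for x
    using adjoint_works[OF assms(1), of x 1] by (simp add: a_def inner_commute)
  obtain y z where yz: "y \<in> span W" "\<And>x. x \<in> span W \<Longrightarrow> real_inner_class.orthogonal z x" "a = y + z"
    using orthogonal_subspace_decomp_exists[of W a] by metis
  have W: "span W = W" using assms(2) by (simp add: span_eq_iff)
  show ?thesis
  proof (rule that[of y])
    show "y \<in> W" using yz(1) W by simp
    show "g x = inner y x" if "x \<in> W" for x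
      using yz(2)[of x] that W by (simp add: a yz(3) inner_add_left real_inner_class.orthogonal_def)
  qed
qed

lemma dual_space_eq:
  fixes W :: "'a::euclidean_space set"
  assumes "subspace W"
  shows "dual_space W = functional_on W ` W"
proof (rule subset_antisym)
  show "functional_on W ` W \<subseteq> dual_space W"
    using assms by (auto simp: dual_space_def functional_on_def inner_add_right subspace_add subspace_scale)
  show "dual_space W \<subseteq> functional_on W ` W"
  proof
    fix \<psi> assume \<psi>: "\<psi> \<in> dual_space W"
    obtain B where B: "B \<subseteq> W" "independent B" "W \<subseteq> span B" "card B = dim W"
      by (rule basis_exists)
    obtain g where g: "linear g" "\<forall>x\<in>B. g x = \<psi> x"
      using linear_independent_extend[OF B(2)] by blast
    have "x \<in> W \<and> g x = \<psi> x" if "x \<in> span B" for x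
      using that
    proof (induction rule: span_induct_alt)
      case base
      have "\<forall>c. \<forall>x\<in>W. \<psi> (c *\<^sub>R x) = c * \<psi> x" using \<psi> by (simp add: dual_space_def)
      then have "\<psi> (0 *\<^sub>R 0) = 0 * \<psi> 0" using subspace_0[OF assms] by blast
      then show ?case using assms by (simp add: subspace_0 linear_0[OF g(1)])
    next
      case (step c x y)
      then have x: "x \<in> W" "g x = \<psi> x" using B(1) g(2) by auto
      then have "c *\<^sub>R x \<in> W" using assms by (simp add: subspace_scale)
      then have "\<psi> (c *\<^sub>R x + y) = c * \<psi> x + \<psi> y" using \<psi> x step by (simp add: dual_space_def)
      then show ?case
        using \<open>c *\<^sub>R x \<in> W\<close> step x assms
        by (simp add: subspace_add linear_add[OF g(1)] linear_scale[OF g(1)])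
    qed
    then have gW: "g x = \<psi> x" if "x \<in> W" for x using that B(3) by blast
    obtain w where w: "w \<in> W" "\<And>x. x \<in> W \<Longrightarrow> g x = inner w x"
      using linear_inner_representation[OF g(1) assms] by blast
    have "\<psi> = functional_on W w"
    proof
      fix x show "\<psi> x = functional_on W w x"
        using \<psi> gW w(2) by (cases "x \<in> W") (auto simp: functional_on_def dual_space_def)
    qed
    with w show "\<psi> \<in> functional_on W ` W" by blast
  qed
qed

definition normal_cone :: "'a::euclidean_space set \<Rightarrow> 'a set \<Rightarrow> 'a set" where
  "normal_cone \<gamma> \<delta> = {w \<in> dir_space \<gamma>. \<delta> \<subseteq> argmax_on (inner w) \<gamma>}"

lemma dual_cone_eq:
  fixes \<gamma> :: "'a::euclidean_space set"
  assumes "\<delta> \<subseteq> \<gamma>"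
  shows "dual_cone \<gamma> \<delta> = functional_on (dir_space \<gamma>) ` normal_cone \<gamma> \<delta>"
proof -
  have "(\<forall>a\<in>\<gamma>. \<forall>x\<in>\<delta>. \<forall>y\<in>\<gamma>. functional_on (dir_space \<gamma>) w (y - a) \<le> functional_on (dir_space \<gamma>) w (x - a))
      \<longleftrightarrow> \<delta> \<subseteq> argmax_on (inner w) \<gamma>" for w
  proof -
    have "(functional_on (dir_space \<gamma>) w (y - a) \<le> functional_on (dir_space \<gamma>) w (x - a))
        \<longleftrightarrow> inner w y \<le> inner w x" if "a \<in> \<gamma>" "x \<in> \<delta>" "y \<in> \<gamma>" for a x y
      using that diff_in_dir_space[of y \<gamma> a] diff_in_dir_space[of x \<gamma> a] assms
      by (auto simp: functional_on_def inner_diff_right subset_iff)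
    then show ?thesis using assms unfolding argmax_on_def by blast
  qed
  then show ?thesis
    unfolding dual_cone_def normal_cone_def dual_space_eq[OF subspace_dir_space] by auto
qed

lemma dir_space_linear_image:
  assumes "linear f"
  shows "dir_space (f ` N) = f ` dir_space N"
proof -
  have "{x - y |x y. x \<in> f ` N \<and> y \<in> f ` N} = f ` {x - y |x y. x \<in> N \<and> y \<in> N}"
    (is "?l = ?r")
  proof (intro subset_antisym subsetI)
    fix z assume "z \<in> ?l"
    then obtain a b where "a \<in> N" "b \<in> N" "z = f (a - b)" by (auto simp: linear_diff[OF assms])
    then show "z \<in> ?r" by blast
  next
    fix z assume "z \<in> ?r"
    then obtain a b where "a \<in> N" "b \<in> N" "z = f a - f b" by (auto simp: linear_diff[OF assms])
    then show "z \<in> ?l" by blast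
  qed
  then show ?thesis by (simp add: dir_space_def linear_span_image[OF assms])
qed

lemma dir_space_translate: "dir_space ((+) t ` c) = dir_space c"
proof -
  have "{x - y |x y. x \<in> (+) t ` c \<and> y \<in> (+) t ` c} = {x - y |x y. x \<in> c \<and> y \<in> c}"
    by (auto simp: image_iff) (metis add_diff_cancel_left)+
  then show ?thesis by (simp add: dir_space_def)
qed

text \<open>The target is an arbitrary real vector space, since dual cones live in a space of all
  functions.\<close>

lemma dim_injective_image:
  fixes f :: "'a::euclidean_space \<Rightarrow> 'b::real_vector"
  assumes "linear f" "inj_on f S" "subspace S"
  shows "dim (f ` S) = dim S"
proof -
  obtain B where B: "B \<subseteq> S" "independent B" "S \<subseteq> span B" "card B = dim S" using basis_exists by blast
  have S: "span B = S" using B assms(3) by (simp add: span_minimal subset_antisym)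
  have "independent (f ` B)"
    using linear_independent_injective_image[OF assms(1) B(2)] assms(2) S by simp
  moreover have "span (f ` B) = span (f ` S)"
    using S by (metis assms(1) linear_span_image span_span)
  moreover have "card (f ` B) = card B" using B(1) assms(2) by (metis card_image inj_on_subset)
  ultimately show ?thesis using dim_eq_card B(4) by metis
qed

lemma normal_cone_dir_space:
  fixes \<gamma> :: "'a::euclidean_space set"
  shows "dir_space (normal_cone \<gamma> \<delta>) \<subseteq> {w \<in> dir_space \<gamma>. \<forall>x\<in>dir_space \<delta>. inner w x = 0}"
  unfolding dir_space_def[of "normal_cone \<gamma> \<delta>"]
proof (intro span_minimal subsetI)
  fix w assume "w \<in> {x - y |x y. x \<in> normal_cone \<gamma> \<delta> \<and> y \<in> normal_cone \<gamma> \<delta>}"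
  then obtain a b where ab: "w = a - b" "a \<in> normal_cone \<gamma> \<delta>" "b \<in> normal_cone \<gamma> \<delta>" by blast
  have "inner c x = 0" if "c \<in> normal_cone \<gamma> \<delta>" "x \<in> dir_space \<delta>" for c x
  proof -
    have "linear (inner c)" by (auto intro!: linearI simp: inner_add_right)
    then show ?thesis
      using that argmax_on_zero_dir_space[of "inner c" \<delta> \<gamma> x] by (simp add: normal_cone_def)
  qed
  then show "w \<in> {w \<in> dir_space \<gamma>. \<forall>x\<in>dir_space \<delta>. inner w x = 0}"
    using ab by (auto simp: inner_diff_left normal_cone_def intro: subspace_diff)
next
  show "subspace {w \<in> dir_space \<gamma>. \<forall>x\<in>dir_space \<delta>. inner w x = 0}"
    by (auto simp: subspace_def inner_add_left intro: subspace_add[OF subspace_dir_space]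
        subspace_scale[OF subspace_dir_space] subspace_0[OF subspace_dir_space])
qed

text \<open>The cone lies in the annihilator of \<open>dir_space \<delta>\<close>. An upper bound
  suffices, because membership in a skeleton asks for nothing else.\<close>

lemma normal_cone_dim:
  fixes \<gamma> :: "'a::euclidean_space set"
  assumes "\<delta> \<subseteq> \<gamma>"
  shows "dim (dir_space (normal_cone \<gamma> \<delta>)) + dim (dir_space \<delta>) \<le> dim (dir_space \<gamma>)"
proof -
  have "dim (dir_space (normal_cone \<gamma> \<delta>)) \<le> dim {w \<in> dir_space \<gamma>. \<forall>x\<in>dir_space \<delta>. real_inner_class.orthogonal x w}"
    by (rule dim_subset) (use normal_cone_dir_space[of \<gamma> \<delta>] in \<open>auto simp: real_inner_class.orthogonal_def inner_commute\<close>)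
  then show ?thesis
    using dim_subspace_orthogonal_to_vectors[OF subspace_dir_space subspace_dir_space dir_space_mono[OF assms]]
    by simp
qed

definition represents :: "'a::euclidean_space set \<Rightarrow> 'a \<Rightarrow> ('a \<Rightarrow>\<^sub>L real) \<Rightarrow> bool" where
  "represents \<gamma> a v \<longleftrightarrow> a \<in> dir_space \<gamma> \<and> (\<forall>x\<in>dir_space \<gamma>. blinfun_apply v x = inner a x)"

lemma represents_exists:
  obtains a where "represents \<gamma> a v"
proof -
  have "linear (blinfun_apply v)" by (rule bounded_linear.linear[OF blinfun.bounded_linear_right])
  then obtain a where "a \<in> dir_space \<gamma>" "\<And>x. x \<in> dir_space \<gamma> \<Longrightarrow> blinfun_apply v x = inner a x"
    using linear_inner_representation[OF _ subspace_dir_space] by blast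
  then show ?thesis by (intro that[of a]) (auto simp: represents_def)
qed

lemma represents_restr: "represents \<gamma> a v \<Longrightarrow> restr \<gamma> v = functional_on (dir_space \<gamma>) a"
  by (auto simp: represents_def restr_def functional_on_def)

text \<open>The \<open>w\<close> on the right is the common point of the two cones; the translate
  contains it exactly when \<open>w - a\<close> lies in the cone of \<delta>.\<close>

lemma dual_cones_meet_iff:
  assumes "represents \<gamma> a v" "\<delta> \<subseteq> \<gamma>" "l \<subseteq> \<gamma>"
  shows "(+) (restr \<gamma> v) ` dual_cone \<gamma> \<delta> \<inter> dual_cone \<gamma> l \<noteq> {} \<longleftrightarrow>
    (\<exists>w\<in>dir_space \<gamma>. \<delta> \<subseteq> argmax_on (inner (w - a)) \<gamma> \<and> l \<subseteq> argmax_on (inner w) \<gamma>)"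
    (is "?l \<longleftrightarrow> ?r")
proof -
  let ?W = "dir_space \<gamma>"
  let ?J = "functional_on ?W"
  have a: "a \<in> ?W" using assms(1) by (simp add: represents_def)
  have add: "?J a + ?J w = ?J (a + w)" for w by (simp add: linear_add[OF linear_functional_on])
  have "?l \<longleftrightarrow> (\<exists>w1\<in>normal_cone \<gamma> \<delta>. \<exists>w\<in>normal_cone \<gamma> l. ?J (a + w1) = ?J w)"
    unfolding represents_restr[OF assms(1)] dual_cone_eq[OF assms(2)] dual_cone_eq[OF assms(3)]
    by (auto simp: image_iff add[symmetric])
  also have "\<dots> \<longleftrightarrow> (\<exists>w1\<in>normal_cone \<gamma> \<delta>. \<exists>w\<in>normal_cone \<gamma> l. a + w1 = w)"
  proof -
    have "?J (a + w1) = ?J w \<longleftrightarrow> a + w1 = w"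
      if "w1 \<in> normal_cone \<gamma> \<delta>" "w \<in> normal_cone \<gamma> l" for w1 w
      using that a
      by (intro inj_on_eq_iff[OF inj_on_functional_on[OF subspace_dir_space]])
        (auto simp: normal_cone_def subspace_add)
    then show ?thesis by blast
  qed
  also have "\<dots> \<longleftrightarrow> ?r"
  proof
    assume "\<exists>w1\<in>normal_cone \<gamma> \<delta>. \<exists>w\<in>normal_cone \<gamma> l. a + w1 = w"
    then obtain w1 where "w1 \<in> normal_cone \<gamma> \<delta>" "a + w1 \<in> normal_cone \<gamma> l" by blast
    then show ?r by (intro bexI[of _ "a + w1"]) (auto simp: normal_cone_def)
  next
    assume ?r
    then obtain w where "w \<in> ?W" "\<delta> \<subseteq> argmax_on (inner (w - a)) \<gamma>" "l \<subseteq> argmax_on (inner w) \<gamma>" by blast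
    then have "w - a \<in> normal_cone \<gamma> \<delta>" "w \<in> normal_cone \<gamma> l" "a + (w - a) = w"
      using a by (auto simp: normal_cone_def subspace_diff)
    then show "\<exists>w1\<in>normal_cone \<gamma> \<delta>. \<exists>w\<in>normal_cone \<gamma> l. a + w1 = w" by blast
  qed
  finally show ?thesis .
qed

text \<open>Transversality expressed by faces instead of cones: spans of two cones fill
  \<open>dir_space \<gamma>\<close> only if the direction spaces of the faces, being orthogonal to
  them, meet trivially.\<close>

definition convenient_vector :: "'a::euclidean_space set \<Rightarrow> 'a \<Rightarrow> bool" where
  "convenient_vector \<gamma> a \<longleftrightarrow> (\<forall>\<delta>\<in>faces \<gamma>. \<forall>l\<in>faces \<gamma>. \<forall>w\<in>dir_space \<gamma>.
     dim (dir_space \<gamma>) \<le> dim (dir_space \<delta>) + dim (dir_space l) \<longrightarrow>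
     \<delta> \<subseteq> argmax_on (inner (w - a)) \<gamma> \<longrightarrow> l \<subseteq> argmax_on (inner w) \<gamma> \<longrightarrow>
     dir_space \<delta> \<inter> dir_space l = {0})"

lemma faces_subset: "f \<in> faces c \<Longrightarrow> f \<subseteq> c"
  by (simp add: faces_def face_of_imp_subset)

text \<open>The codimension equation gives \<open>dim (A + B) = dim ?W\<close>, so the spans
  \<open>A\<close> and \<open>B\<close> of the two cones together fill \<open>?W\<close>; a common
  direction of \<delta> and l is orthogonal to both and hence zero.\<close>

lemma convenient_vectorI:
  fixes X :: "'a::euclidean_space set set"
  assumes "v \<in> convenient X" "\<gamma> \<in> X" "\<gamma> \<noteq> {}" "represents \<gamma> a v"
  shows "convenient_vector \<gamma> a"
  unfolding convenient_vector_def
proof (intro ballI impI)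
  fix \<delta> l w
  assume \<delta>: "\<delta> \<in> faces \<gamma>" and l: "l \<in> faces \<gamma>" and w: "w \<in> dir_space \<gamma>"
    "\<delta> \<subseteq> argmax_on (inner (w - a)) \<gamma>" "l \<subseteq> argmax_on (inner w) \<gamma>"
    and dims: "dim (dir_space \<gamma>) \<le> dim (dir_space \<delta>) + dim (dir_space l)"
  let ?W = "dir_space \<gamma>"
  let ?J = "functional_on ?W"
  define A where "A = dir_space (normal_cone \<gamma> \<delta>)"
  define B where "B = dir_space (normal_cone \<gamma> l)"
  note sub = faces_subset[OF \<delta>] faces_subset[OF l]
  note inj = inj_on_functional_on[OF subspace_dir_space, of \<gamma>]
  \<comment> \<open>Convenience holds for all pairs of degrees, so they may be adapted to \<delta>:
    its cone has dimension at most \<open>q\<close>, and the assumed dimension inequality puts the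
    cone of l into the p-skeleton.\<close>
  define p where "p = dim (dir_space \<delta>)"
  define q where "q = dim ?W - p"
  have p: "p \<le> dim ?W" unfolding p_def by (rule dim_subset[OF dir_space_mono[OF sub(1)]])
  then have pq: "aff_dim \<gamma> = int (p + q)" using assms(3) by (simp add: q_def aff_dim_dir_space)
  have AW: "A \<subseteq> ?W" "B \<subseteq> ?W" and sAB: "subspace A" "subspace B"
    using normal_cone_dir_space[of \<gamma>] unfolding A_def B_def by (auto; blast)+
  have dA: "dim A + p \<le> dim ?W" "dim B + dim (dir_space l) \<le> dim ?W"
    using normal_cone_dim[OF sub(1)] normal_cone_dim[OF sub(2)] by (simp_all add: A_def B_def p_def)
  have dJ: "dim (?J ` U) = dim U" if "subspace U" "U \<subseteq> ?W" for U
    using dim_injective_image[OF linear_functional_on inj_on_subset[OF inj that(2)] that(1)] .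
  have dir: "dir_space (dual_cone \<gamma> \<delta>) = ?J ` A" "dir_space (dual_cone \<gamma> l) = ?J ` B"
    unfolding dual_cone_eq[OF sub(1)] dual_cone_eq[OF sub(2)] A_def B_def
    by (simp_all add: dir_space_linear_image[OF linear_functional_on])
  have "dual_cone \<gamma> \<delta> \<in> skeleton q (dual_fan \<gamma>)"
    using \<delta> dA(1) by (auto simp: skeleton_def dual_fan_def dir dJ[OF sAB(1) AW(1)] q_def)
  moreover have "dual_cone \<gamma> l \<in> skeleton p (dual_fan \<gamma>)"
    using l dA(2) dims by (auto simp: skeleton_def dual_fan_def dir dJ[OF sAB(2) AW(2)] p_def)
  moreover have "transversal_in (dual_space ?W)
      (translate_complex (restr \<gamma> v) (skeleton q (dual_fan \<gamma>))) (skeleton p (dual_fan \<gamma>))"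
    using assms(1,2) pq by (auto simp: convenient_def convenient_pq_def)
  moreover have "(+) (restr \<gamma> v) ` dual_cone \<gamma> \<delta> \<inter> dual_cone \<gamma> l \<noteq> {}"
    using dual_cones_meet_iff[OF assms(4) sub] w by blast
  ultimately have "codim_in (dual_space ?W) (?J ` A \<inter> ?J ` B) =
      codim_in (dual_space ?W) (?J ` A) + codim_in (dual_space ?W) (?J ` B)"
    unfolding transversal_in_def translate_complex_def dir[symmetric]
    using dir_space_translate[of "restr \<gamma> v" "dual_cone \<gamma> \<delta>"] by (metis imageI)
  moreover have "?J ` A \<inter> ?J ` B = ?J ` (A \<inter> B)"
    by (rule inj_on_image_Int[OF inj AW, symmetric])
  moreover have "dim (?J ` (A \<inter> B)) = dim (A \<inter> B)"
    using AW sAB by (intro dJ) (auto intro: subspace_inter)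
  moreover have "dim (dual_space ?W) = dim ?W"
    unfolding dual_space_eq[OF subspace_dir_space] by (rule dJ) auto
  ultimately have "dim A + dim B = dim ?W + dim (A \<inter> B)"
    by (simp add: codim_in_def dJ[OF sAB(1) AW(1)] dJ[OF sAB(2) AW(2)])
  then have dsum: "dim {x + y |x y. x \<in> A \<and> y \<in> B} = dim ?W"
    using dim_sums_Int[OF sAB] by simp
  have "{x + y |x y. x \<in> A \<and> y \<in> B} = ?W"
    using AW dsum subspace_sums[OF sAB]
    by (intro subspace_dim_equal) (auto intro: subspace_add[OF subspace_dir_space])
  moreover have "inner x e = 0" if "e \<in> dir_space \<delta> \<inter> dir_space l" "x \<in> {x + y |x y. x \<in> A \<and> y \<in> B}" for x e
  proof -
    obtain y z where "x = y + z" "y \<in> A" "z \<in> B" using \<open>x \<in> {x + y |x y. x \<in> A \<and> y \<in> B}\<close> by blast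
    then show ?thesis
      using that(1) normal_cone_dir_space[of \<gamma> \<delta>] normal_cone_dir_space[of \<gamma> l]
      by (auto simp: A_def B_def inner_add_left subset_iff)
  qed
  moreover have "dir_space \<delta> \<subseteq> ?W" by (rule dir_space_mono[OF sub(1)])
  ultimately have "e = 0" if "e \<in> dir_space \<delta> \<inter> dir_space l" for e
    using that by (metis IntD1 inner_eq_zero_iff subsetD)
  then show "dir_space \<delta> \<inter> dir_space l = {0}"
    using subspace_0[OF subspace_dir_space, of \<delta>] subspace_0[OF subspace_dir_space, of l] by blast
qed

subsection \<open>The product as a sum over faces of the square of a cell\<close>

text \<open>Contains the products of faces of all bidegrees with total degree the dimension of
  \<open>\<gamma>\<close>; \<open>product_cochain\<close> selects the bidegree (p, q)
  afterwards.\<close>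

definition cell_pairs :: "'a::euclidean_space set \<Rightarrow> 'a \<Rightarrow> ('a \<times> 'a) set set" where
  "cell_pairs \<gamma> a = {F. F face_of \<gamma> \<times> \<gamma> \<and> aff_dim F = aff_dim \<gamma> \<and>
     (\<exists>w\<in>dir_space \<gamma>. F \<subseteq> argmax_on (\<lambda>z. inner w (fst z + snd z) - inner a (fst z)) (\<gamma> \<times> \<gamma>))}"

lemma argmax_on_Times:
  "argmax_on (\<lambda>z. f (fst z) + g (snd z)) (c \<times> d) = argmax_on f c \<times> argmax_on g d"
proof (intro subset_antisym subsetI)
  fix z assume "z \<in> argmax_on (\<lambda>z. f (fst z) + g (snd z)) (c \<times> d)"
  then have z: "fst z \<in> c" "snd z \<in> d"
    "\<And>x y. x \<in> c \<Longrightarrow> y \<in> d \<Longrightarrow> f x + g y \<le> f (fst z) + g (snd z)"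
    by (auto simp: argmax_on_def)
  have "f x \<le> f (fst z)" if "x \<in> c" for x using z(3)[OF that z(2)] by simp
  moreover have "g y \<le> g (snd z)" if "y \<in> d" for y using z(3)[OF z(1) that] by simp
  ultimately show "z \<in> argmax_on f c \<times> argmax_on g d"
    using z(1,2) by (auto simp: argmax_on_def mem_Times_iff)
qed (auto simp: argmax_on_def intro: add_mono)

text \<open>The functional separates as \<open>w - a\<close> on the first factor plus
  \<open>w\<close> on the second, which are the two conditions of
  \<open>dual_cones_meet_iff\<close>.\<close>

lemma argmax_on_pair:
  fixes \<gamma> :: "'a::euclidean_space set"
  shows "argmax_on (\<lambda>z. inner w (fst z + snd z) - inner a (fst z)) (\<gamma> \<times> \<gamma>) =
    argmax_on (inner (w - a)) \<gamma> \<times> argmax_on (inner w) \<gamma>"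
proof -
  have "(\<lambda>z. inner w (fst z + snd z) - inner a (fst z)) =
      (\<lambda>z. inner (w - a) (fst z) + inner w (snd z))"
    by (auto simp: inner_add_right inner_diff_left)
  then show ?thesis by (simp add: argmax_on_Times)
qed

context cochain_pair
begin

definition pair_term :: "'a set \<Rightarrow> 'a orientation \<Rightarrow> ('a \<times> 'a) set \<Rightarrow> 's" where
  "pair_term \<gamma> \<omega> F =
     product_cochain (F, pull_orientation \<omega> (\<lambda>z. fst z + snd z) (dir_space F))"

text \<open>Reindexing by (\<delta>, l) -> \<delta> \<times> l; the faces of other bidegrees
  contribute zero.\<close>

lemma cup_eq:
  assumes "\<gamma> \<in> X" "aff_dim \<gamma> = int (p + q)" "represents \<gamma> a v"
  shows "cup p q v rp rq (\<gamma>, \<omega>) = (\<Sum>F\<in>cell_pairs \<gamma> a. pair_term \<gamma> \<omega> F)"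
proof -
  have mem: "(\<delta>, l) \<in> cup_pairs p q \<gamma> v \<longleftrightarrow> \<delta> \<times> l \<in> cell_pairs \<gamma> a \<and> aff_dim \<delta> = int p \<and> aff_dim l = int q"
    if ne: "\<delta> \<noteq> {}" "l \<noteq> {}" for \<delta> l
  proof -
    have "\<delta> \<times> l \<in> cell_pairs \<gamma> a \<longleftrightarrow> \<delta> face_of \<gamma> \<and> l face_of \<gamma> \<and> aff_dim \<delta> + aff_dim l = aff_dim \<gamma> \<and>
      (\<exists>w\<in>dir_space \<gamma>. \<delta> \<subseteq> argmax_on (inner (w - a)) \<gamma> \<and> l \<subseteq> argmax_on (inner w) \<gamma>)"
      using ne by (auto simp: cell_pairs_def argmax_on_pair face_of_Times_eq aff_dim_Times times_subset_iff)
    moreover have "(\<delta>, l) \<in> cup_pairs p q \<gamma> v \<longleftrightarrow> \<delta> face_of \<gamma> \<and> l face_of \<gamma> \<and>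
      aff_dim \<delta> = int p \<and> aff_dim l = int q \<and>
      (\<exists>w\<in>dir_space \<gamma>. \<delta> \<subseteq> argmax_on (inner (w - a)) \<gamma> \<and> l \<subseteq> argmax_on (inner w) \<gamma>)"
      using ne dual_cones_meet_iff[OF assms(3), of \<delta> l]
      by (auto simp: cup_pairs_def faces_def dest: face_of_imp_subset)
    ultimately show ?thesis using assms(2) by auto
  qed
  have ne: "\<delta> \<noteq> {} \<and> l \<noteq> {}" if "(\<delta>, l) \<in> cup_pairs p q \<gamma> v" for \<delta> l
    using that by (auto simp: cup_pairs_def faces_def)
  let ?f = "\<lambda>(\<delta>, l). \<delta> \<times> l"
  have inj: "inj_on ?f (cup_pairs p q \<gamma> v)"
    using ne by (auto simp: inj_on_def times_eq_iff)
  have val: "(let (\<omega>\<delta>, \<omega>l) = (SOME (\<alpha>, \<beta>).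
           is_orientation (dir_space \<delta>) \<alpha> \<and> is_orientation (dir_space l) \<beta> \<and>
           oriented_direct_sum (dir_space \<delta>) \<alpha> (dir_space l) \<beta> \<omega>)
     in rp (\<delta>, \<omega>\<delta>) * rq (l, \<omega>l)) = pair_term \<gamma> \<omega> (\<delta> \<times> l)"
    if dl: "(\<delta>, l) \<in> cup_pairs p q \<gamma> v" for \<delta> l
  proof -
    note n = ne[OF dl]
    have pb: "map (\<lambda>z. fst z + snd z) (product_basis bs cs) = bs @ cs" for bs cs :: "'a list"
      by (simp add: product_basis_def comp_def)
    \<comment> \<open>The sum map sends a product basis to the concatenated basis. The two
      predicates therefore coincide, and \<open>SOME\<close> picks the same pair on both
      sides.\<close>
    have "splits (dir_space \<delta>) \<alpha> (dir_space l) \<beta>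
        (pull_orientation \<omega> (\<lambda>z. fst z + snd z) (dir_space (\<delta> \<times> l))) \<longleftrightarrow>
       is_orientation (dir_space \<delta>) \<alpha> \<and> is_orientation (dir_space l) \<beta> \<and>
       oriented_direct_sum (dir_space \<delta>) \<alpha> (dir_space l) \<beta> \<omega>" for \<alpha> \<beta>
      using n by (auto simp: splits_def oriented_direct_sum_def pull_orientation_def dir_space_Times
          ordered_bases_product pb)
    then show ?thesis
      using dl n by (simp add: pair_term_def product_cochain_def cup_pairs_def)
  qed
  have fin: "finite (cell_pairs \<gamma> a)"
    using finite_polytope_faces[OF polytope_Times[OF polytope_cell[OF assms(1)] polytope_cell[OF assms(1)]]]
    by (auto simp: cell_pairs_def intro: finite_subset[rotated])
  have "cup p q v rp rq (\<gamma>, \<omega>) = (\<Sum>(\<delta>, l)\<in>cup_pairs p q \<gamma> v. pair_term \<gamma> \<omega> (\<delta> \<times> l))"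
    unfolding cup_def prod.case by (rule sum.cong) (use val in auto)
  also have "\<dots> = (\<Sum>F\<in>?f ` cup_pairs p q \<gamma> v. pair_term \<gamma> \<omega> F)"
    by (subst sum.reindex[OF inj]) (simp add: case_prod_unfold)
  also have "\<dots> = (\<Sum>F\<in>cell_pairs \<gamma> a. pair_term \<gamma> \<omega> F)"
  proof (rule sum.mono_neutral_left[OF fin])
    show "?f ` cup_pairs p q \<gamma> v \<subseteq> cell_pairs \<gamma> a"
    proof (clarify, simp)
      fix \<delta> l assume "(\<delta>, l) \<in> cup_pairs p q \<gamma> v"
      then show "\<delta> \<times> l \<in> cell_pairs \<gamma> a" using mem[of \<delta> l] ne[of \<delta> l] by blast
    qed
    show "\<forall>F\<in>cell_pairs \<gamma> a - ?f ` cup_pairs p q \<gamma> v. pair_term \<gamma> \<omega> F = 0"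
    proof
      fix F assume F: "F \<in> cell_pairs \<gamma> a - ?f ` cup_pairs p q \<gamma> v"
      then have "F face_of \<gamma> \<times> \<gamma>" "F \<noteq> {}" using assms(2) by (auto simp: cell_pairs_def)
      then obtain \<delta> l where \<delta>: "F = \<delta> \<times> l" "\<delta> \<noteq> {}" "l \<noteq> {}" using face_of_Times_cases by metis
      have "\<not> (aff_dim \<delta> = int p \<and> aff_dim l = int q)" using F mem[OF \<delta>(2,3)] \<delta>(1) by auto
      then show "pair_term \<gamma> \<omega> F = 0"
        using product_cochain_other[OF \<delta>(2,3)] by (simp add: pair_term_def \<delta>(1))
    qed
  qed
  finally show ?thesis .
qed

text \<open>The vector \<open>e\<close> is orthogonal to \<open>a\<close> when there is room for it, so that \<open>inner (a + t *\<^sub>R (m - a)) e\<close>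
  is \<open>t * inner m e\<close> and the path from \<open>a\<close> to \<open>m\<close> meets no wall of codimension two or more.\<close>

definition generic_for :: "'a set \<Rightarrow> 'a \<Rightarrow> 'a \<Rightarrow> bool" where
  "generic_for \<gamma> a m \<longleftrightarrow> (\<forall>\<delta>\<in>faces \<gamma>. \<forall>l\<in>faces \<gamma>. dir_space \<delta> \<inter> dir_space l \<noteq> {0} \<longrightarrow>
     (\<exists>e\<in>dir_space \<delta> \<inter> dir_space l. inner m e \<noteq> 0 \<and>
        (2 \<le> dim (dir_space \<delta> \<inter> dir_space l) \<longrightarrow> inner a e = 0)))"

text \<open>Concerns the special triples whose large cell is \<open>\<gamma>\<close> itself: no
  point of the segment annihilates their common line.\<close>

definition avoids_discriminant :: "'a set \<Rightarrow> 'a \<Rightarrow> 'a \<Rightarrow> bool" where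
  "avoids_discriminant \<gamma> a m \<longleftrightarrow> (\<forall>\<delta>\<in>faces \<gamma>. \<forall>l\<in>faces \<gamma>. \<forall>g. \<forall>t\<in>{0..1}.
     g facet_of \<gamma> \<longrightarrow> \<delta> \<union> l \<subseteq> g \<longrightarrow> aff_dim \<delta> + aff_dim l = aff_dim \<gamma> \<longrightarrow>
     dim (dir_space \<delta> \<inter> dir_space l) = 1 \<longrightarrow>
     (\<exists>e\<in>dir_space \<delta> \<inter> dir_space l. inner (a + t *\<^sub>R (m - a)) e \<noteq> 0))"

text \<open>An instance of \<open>sweep\<close> on the square of \<open>\<gamma>\<close>:
  \<open>\<phi>\<close> and \<open>\<eta>\<close> are \<open>a\<close> and \<open>m - a\<close> on
  the first factor, so time 0 selects the pairs of \<open>a\<close> and time 1 those of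
  \<open>m\<close>.\<close>

lemma cup_sum_path:
  assumes \<gamma>: "\<gamma> \<in> X" "aff_dim \<gamma> = int (p + q)" and \<omega>: "is_orientation (dir_space \<gamma>) \<omega>"
    and conv: "convenient_vector \<gamma> a" and gen: "generic_for \<gamma> a m"
    and disc: "avoids_discriminant \<gamma> a m"
  shows "(\<Sum>F\<in>cell_pairs \<gamma> a. pair_term \<gamma> \<omega> F) = (\<Sum>F\<in>cell_pairs \<gamma> m. pair_term \<gamma> \<omega> F)"
proof -
  let ?W = "dir_space \<gamma>" and ?\<pi> = "\<lambda>z::'a \<times> 'a. fst z + snd z"
  let ?\<phi> = "\<lambda>z::'a \<times> 'a. inner a (fst z)" and ?\<eta> = "\<lambda>z::'a \<times> 'a. inner (m - a) (fst z)"
  have ne: "\<gamma> \<noteq> {}" using \<gamma>(2) by auto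
  note poly = polytope_cell[OF \<gamma>(1)]
  have dimW: "dim ?W = p + q" using aff_dim_dir_space[OF ne] \<gamma>(2) by simp
  have conv_face: "argmax_on (inner b) \<gamma> \<in> faces \<gamma>" for b
  proof -
    have "linear (inner b)" by (auto intro!: linearI simp: inner_add_right)
    then show ?thesis
      using argmax_on_face_of[OF _ polytope_imp_convex[OF poly]]
        argmax_on_nonempty[OF _ polytope_imp_compact[OF poly] ne] by (simp add: faces_def)
  qed
  have am: "argmax_on (\<lambda>z. inner w (?\<pi> z) - ?\<phi> z - t * ?\<eta> z) (\<gamma> \<times> \<gamma>) =
      argmax_on (inner (w - (a + t *\<^sub>R (m - a)))) \<gamma> \<times> argmax_on (inner w) \<gamma>" for w t
  proof -
    have "(\<lambda>z. inner w (?\<pi> z) - ?\<phi> z - t * ?\<eta> z) =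
        (\<lambda>z. inner w (?\<pi> z) - inner (a + t *\<^sub>R (m - a)) (fst z))"
      by (auto simp: inner_add_left)
    then show ?thesis by (simp only: argmax_on_pair)
  qed
  \<comment> \<open>Along common directions both \<open>w\<close> and
    \<open>w - (a + t (m - a))\<close> vanish, hence so does their difference: a pair with a common
    direction occurs only on its wall.\<close>
  have vanish: "inner (a + t *\<^sub>R (m - a)) e = 0"
    if "\<delta> \<subseteq> argmax_on (inner (w - (a + t *\<^sub>R (m - a)))) \<gamma>" "l \<subseteq> argmax_on (inner w) \<gamma>"
      "e \<in> dir_space \<delta> \<inter> dir_space l" for t w \<delta> l e
  proof -
    have lin: "linear (inner b)" for b :: 'a by (auto intro!: linearI simp: inner_add_right)
    have "inner (w - (a + t *\<^sub>R (m - a))) e = 0" "inner w e = 0"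
      using argmax_on_zero_dir_space[OF lin that(1)] argmax_on_zero_dir_space[OF lin that(2)] that(3)
      by auto
    then show ?thesis by (simp add: inner_diff_left)
  qed
  \<comment> \<open>A common plane contains some \<open>e\<close> orthogonal to \<open>a\<close> but
    not to \<open>m\<close>, so \<open>vanish\<close> reads \<open>t * inner m e = 0\<close>. This
    forces \<open>t = 0\<close>, where convenience of \<open>a\<close> applies.\<close>
  have line: "dim (dir_space \<delta> \<inter> dir_space l) \<le> 1"
    if t: "0 \<le> t" "t \<le> 1" and w: "w \<in> ?W" and f: "\<delta> \<in> faces \<gamma>" "l \<in> faces \<gamma>"
      and sub: "\<delta> \<subseteq> argmax_on (inner (w - (a + t *\<^sub>R (m - a)))) \<gamma>" "l \<subseteq> argmax_on (inner w) \<gamma>"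
      and d: "dim ?W \<le> dim (dir_space \<delta>) + dim (dir_space l)" for t w \<delta> l
  proof (rule ccontr)
    assume n: "\<not> ?thesis"
    then have 2: "2 \<le> dim (dir_space \<delta> \<inter> dir_space l)" by linarith
    have "dim {0 :: 'a} = 0" by simp
    then have "dir_space \<delta> \<inter> dir_space l \<noteq> {0}" using 2 by (metis not_numeral_le_zero)
    from gen[unfolded generic_for_def, rule_format, OF f this]
    obtain e where e: "e \<in> dir_space \<delta> \<inter> dir_space l" "inner m e \<noteq> 0" "inner a e = 0"
      using 2 by metis
    have "t * inner m e = 0"
      using vanish[OF sub e(1)] e(3) by (simp add: inner_add_left inner_diff_left)
    then have "t = 0" using e(2) by simp
    with sub(1) have "\<delta> \<subseteq> argmax_on (inner (w - a)) \<gamma>" by simp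
    from conv[unfolded convenient_vector_def, rule_format, OF f w d this sub(2)]
    have "e = 0" using e(1) by simp
    then show False using e(2) by simp
  qed
  \<comment> \<open>At \<open>t = 0\<close> by convenience, at \<open>t = 1\<close> by genericity of
    \<open>m\<close>. Otherwise \<open>x\<close> spans the common line by \<open>line\<close>; from
    \<open>inner (m - a) x = 0\<close> and \<open>vanish\<close> both \<open>a\<close> and
    \<open>m\<close> annihilate it, against genericity.\<close>
  have trans_pair: "x = 0"
    if t: "0 \<le> t" "t \<le> 1" and w: "w \<in> ?W" and f: "\<delta> \<in> faces \<gamma>" "l \<in> faces \<gamma>"
      and sub: "\<delta> \<subseteq> argmax_on (inner (w - (a + t *\<^sub>R (m - a)))) \<gamma>" "l \<subseteq> argmax_on (inner w) \<gamma>"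
      and d: "dim ?W \<le> dim (dir_space \<delta>) + dim (dir_space l)"
      and x: "x \<in> dir_space \<delta> \<inter> dir_space l" and cond: "t = 0 \<or> t = 1 \<or> inner (m - a) x = 0" for t w \<delta> l x
  proof (rule ccontr)
    assume nz: "x \<noteq> 0"
    let ?U = "dir_space \<delta> \<inter> dir_space l"
    have U: "?U \<noteq> {0}" using x nz by (metis singletonD)
    from gen[unfolded generic_for_def, rule_format, OF f this]
    obtain e where e: "e \<in> ?U" "inner m e \<noteq> 0" by metis
    show False
    proof (cases "t = 0")
      case True
      with sub(1) have "\<delta> \<subseteq> argmax_on (inner (w - a)) \<gamma>" by simp
      from conv[unfolded convenient_vector_def, rule_format, OF f w d this sub(2)]
      show False using U by simp
    next
      case False
      then consider "t = 1" | "inner (m - a) x = 0" using cond by blast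
      then show False
      proof cases
        case 1
        then show False using vanish[OF sub e(1)] e(2) by simp
      next
        case 2
        have sU: "subspace ?U" by (simp add: subspace_inter)
        have "dim ?U \<le> 1" by (rule line[OF t w f sub d])
        then have "dim ?U = dim {x}"
          using dim_subset[of "{x}" ?U] x nz by (simp add: dim_singleton)
        then have "span {x} = span ?U" using x by (intro dim_eq_span) auto
        then have "e \<in> span {x}" using e(1) by (simp add: span_base)
        then obtain k where k: "e = k *\<^sub>R x" by (auto simp: span_singleton)
        have "inner a x = 0" using vanish[OF sub x] 2 by (simp add: inner_add_left)
        then have "inner m x = 0" using 2 by (simp add: inner_diff_left)
        then show False using e(2) k by simp
      qed
    qed
  qed
  \<comment> \<open>The kernel of the sum map consists of the vectors (x, -x), so on \<delta>
    \<times> l it is a copy of the common directions.\<close>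
  have trans_main: "z = 0"
    if "0 \<le> t" "t \<le> 1" "w \<in> ?W"
      and d: "dim ?W \<le> dim (dir_space (argmax_on (\<lambda>z. inner w (?\<pi> z) - ?\<phi> z - t * ?\<eta> z) (\<gamma> \<times> \<gamma>)))"
      and z: "z \<in> dir_space (argmax_on (\<lambda>z. inner w (?\<pi> z) - ?\<phi> z - t * ?\<eta> z) (\<gamma> \<times> \<gamma>))"
      and cond: "t = 0 \<or> t = 1 \<or> ?\<eta> z = 0" and \<pi>z: "?\<pi> z = 0" for t w z
  proof -
    let ?\<delta> = "argmax_on (inner (w - (a + t *\<^sub>R (m - a)))) \<gamma>" and ?l = "argmax_on (inner w) \<gamma>"
    have f: "?\<delta> \<in> faces \<gamma>" "?l \<in> faces \<gamma>" by (rule conv_face)+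
    then have n: "?\<delta> \<noteq> {}" "?l \<noteq> {}" by (auto simp: faces_def)
    obtain x y where xy: "z = (x, y)" by (cases z)
    have m: "x \<in> dir_space ?\<delta>" "y \<in> dir_space ?l"
      using z unfolding am dir_space_Times[OF n] xy by auto
    have "y = - x" using \<pi>z xy by (simp add: eq_neg_iff_add_eq_0 add.commute)
    then have "x \<in> dir_space ?\<delta> \<inter> dir_space ?l"
      using m subspace_neg[OF subspace_dir_space, of y ?l] by simp
    moreover have "dim ?W \<le> dim (dir_space ?\<delta>) + dim (dir_space ?l)"
      using d unfolding am dir_space_Times[OF n] by (simp add: dim_Times)
    ultimately have "x = 0"
      using trans_pair[OF that(1-3) f order_refl order_refl] cond xy by simp
    then show "z = 0" using xy \<open>y = - x\<close> by (simp add: zero_prod_def)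
  qed
  \<comment> \<open>A non-zero \<open>w'\<close> puts \<delta> and l into a proper face, hence into
    a facet. The sum of their direction spaces is then too small, so they share a line: a special
    triple whose wall contains the current point of the path.\<close>
  have ray: "w' = 0"
    if F: "F face_of \<gamma> \<times> \<gamma>" "aff_dim F = int (dim ?W)" and t: "0 \<le> t" "t \<le> 1" and w: "w \<in> ?W"
      and sub: "F \<subseteq> argmax_on (\<lambda>z. inner w (?\<pi> z) - ?\<phi> z - t * ?\<eta> z) (\<gamma> \<times> \<gamma>)"
      and w': "w' \<in> ?W" "F \<subseteq> argmax_on (\<lambda>z. inner w' (?\<pi> z)) (\<gamma> \<times> \<gamma>)" for F t w w'
  proof (rule ccontr)
    assume nz: "w' \<noteq> 0"
    have "F \<noteq> {}" using F(2) by auto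
    then obtain \<delta> l where \<delta>: "F = \<delta> \<times> l" "\<delta> face_of \<gamma>" "l face_of \<gamma>" "\<delta> \<noteq> {}" "l \<noteq> {}"
      using face_of_Times_cases[OF F(1)] by metis
    let ?U = "dir_space \<delta> \<inter> dir_space l"
    have f: "\<delta> \<in> faces \<gamma>" "l \<in> faces \<gamma>" using \<delta> by (auto simp: faces_def)
    have s: "\<delta> \<subseteq> argmax_on (inner (w - (a + t *\<^sub>R (m - a)))) \<gamma>" "l \<subseteq> argmax_on (inner w) \<gamma>"
      using sub \<delta>(1,4,5) unfolding am by (auto simp: times_subset_iff)
    have dims: "dim (dir_space \<delta>) + dim (dir_space l) = dim ?W"
      using F(2) \<delta>(1,4,5)
      by (simp add: aff_dim_dir_space dir_space_Times dim_Times)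
    let ?f = "argmax_on (inner w') \<gamma>"
    have "argmax_on (\<lambda>z. inner w' (?\<pi> z)) (\<gamma> \<times> \<gamma>) = ?f \<times> ?f"
      using argmax_on_pair[of w' 0 \<gamma>] by simp
    then have sf: "\<delta> \<subseteq> ?f" "l \<subseteq> ?f" using w'(2) \<delta>(1,4,5) by (auto simp: times_subset_iff)
    have "?f \<noteq> \<gamma>"
    proof
      assume "?f = \<gamma>"
      moreover have "linear (inner w')" by (auto intro!: linearI simp: inner_add_right)
      ultimately have "inner w' w' = 0"
        using argmax_on_zero_dir_space[of "inner w'" \<gamma> \<gamma> w'] w'(1) by simp
      then show False using nz by simp
    qed
    moreover have "?f face_of \<gamma>" "?f \<noteq> {}" using conv_face[of w'] by (auto simp: faces_def)
    ultimately obtain g where g: "g facet_of \<gamma>" "?f \<subseteq> g"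
      using face_of_polyhedron_subset_facet[OF polytope_imp_polyhedron[OF poly]] by metis
    have "{x + y |x y. x \<in> dir_space \<delta> \<and> y \<in> dir_space l} \<subseteq> dir_space g"
      using dir_space_mono[of \<delta> g] dir_space_mono[of l g] sf g(2)
      by (auto intro!: subspace_add[OF subspace_dir_space])
    then have "dim {x + y |x y. x \<in> dir_space \<delta> \<and> y \<in> dir_space l} \<le> dim (dir_space g)"
      by (rule dim_subset)
    then have "dim {x + y |x y. x \<in> dir_space \<delta> \<and> y \<in> dir_space l} < dim ?W"
      using facet_dim(1)[OF g(1)] by linarith
    then have "1 \<le> dim ?U"
      using dim_sums_Int[OF subspace_dir_space[of \<delta>] subspace_dir_space[of l]] dims by linarith
    moreover have "dim ?U \<le> 1" using dims by (intro line[OF t w f s]) simp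
    ultimately have "dim ?U = 1" by simp
    moreover have "aff_dim \<delta> + aff_dim l = aff_dim \<gamma>"
      using dims \<delta>(4,5) ne by (simp add: aff_dim_dir_space)
    moreover have "\<delta> \<union> l \<subseteq> g" using sf g(2) by blast
    moreover have "t \<in> {0..1}" using t by simp
    ultimately obtain e where "e \<in> ?U" "inner (a + t *\<^sub>R (m - a)) e \<noteq> 0"
      using disc[unfolded avoids_discriminant_def, rule_format, OF f _ g(1)] by metis
    then show False using vanish[OF s] by blast
  qed
  interpret sweep "\<gamma> \<times> \<gamma>" ?\<pi> ?\<phi> ?\<eta> ?W \<omega> product_cochain
  proof (rule sweep.intro)
    show "polytope (\<gamma> \<times> \<gamma>)" by (rule polytope_Times[OF poly poly])
    show "linear ?\<pi>" "linear ?\<phi>" "linear ?\<eta>"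
      by (auto intro!: linearI simp: inner_add_right scaleR_add_right algebra_simps)
    show "?\<pi> ` dir_space (\<gamma> \<times> \<gamma>) \<subseteq> ?W"
      unfolding dir_space_Times[OF ne ne] by (auto intro: subspace_add[OF subspace_dir_space])
    show "product_cochain (F, \<lambda>bs. - \<Theta> bs) = - product_cochain (F, \<Theta>)"
      if "F face_of \<gamma> \<times> \<gamma>" "aff_dim F = int (dim ?W)" "is_orientation (dir_space F) \<Theta>" for F \<Theta>
      using that by (intro product_cochain_uminus[OF \<gamma>(1)]) auto
    show "coboundary product_cochain (G, \<Theta>) = 0"
      if G: "G face_of \<gamma> \<times> \<gamma>" "aff_dim G = int (dim ?W) + 1" "is_orientation (dir_space G) \<Theta>" for G \<Theta>
    proof -
      have "G \<noteq> {}" using G(2) by auto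
      then obtain c d where "G = c \<times> d" "c face_of \<gamma>" "d face_of \<gamma>" "c \<noteq> {}" "d \<noteq> {}"
        using face_of_Times_cases[OF G(1)] by metis
      then show ?thesis
        using product_cochain_closed[of c d] face_in_X[OF \<gamma>(1)] G dimW by simp
    qed
    let ?M = "\<lambda>t w. argmax_on (\<lambda>z. inner w (?\<pi> z) - ?\<phi> z - t * ?\<eta> z) (\<gamma> \<times> \<gamma>)"
    show "z = 0" if "0 \<le> t" "t \<le> 1" "w \<in> ?W" "dim ?W \<le> dim (dir_space (?M t w))"
      "z \<in> dir_space (?M t w)" "?\<eta> z = 0" "?\<pi> z = 0" for t w z
      using trans_main[OF that(1-5) _ that(7)] that(6) by blast
    show "z = 0" if "t = 0 \<or> t = 1" "w \<in> ?W" "dim ?W \<le> dim (dir_space (?M t w))"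
      "z \<in> dir_space (?M t w)" "?\<pi> z = 0" for t w z
    proof -
      have "0 \<le> t" "t \<le> 1" using that(1) by auto
      from trans_main[OF this that(2-4) _ that(5)] show ?thesis using that(1) by blast
    qed
    show "w' = 0" if "F face_of \<gamma> \<times> \<gamma>" "aff_dim F = int (dim ?W)" "0 \<le> t" "t \<le> 1" "w \<in> ?W"
      "F \<subseteq> ?M t w" "w' \<in> ?W" "F \<subseteq> argmax_on (\<lambda>z. inner w' (?\<pi> z)) (\<gamma> \<times> \<gamma>)" for F t w w'
      by (rule ray[OF that])
    show "is_orientation ?W \<omega>" by (rule \<omega>)
  qed (rule subspace_dir_space)
  have "cell_pairs \<gamma> a = selected 0" "cell_pairs \<gamma> m = selected 1"
    unfolding cell_pairs_def selected_def nfaces_def argmax_on_pair am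
    using dimW \<gamma>(2) by auto
  then show ?thesis
    using sum_selected_eq by (simp add: end_term_def pair_term_def)
qed

end

subsection \<open>Generic paths off the discriminant\<close>

text \<open>A small step along \<open>e\<close> leaves the hyperplane orthogonal to \<open>e\<close>
  and preserves the finitely many open conditions already achieved.\<close>

lemma exists_off_hyperplanes:
  fixes a :: "'a::euclidean_space"
  assumes "finite E" "0 \<notin> E" "open U" "a \<in> U"
  obtains m where "m \<in> U" "\<And>e. e \<in> E \<Longrightarrow> inner m e \<noteq> 0"
proof -
  have "\<exists>m\<in>U. \<forall>e\<in>E. inner m e \<noteq> 0"
    using assms(1,2)
  proof (induction E rule: finite_induct)
    case (insert e E)
    then obtain m where m: "m \<in> U" "\<forall>e\<in>E. inner m e \<noteq> 0" by auto
    have t: "((\<lambda>s. m + s *\<^sub>R e) \<longlongrightarrow> m) (at_right 0)"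
      by (auto intro!: tendsto_eq_intros)
    have 1: "\<forall>\<^sub>F s in at_right 0. m + s *\<^sub>R e \<in> U"
      by (rule topological_tendstoD[OF t assms(3) m(1)])
    have "\<forall>\<^sub>F s in at_right 0. inner (m + s *\<^sub>R e) f \<noteq> 0" if "f \<in> E" for f
    proof (rule tendsto_imp_eventually_ne)
      show "((\<lambda>s. inner (m + s *\<^sub>R e) f) \<longlongrightarrow> inner m f) (at_right 0)"
        by (intro tendsto_inner t tendsto_const)
      show "inner m f \<noteq> 0" using m(2) that by blast
    qed
    then have 2: "\<forall>\<^sub>F s in at_right 0. \<forall>f\<in>E. inner (m + s *\<^sub>R e) f \<noteq> 0"
      using insert(1) by (simp add: eventually_ball_finite)
    have e: "inner e e > 0" using insert by simp
    have "\<forall>\<^sub>F s in at_right 0. inner (m + s *\<^sub>R e) e \<noteq> 0"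
    proof (cases "inner m e = 0")
      case True
      have "\<forall>\<^sub>F s::real in at_right 0. 0 < s" by (simp add: eventually_at_right_less)
      then show ?thesis by (rule eventually_mono) (use True e in \<open>auto simp: inner_add_left\<close>)
    next
      case False
      show ?thesis
        by (rule tendsto_imp_eventually_ne[OF _ False]) (intro tendsto_inner t tendsto_const)
    qed
    with 1 2 have "\<forall>\<^sub>F s in at_right 0. m + s *\<^sub>R e \<in> U \<and> (\<forall>f\<in>insert e E. inner (m + s *\<^sub>R e) f \<noteq> 0)"
      by eventually_elim simp
    then show ?case
      using eventually_happens'[OF trivial_limit_at_right_real] by blast
  qed (use assms(4) in auto)
  then show ?thesis using that by blast
qed

text \<open>The kernel of \<open>inner a\<close> on \<open>U\<close> has codimension at most one, so
  it is non-zero once \<open>U\<close> contains a plane.\<close>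

lemma exists_orthogonal_vector:
  fixes a :: "'a::euclidean_space"
  assumes "subspace U" "U \<noteq> {0}"
  shows "\<exists>e\<in>U. e \<noteq> 0 \<and> (2 \<le> dim U \<longrightarrow> inner a e = 0)"
proof -
  obtain x where x: "x \<in> U" "x \<noteq> 0" using assms subspace_0 by blast
  show ?thesis
  proof (cases "2 \<le> dim U \<and> inner a x \<noteq> 0")
    case True
    have "\<not> U \<subseteq> span {x}"
    proof
      assume "U \<subseteq> span {x}"
      then have "dim U \<le> card {x}" by (intro dim_le_card) auto
      with True show False by simp
    qed
    then obtain b where b: "b \<in> U" "b \<notin> span {x}" by blast
    define e where "e = b - (inner a b / inner a x) *\<^sub>R x"
    have "e \<in> U" unfolding e_def using assms(1) b(1) x(1) by (intro subspace_diff subspace_scale)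
    moreover have "e \<noteq> 0"
    proof
      assume "e = 0"
      then have "b = (inner a b / inner a x) *\<^sub>R x" by (simp add: e_def)
      then show False using b(2) by (metis insertI1 span_base span_scale)
    qed
    moreover have "inner a e = 0" using True by (simp add: e_def inner_diff_right)
    ultimately show ?thesis by blast
  qed (use x in blast)
qed

text \<open>The functionals vanishing at \<open>e\<close> form the wall of the triple, which
  \<open>C\<close> avoids; evaluation at \<open>e\<close> is continuous and non-zero on the
  connected set \<open>C\<close> and keeps its sign.\<close>

lemma same_sign_off_discriminant:
  fixes u v :: "'a::euclidean_space \<Rightarrow>\<^sub>L real"
  assumes "C \<in> components (- discriminant X)" "u \<in> C" "v \<in> C"
    and "(\<delta>, l, g) \<in> special_triples X" "e \<in> dir_space \<delta> \<inter> dir_space l" "e \<noteq> 0"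
  shows "blinfun_apply u e * blinfun_apply v e > 0"
proof -
  let ?U = "dir_space \<delta> \<inter> dir_space l"
  have "dim ?U = 1" using assms(4) by (auto simp: special_triples_def)
  then have "span {e} = span ?U"
    using assms(5,6) by (intro dim_eq_span) auto
  moreover have "span ?U = ?U"
    unfolding span_eq_iff by (rule subspace_inter) simp_all
  ultimately have U: "?U = span {e}" by simp
  have nz: "blinfun_apply w e \<noteq> 0" if "w \<in> C" for w
  proof
    assume z: "blinfun_apply w e = 0"
    have "w \<in> ann ?U"
      unfolding U by (auto simp: ann_def span_singleton blinfun.scaleR_right z)
    then have "w \<in> discriminant X" using assms(4) by (force simp: discriminant_def)
    then show False using in_components_subset[OF assms(1)] that by blast
  qed
  have conn: "connected ((\<lambda>w. blinfun_apply w e) ` C)"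
    using in_components_connected[OF assms(1)]
    by (intro connected_continuous_image continuous_intros)
  have "\<not> (blinfun_apply x e \<le> 0 \<and> 0 \<le> blinfun_apply y e)" if "x \<in> C" "y \<in> C" for x y
    using connectedD_interval[OF conn, of "blinfun_apply x e" "blinfun_apply y e" 0] that nz by force
  then show ?thesis
    using assms(2,3) nz by (metis linorder_not_le mult_neg_neg mult_pos_pos nle_le)
qed

context cochain_pair
begin

lemma finite_faces: "c \<in> X \<Longrightarrow> finite (faces c)"
  using finite_polytope_faces[OF polytope_cell] by (auto simp: faces_def intro: finite_subset[rotated])

lemma generic_exists:
  assumes "\<gamma> \<in> X" "open U" "a \<in> U"
  obtains m where "m \<in> U" "generic_for \<gamma> a m" "generic_for \<gamma> b m"
proof -
  let ?U = "\<lambda>(\<delta>, l). dir_space \<delta> \<inter> dir_space l"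
  define S where "S = {s \<in> faces \<gamma> \<times> faces \<gamma>. ?U s \<noteq> {0}}"
  have "finite S" using finite_faces[OF assms(1)] by (simp add: S_def)
  have "\<exists>e. e \<in> ?U s \<and> e \<noteq> 0 \<and> (2 \<le> dim (?U s) \<longrightarrow> inner c e = 0)" if "s \<in> S" for s c
  proof -
    have "subspace (?U s)" by (cases s) (simp add: subspace_inter)
    then show ?thesis using exists_orthogonal_vector[of "?U s" c] that by (auto simp: S_def)
  qed
  then obtain e where e: "\<And>s c. s \<in> S \<Longrightarrow> e s c \<in> ?U s \<and> e s c \<noteq> 0 \<and> (2 \<le> dim (?U s) \<longrightarrow> inner c (e s c) = 0)"
    by metis
  \<comment> \<open>One set of test vectors for both starting points, so that a single
    \<open>m\<close> is generic with respect to each.\<close>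
  define E where "E = (\<lambda>s. e s a) ` S \<union> (\<lambda>s. e s b) ` S"
  have "finite E" using \<open>finite S\<close> by (simp add: E_def)
  moreover have "0 \<notin> E"
  proof
    assume "0 \<in> E"
    then obtain s c where "s \<in> S" "e s c = 0" unfolding E_def by (auto simp: image_iff)
    then show False using e by blast
  qed
  ultimately obtain m where m: "m \<in> U" "\<And>x. x \<in> E \<Longrightarrow> inner m x \<noteq> 0"
    using exists_off_hyperplanes[OF _ _ assms(2,3)] by blast
  have "generic_for \<gamma> c m" if "c = a \<or> c = b" for c
    unfolding generic_for_def
  proof (intro ballI impI)
    fix \<delta> l assume "\<delta> \<in> faces \<gamma>" "l \<in> faces \<gamma>" "dir_space \<delta> \<inter> dir_space l \<noteq> {0}"
    then have s: "(\<delta>, l) \<in> S" by (simp add: S_def)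
    have "inner m (e (\<delta>, l) c) \<noteq> 0" using m(2) s that unfolding E_def by blast
    then show "\<exists>e\<in>dir_space \<delta> \<inter> dir_space l. inner m e \<noteq> 0 \<and>
        (2 \<le> dim (dir_space \<delta> \<inter> dir_space l) \<longrightarrow> inner c e = 0)"
      using e[OF s, of c] by auto
  qed
  then show ?thesis using that m(1) by blast
qed

text \<open>Both products equal the sum of the auxiliary vector \<open>m\<close>, to which
  \<open>cup_sum_path\<close> leads from either side.\<close>

lemma cup_same_component:
  assumes "u \<in> convenient X" "v \<in> convenient X"
    and "C \<in> components (- discriminant X)" "u \<in> C" "v \<in> C"
    and oc: "(\<gamma>, \<omega>) \<in> oriented_cells (p + q) X"
  shows "cup p q u rp rq (\<gamma>, \<omega>) = cup p q v rp rq (\<gamma>, \<omega>)"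
proof -
  have \<gamma>: "\<gamma> \<in> X" "aff_dim \<gamma> = int (p + q)" and \<omega>: "is_orientation (dir_space \<gamma>) \<omega>"
    using oc by (auto simp: oriented_cells_def)
  have ne: "\<gamma> \<noteq> {}" using \<gamma>(2) by auto
  obtain a b where a: "represents \<gamma> a u" and b: "represents \<gamma> b v"
    using represents_exists by metis
  \<comment> \<open>The finitely many pairs whose walls the segments have to miss; each comes from a
    special triple, by adding a common facet.\<close>
  define S where "S = {(\<delta>, l). \<delta> \<in> faces \<gamma> \<and> l \<in> faces \<gamma> \<and>
    (\<exists>g. g facet_of \<gamma> \<and> \<delta> \<union> l \<subseteq> g) \<and> aff_dim \<delta> + aff_dim l = aff_dim \<gamma> \<and>
    dim (dir_space \<delta> \<inter> dir_space l) = 1}"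
  have "S \<subseteq> faces \<gamma> \<times> faces \<gamma>" by (auto simp: S_def)
  then have "finite S" using finite_faces[OF \<gamma>(1)] by (meson finite_SigmaI finite_subset)
  have "\<exists>e. e \<in> dir_space (fst s) \<inter> dir_space (snd s) \<and> inner a e * inner b e > 0" if sS: "s \<in> S" for s
  proof -
    obtain \<delta> l where s: "s = (\<delta>, l)" by (cases s)
    then obtain g where g: "g facet_of \<gamma>" "\<delta> \<union> l \<subseteq> g" and f: "\<delta> \<in> faces \<gamma>" "l \<in> faces \<gamma>"
      and d: "aff_dim \<delta> + aff_dim l = aff_dim \<gamma>" "dim (dir_space \<delta> \<inter> dir_space l) = 1"
      using sS unfolding S_def by blast
    have n: "\<delta> \<noteq> {}" "l \<noteq> {}" using f by (auto simp: faces_def)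
    have X: "\<delta> \<in> X" "l \<in> X" using f face_in_X[OF \<gamma>(1)] by (auto simp: faces_def)
    define p' where "p' = dim (dir_space \<delta>)"
    define q' where "q' = dim (dir_space l)"
    have pq: "aff_dim \<delta> = int p'" "aff_dim l = int q'" "aff_dim \<gamma> = int (p' + q')"
      using d(1) n by (simp_all add: p'_def q'_def aff_dim_dir_space)
    have sub: "\<delta> \<union> l \<subseteq> \<gamma>" using faces_subset f by blast
    have "(\<delta>, l, \<gamma>) \<in> Lambda p' q' X"
      using X \<gamma>(1) pq sub d(2) by (simp add: Lambda_def)
    moreover have "g \<in> faces \<gamma>" "aff_dim g = int (p' + q') - 1"
      using g(1) pq(3) by (auto simp: facet_of_def faces_def)
    ultimately have special: "(\<delta>, l, g) \<in> special_triples X"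
      using d(2) g(2) unfolding special_triples_def by blast
    have "dim {0 :: 'a} = 0" by simp
    then have "dir_space \<delta> \<inter> dir_space l \<noteq> {0}" using d(2) by (metis zero_neq_one)
    then obtain e where e: "e \<in> dir_space \<delta> \<inter> dir_space l" "e \<noteq> 0"
      using exists_orthogonal_vector[OF subspace_inter[OF subspace_dir_space subspace_dir_space]] by metis
    have "e \<in> dir_space \<gamma>" using e(1) dir_space_mono[OF faces_subset[OF f(1)]] by blast
    then have "blinfun_apply u e = inner a e" "blinfun_apply v e = inner b e"
      using a b by (auto simp: represents_def)
    then show ?thesis using same_sign_off_discriminant[OF assms(3-5) special e] e(1) s by auto
  qed
  then obtain e where e: "\<And>s. s \<in> S \<Longrightarrow> e s \<in> dir_space (fst s) \<inter> dir_space (snd s) \<and>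
      inner a (e s) * inner b (e s) > 0" by metis
  \<comment> \<open>Vectors with the same sign as \<open>a\<close>, equivalently as
    \<open>b\<close>, on each special line: an intersection of finitely many open
    half-spaces.\<close>
  define U where "U = (\<Inter>s\<in>S. {m. inner a (e s) * inner m (e s) > 0})"
  have "open U" unfolding U_def
    using \<open>finite S\<close> by (intro open_INT ballI open_Collect_less continuous_intros)
  moreover have "a \<in> U"
  proof -
    have "inner a (e s) \<noteq> 0" if "s \<in> S" for s using e[OF that] by auto
    then show ?thesis by (auto simp: U_def zero_less_mult_iff linorder_neq_iff)
  qed
  ultimately obtain m where m: "m \<in> U" "generic_for \<gamma> a m" "generic_for \<gamma> b m"
    using generic_exists[OF \<gamma>(1)] by metis
  have disc: "avoids_discriminant \<gamma> c m" if "c = a \<or> c = b" for c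
    unfolding avoids_discriminant_def
  proof (intro ballI allI impI)
    fix \<delta> l g and t :: real
    assume *: "\<delta> \<in> faces \<gamma>" "l \<in> faces \<gamma>" "t \<in> {0..1}" "g facet_of \<gamma>" "\<delta> \<union> l \<subseteq> g"
      "aff_dim \<delta> + aff_dim l = aff_dim \<gamma>" "dim (dir_space \<delta> \<inter> dir_space l) = 1"
    then have s: "(\<delta>, l) \<in> S" by (auto simp: S_def)
    define f where "f = e (\<delta>, l)"
    have f: "f \<in> dir_space \<delta> \<inter> dir_space l" "inner a f * inner b f > 0"
      using e[OF s] by (auto simp: f_def)
    have "inner a f * inner m f > 0" using m(1) s by (auto simp: U_def f_def)
    then have cm: "inner c f * inner m f > 0"
      using f(2) that by (auto simp: zero_less_mult_iff)
    have eq: "inner (c + t *\<^sub>R (m - c)) f = (1 - t) * inner c f + t * inner m f"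
      by (simp add: inner_add_left inner_diff_left algebra_simps)
    have t: "0 \<le> t" "t \<le> 1" using *(3) by auto
    have mm: "inner m f * inner m f > 0" using cm by (auto simp: zero_less_mult_iff)
    \<comment> \<open>After multiplication by \<open>inner m f\<close> the values of
      \<open>c\<close> and of \<open>m\<close> at \<open>f\<close> are both positive, so their
      convex combination cannot vanish.\<close>
    have "(1 - t) * x + t * y > 0" if "x > 0" "y > 0" for x y :: real
    proof (cases "t = 0")
      case False
      then show ?thesis using that t by (intro add_nonneg_pos mult_nonneg_nonneg mult_pos_pos) auto
    qed (use that in simp)
    from this[OF cm mm]
    have "0 < (1 - t) * (inner c f * inner m f) + t * (inner m f * inner m f)" .
    also have "(1 - t) * (inner c f * inner m f) + t * (inner m f * inner m f) =
        inner (c + t *\<^sub>R (m - c)) f * inner m f"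
      unfolding eq by (simp add: algebra_simps)
    finally have "inner (c + t *\<^sub>R (m - c)) f \<noteq> 0" by auto
    then show "\<exists>e\<in>dir_space \<delta> \<inter> dir_space l. inner (c + t *\<^sub>R (m - c)) e \<noteq> 0" using f(1) by blast
  qed
  have "cup p q u rp rq (\<gamma>, \<omega>) = (\<Sum>F\<in>cell_pairs \<gamma> m. pair_term \<gamma> \<omega> F)"
    unfolding cup_eq[OF \<gamma> a]
    by (rule cup_sum_path[OF \<gamma> \<omega> convenient_vectorI[OF assms(1) \<gamma>(1) ne a] m(2) disc]) simp
  moreover have "cup p q v rp rq (\<gamma>, \<omega>) = (\<Sum>F\<in>cell_pairs \<gamma> m. pair_term \<gamma> \<omega> F)"
    unfolding cup_eq[OF \<gamma> b]
    by (rule cup_sum_path[OF \<gamma> \<omega> convenient_vectorI[OF assms(2) \<gamma>(1) ne b] m(3) disc]) simp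
  ultimately show ?thesis by simp
qed

end

theorem theorem1:
  fixes X :: "'a::euclidean_space set set"
    and G :: "bit \<Rightarrow> 's::ring set"
    and p q :: nat
    and rp rq :: "('a, 's) cochain"
    and u v :: "'a \<Rightarrow>\<^sub>L real"
    and C :: "('a \<Rightarrow>\<^sub>L real) set"
  assumes "P_complex X"
    and "\<And>c. c \<in> X \<Longrightarrow> compact c"
    and "supercommutative G"
    and "rp \<in> cochains p X" and "rq \<in> cochains q X"
    and "closed_cochain p X rp" and "closed_cochain q X rq"
    and "u \<in> convenient X" and "v \<in> convenient X"
    and "C \<in> components (- discriminant X)"
    and "u \<in> C" and "v \<in> C"
  shows "\<forall>oc\<in>oriented_cells (p + q) X. cup p q u rp rq oc = cup p q v rp rq oc"
proof -
  have "polytope c" if "c \<in> X" for c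
    using that assms(1,2) by (auto simp: P_complex_def polytope_eq_bounded_polyhedron compact_imp_bounded)
  then interpret cochain_pair X p q rp rq
    using assms by unfold_locales auto
  show ?thesis
    using cup_same_component[OF assms(8-12)] by auto
qed

end
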